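(* Let $\Psi\in\mathcal B_0$ be strictly increasing and satisfy the weak lower scaling property with parameters $\underline\mu>0$, $\underline c\in(0,1]$, $\underline\theta\ge0$. Let $\mathcal D\subset\mathbb R^d$ be a bounded domain with regular boundary. Suppose that $V\in L^\infty(\mathbb R^d)$, $V\ge0$, is continuous in a neighbourhood of $\mathcal D$, and $f\in L^p(\mathcal D)$ for some $p\ge 1$ with $p>\frac{d}{2\underline\mu}$. Then there exists a unique weak solution $\varphi\in C(\mathbb R^d)$ of $$H^{\mathcal D,V}\varphi=f\ \text{ in }\mathcal D,\qquad\varphi=0\ \text{ in }\mathcal D^c,$$ that is, a unique $\varphi\in C(\mathbb R^d)$ vanishing on $\mathcal D^c=\mathbb R^d\setminus\mathcal D$ such that for every $t\ge0$ and $x\in\mathcal D$ $$\varphi(x)=\mathbb E^x\big[e^{-\int_0^{t\wedge\tau_{\mathcal D}}V(X_s)ds}\varphi(X_{t\wedge\tau_{\mathcal D}})\big]+\mathbb E^x\Big[\int_0^{t\wedge\tau_{\mathcal D}}e^{-\int_0^sV(X_r)dr}f(X_s)\,ds\Big].$$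
   Context: $\mathcal B_0$ is the set of Bernstein functions $\Psi\in C^\infty((0,\infty))$ with $\Psi\ge0$, $(-1)^n\Psi^{(n)}\le0$ for all integers $n\ge1$, and $\lim_{u\downarrow0}\Psi(u)=0$. Weak lower scaling with parameters $\underline\mu>0,\underline c\in(0,1],\underline\theta\ge0$: $\Psi(\gamma u)\ge\underline c\,\gamma^{\underline\mu}\Psi(u)$ for all $u>\underline\theta$, $\gamma\ge1$. $(X_t)_{t\ge0}$ is the subordinate Brownian motion $X_t=B_{S_t}$ in $\mathbb R^d$, where $B$ is $d$-dimensional Brownian motion with $\mathbb E[e^{i\xi\cdot B_t}]=e^{-t|\xi|^2}$ and $S$ is an independent subordinator with $\mathbb E[e^{-uS_t}]=e^{-t\Psi(u)}$; $X$ is a Lévy process with generator $-\Psi(-\Delta)$. $\mathbb P^x,\mathbb E^x$ refer to $X$ started at $x$. $\tau_{\mathcal D}=\inf\{t>0: X_t\notin\mathcal D\}$. The boundary of $\mathcal D$ is regular if $\mathbb P^z(\tau_{\mathcal D}=0)=1$ for every $z\in\partial\mathcal D$. $H^{\mathcal D,V}=\Psi(-\Delta)+V$ on $\mathcal D$. *)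

theory Defs
  imports "HOL-Probability.Probability"
begin

section \<open>Bernstein functions\<close>

text \<open>
  Functions on \<open>(0, \<infinity>)\<close> are total functions on the reals whose values outside
  \<open>(0, \<infinity>)\<close> are never used; since \<open>(0, \<infinity>)\<close> is open, the iterated
  derivatives at \<open>u > 0\<close> do not depend on these values.
\<close>

definition bernstein0 :: "(real \<Rightarrow> real) \<Rightarrow> bool" where
  "bernstein0 \<Psi> \<longleftrightarrow>
     (\<forall>n::nat. \<forall>u>0. ((deriv ^^ n) \<Psi>) differentiable (at u)) \<and>
     (\<forall>u>0. 0 \<le> \<Psi> u) \<and>
     (\<forall>n\<ge>1. \<forall>u>0. (-1) ^ n * (deriv ^^ n) \<Psi> u \<le> 0) \<and>
     (\<Psi> \<longlongrightarrow> 0) (at_right 0)"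

definition weak_lower_scaling :: "(real \<Rightarrow> real) \<Rightarrow> real \<Rightarrow> real \<Rightarrow> real \<Rightarrow> bool" where
  "weak_lower_scaling \<Psi> \<mu> c \<theta> \<longleftrightarrow>
     (\<forall>u>\<theta>. \<forall>\<gamma>\<ge>1. \<Psi> (\<gamma> * u) \<ge> c * \<gamma> powr \<mu> * \<Psi> u)"

section \<open>Subordinate Brownian motion\<close>

text \<open>Time is indexed by the reals, and only times \<open>t \<ge> 0\<close> matter.\<close>

definition cadlag :: "(real \<Rightarrow> 'a::topological_space) \<Rightarrow> bool" where
  "cadlag x \<longleftrightarrow>
     (\<forall>t\<ge>0. (x \<longlongrightarrow> x t) (at_right t)) \<and>
     (\<forall>t>0. \<exists>l. (x \<longlongrightarrow> l) (at_left t))"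

definition levy_process ::
    "'w measure \<Rightarrow> (real \<Rightarrow> 'w \<Rightarrow> 'a::euclidean_space) \<Rightarrow> bool" where
  "levy_process M X \<longleftrightarrow>
     prob_space M \<and>
     (\<forall>t\<ge>0. X t \<in> borel_measurable M) \<and>
     (AE \<omega> in M. X 0 \<omega> = 0) \<and>
     (\<forall>(t :: nat \<Rightarrow> real) n. 0 \<le> t 0 \<longrightarrow> incseq t \<longrightarrow>
        prob_space.indep_vars M (\<lambda>_. borel)
          (\<lambda>i \<omega>. X (t (Suc i)) \<omega> - X (t i) \<omega>) {..<n}) \<and>
     (\<forall>s\<ge>0. \<forall>h\<ge>0. distr M borel (\<lambda>\<omega>. X (s + h) \<omega> - X s \<omega>) = distr M borel (X h)) \<and>
     (AE \<omega> in M. cadlag (\<lambda>t. X t \<omega>))"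

text \<open>
  Brownian motion started at \<open>0\<close>, run at twice the usual speed: its generator is
  \<open>\<Delta>\<close> and not \<open>\<Delta>/2\<close>.
\<close>

definition brownian_motion ::
    "'w measure \<Rightarrow> (real \<Rightarrow> 'w \<Rightarrow> 'a::euclidean_space) \<Rightarrow> bool" where
  "brownian_motion M B \<longleftrightarrow>
     levy_process M B \<and>
     (AE \<omega> in M. continuous_on {0..} (\<lambda>t. B t \<omega>)) \<and>
     (\<forall>t\<ge>0. \<forall>\<xi>. (CLINT \<omega>|M. iexp (\<xi> \<bullet> B t \<omega>)) = complex_of_real (exp (- t * (norm \<xi>)\<^sup>2)))"

definition subordinator ::
    "'w measure \<Rightarrow> (real \<Rightarrow> real) \<Rightarrow> (real \<Rightarrow> 'w \<Rightarrow> real) \<Rightarrow> bool" where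
  "subordinator M \<Psi> S \<longleftrightarrow>
     levy_process M S \<and>
     (AE \<omega> in M. mono_on {0..} (\<lambda>t. S t \<omega>)) \<and>
     (\<forall>t\<ge>0. \<forall>u>0. (LINT \<omega>|M. exp (- u * S t \<omega>)) = exp (- t * \<Psi> u))"

definition process_events ::
    "'w measure \<Rightarrow> (real \<Rightarrow> 'w \<Rightarrow> 'a::topological_space) \<Rightarrow> 'w set set" where
  "process_events M X =
     sets (vimage_algebra (space M) (\<lambda>\<omega>. \<lambda>t\<in>{0..}. X t \<omega>) (Pi\<^sub>M {0..} (\<lambda>_. borel)))"

text \<open>
  Independence of \<open>B\<close> and \<open>S\<close> is independence of the sigma-algebras generated by the
  whole processes; \<open>indep_var\<close> would force both state spaces to have the same type.
\<close>

definition subordinate_brownian_motion ::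
    "'w measure \<Rightarrow> (real \<Rightarrow> real) \<Rightarrow> (real \<Rightarrow> 'w \<Rightarrow> 'a::euclidean_space) \<Rightarrow> bool" where
  "subordinate_brownian_motion M \<Psi> X \<longleftrightarrow>
     (\<exists>B S. brownian_motion M B \<and> subordinator M \<Psi> S \<and>
        prob_space.indep_set M (process_events M B) (process_events M S) \<and>
        X = (\<lambda>t \<omega>. B (S t \<omega>) \<omega>))"

section \<open>Exit times\<close>

text \<open>The infimum is taken in the extended reals, so that it is \<open>\<infinity>\<close> if there is no exit.\<close>

definition exit_time :: "'a set \<Rightarrow> (real \<Rightarrow> 'a) \<Rightarrow> ereal" where
  "exit_time D x = Inf (ereal ` {t. t > 0 \<and> x t \<notin> D})"

definition stopped_time :: "'a set \<Rightarrow> real \<Rightarrow> (real \<Rightarrow> 'a) \<Rightarrow> real" where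
  "stopped_time D t x = real_of_ereal (min (ereal t) (exit_time D x))"

text \<open>
  \<open>X\<close> is started at \<open>0\<close>. The law of the process started at \<open>x\<close> is that of the
  translated path \<open>path_from X x \<omega>\<close>.
\<close>

definition path_from ::
    "(real \<Rightarrow> 'w \<Rightarrow> 'a::real_vector) \<Rightarrow> 'a \<Rightarrow> 'w \<Rightarrow> real \<Rightarrow> 'a" where
  "path_from X x \<omega> = (\<lambda>t. x + X t \<omega>)"

definition regular_boundary ::
    "'w measure \<Rightarrow> (real \<Rightarrow> 'w \<Rightarrow> 'a::euclidean_space) \<Rightarrow> 'a set \<Rightarrow> bool" where
  "regular_boundary M X D \<longleftrightarrow>
     (\<forall>z\<in>frontier D. AE \<omega> in M. exit_time D (path_from X z \<omega>) = 0)"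

section \<open>Lebesgue spaces\<close>

text \<open>Membership of a representative; elements are identified almost everywhere.\<close>

definition Lp_on :: "real \<Rightarrow> 'a::euclidean_space set \<Rightarrow> ('a \<Rightarrow> real) \<Rightarrow> bool" where
  "Lp_on p D f \<longleftrightarrow>
     set_borel_measurable lebesgue D f \<and> set_integrable lebesgue D (\<lambda>x. \<bar>f x\<bar> powr p)"

definition Linfty :: "('a::euclidean_space \<Rightarrow> real) \<Rightarrow> bool" where
  "Linfty V \<longleftrightarrow> V \<in> borel_measurable lebesgue \<and> (\<exists>C. AE x in lebesgue. \<bar>V x\<bar> \<le> C)"

section \<open>Weak solutions\<close>

definition fk_weight :: "('a \<Rightarrow> real) \<Rightarrow> (real \<Rightarrow> 'a) \<Rightarrow> real \<Rightarrow> real" where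
  "fk_weight V x s = exp (- (LINT r:{0..s}|lebesgue. V (x r)))"

text \<open>
  Expectations are taken over the completion of \<open>M\<close>, because \<open>exit_time\<close> need not be
  measurable with respect to an incomplete \<open>M\<close>. Pathwise integrals are taken with respect
  to the completed Lebesgue measure, so that they do not depend on the representatives of
  \<open>V\<close> and \<open>f\<close>. Since Bochner integrals of non-integrable functions are \<open>0\<close>, the
  existence of the integrals is part of the definition; only values of \<open>f\<close> in \<open>D\<close>
  contribute, as \<open>x s \<in> D\<close> for all \<open>s\<close> strictly before the stopped time.
\<close>

definition weak_solution ::
    "'w measure \<Rightarrow> (real \<Rightarrow> 'w \<Rightarrow> 'a::euclidean_space) \<Rightarrow> 'a set \<Rightarrow> ('a \<Rightarrow> real)
      \<Rightarrow> ('a \<Rightarrow> real) \<Rightarrow> ('a \<Rightarrow> real) \<Rightarrow> bool" where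
  "weak_solution M X D V f \<phi> \<longleftrightarrow>
     continuous_on UNIV \<phi> \<and>
     (\<forall>x. x \<notin> D \<longrightarrow> \<phi> x = 0) \<and>
     (\<forall>t\<ge>0. \<forall>x\<in>D.
        let T = (\<lambda>\<omega>. stopped_time D t (path_from X x \<omega>));
            terminal = (\<lambda>\<omega>. fk_weight V (path_from X x \<omega>) (T \<omega>) * \<phi> (path_from X x \<omega> (T \<omega>)));
            density = (\<lambda>\<omega> s. fk_weight V (path_from X x \<omega>) s * f (path_from X x \<omega> s));
            running = (\<lambda>\<omega>. LINT s:{0..T \<omega>}|lebesgue. density \<omega> s)
        in integrable (completion M) terminal \<and>
           (AE \<omega> in M. set_integrable lebesgue {0..T \<omega>} (density \<omega>)) \<and>
           integrable (completion M) running \<and>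
           \<phi> x = (LINT \<omega>|completion M. terminal \<omega>) + (LINT \<omega>|completion M. running \<omega>))"

end

theory Submission
  imports Defs
begin

text \<open>
  Killing the process on leaving \<open>D\<close> and discounting it by \<open>V\<close> gives a semigroup \<open>Q\<^sub>t\<close>, and the
  candidate solution is \<open>\<phi> = \<integral>\<^sub>0\<^sup>\<infinity> Q\<^sub>s f ds\<close>. The Markov property at deterministic times yields
  \<open>\<phi> = \<integral>\<^sub>0\<^sup>t Q\<^sub>s f ds + Q\<^sub>t \<phi>\<close>, which is the weak formulation once \<open>\<phi> = 0\<close> off \<open>D\<close>.

  Lower scaling and the Chernoff bound control \<open>E S\<^sub>t\<^bsup>-d/2\<^esup>\<close>, hence the density of \<open>X\<^sub>t\<close>, so that
  \<open>\<integral>\<^sub>0\<^sup>t E\<^sup>x |f|(X\<^sub>s) ds\<close> tends to \<open>0\<close> uniformly in \<open>x\<close> as \<open>t \<down> 0\<close>. Inside \<open>D\<close> the function \<open>\<phi>\<close> is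
  therefore a locally uniform limit of the continuous functions \<open>E\<^sup>x \<phi>(X\<^sub>t)\<close>; at a regular boundary
  point the survival probability, an infimum of continuous functions, forces \<open>\<phi>\<close> to vanish.

  The killing time in \<open>Q\<^sub>t\<close> also reacts to left limits in the complement of \<open>D\<close>, which makes it a
  measurable functional of the path; by quasi-left-continuity it is almost surely the exit time.

  The difference of two solutions is bounded by its supremum times the probability that \<open>|X\<^sub>1|\<close> is
  at most the diameter of \<open>D\<close>, which is less than \<open>1\<close>.
\<close>

section \<open>Evaluation of right-continuous paths\<close>

text \<open>Two obstacles shape the argument. \<open>M\<close> may be incomplete, and an event of
  \<open>path_space\<close> depends on countably many times only, so neither the exit time nor
  evaluation at a random time comes as a measurable quantity. Probabilities are therefore taken of
  functionals read off at rational or dyadic times, and the stopped quantities of the weak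
  formulation are reached through almost sure equalities, transported to the completion. The Markov
  property is an identity of laws of concatenated paths at a fixed time; this suffices because
  solutions vanish off \<open>D\<close>, so that stopping at the exit and killing there give the
  same terminal value.

  The condition \<open>p > d / (2 * \<mu>)\<close> enters as follows. For every
  \<open>b > d / (2 * \<mu>)\<close> lower scaling bounds the density of the process at time
  \<open>t\<close> by a constant times \<open>1 + t powr (- b)\<close>; interpolation with the p-th
  power integral of \<open>f\<close> bounds the expectation of \<open>|f|\<close> at time
  \<open>s\<close> by a constant times \<open>1 + s powr (- b / p)\<close>, which is integrable at 0
  when \<open>b < p\<close>.\<close>

definition rgrid :: "nat \<Rightarrow> real \<Rightarrow> real" where
  "rgrid m r = (real (nat \<lfloor>2 ^ m * r\<rfloor>) + 1) / 2 ^ m"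

text \<open>
  Evaluation of a path at a time is not jointly measurable on the product space, but the limit along
  the dyadic times strictly after \<open>r\<close> is, and it agrees with \<open>p r\<close> for right-continuous \<open>p\<close>.
\<close>

definition right_eval :: "(real \<Rightarrow> 'a::euclidean_space) \<Rightarrow> real \<Rightarrow> 'a" where
  "right_eval p r = lim (\<lambda>m. p (rgrid m r))"

text \<open>\<open>nat\<close> sends negative values to 0, so the bound holds for every real
  \<open>r\<close>. Consequently \<open>right_eval p\<close> reads \<open>p\<close> at positive
  times only, whatever time it is given, and does not change when \<open>p\<close> is restricted to
  \<open>{0..}\<close>.\<close>

lemma rgrid_pos: "0 < rgrid m r"
  by (auto simp: rgrid_def field_simps add_pos_nonneg)

lemma rgrid_gt: "0 \<le> r \<Longrightarrow> r < rgrid m r"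
proof -
  assume "0 \<le> r"
  then have "real (nat \<lfloor>2 ^ m * r\<rfloor>) = real_of_int \<lfloor>2 ^ m * r\<rfloor>" by simp
  then show ?thesis unfolding rgrid_def
    using floor_correct[of "2^m * r"] by (simp add: field_simps)
qed

lemma rgrid_le: "0 \<le> r \<Longrightarrow> rgrid m r \<le> r + 1 / 2 ^ m"
proof -
  assume "0 \<le> r"
  then have "real (nat \<lfloor>2 ^ m * r\<rfloor>) = real_of_int \<lfloor>2 ^ m * r\<rfloor>" by simp
  then show ?thesis unfolding rgrid_def
    using floor_correct[of "2^m * r"] by (simp add: field_simps)
qed

lemma rgrid_tendsto: "0 \<le> r \<Longrightarrow> filterlim (\<lambda>m. rgrid m r) (at_right r) sequentially"
proof -
  assume r: "0 \<le> r"
  have "(\<lambda>m. (1/2::real) ^ m) \<longlonglongrightarrow> 0" by (intro LIMSEQ_realpow_zero) auto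
  then have 1: "(\<lambda>m. r + 1 / 2 ^ m) \<longlonglongrightarrow> r"
    using tendsto_add[OF tendsto_const[of r]] by (fastforce simp: power_divide)
  have "(\<lambda>m. rgrid m r) \<longlonglongrightarrow> r"
    by (rule tendsto_sandwich[OF _ _ tendsto_const 1])
       (auto intro!: always_eventually less_imp_le rgrid_gt rgrid_le r)
  then show ?thesis
    using rgrid_gt[OF r] by (simp add: filterlim_at less_imp_neq[symmetric])
qed

lemma right_eval_eq:
  assumes "cadlag p" "0 \<le> r" shows "right_eval p r = p r"
proof -
  have "(p \<longlongrightarrow> p r) (at_right r)" using assms by (auto simp: cadlag_def)
  from filterlim_compose[OF this rgrid_tendsto[OF assms(2)]]
  show ?thesis unfolding right_eval_def by (rule limI)
qed

lemma right_eval_cong: "(\<And>r. 0 \<le> r \<Longrightarrow> p r = q r) \<Longrightarrow> right_eval p = right_eval q"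
  unfolding right_eval_def by (simp add: less_imp_le[OF rgrid_pos])

lemma right_eval_restrict [simp]: "right_eval (restrict p {0..}) = right_eval p"
  by (rule right_eval_cong) simp

abbreviation path_space :: "(real \<Rightarrow> 'a::topological_space) measure" where
  "path_space \<equiv> Pi\<^sub>M {0..} (\<lambda>_. borel)"

text \<open>On each event where the floor of \<open>2 ^ m * R z\<close> has a fixed value the grid
  time is constant, so evaluation is a coordinate projection there; countably many such events cover
  the space, and the limit in \<open>m\<close> stays measurable.\<close>

lemma measurable_right_eval [measurable (raw)]:
  assumes P: "P \<in> measurable N path_space" and [measurable]: "R \<in> borel_measurable N"
  shows "(\<lambda>z. right_eval (P z) (R z)) \<in> borel_measurable N"
  unfolding right_eval_def
proof (rule borel_measurable_lim_metric)
  fix m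
  have *: "(\<lambda>z. P z ((real k + 1) / 2 ^ m)) \<in> borel_measurable N" for k :: nat
    using measurable_compose[OF P measurable_component_singleton[of "(real k + 1) / 2 ^ m" "{0..}"]]
    by simp
  show "(\<lambda>z. P z (rgrid m (R z))) \<in> borel_measurable N"
    unfolding rgrid_def
    by (rule measurable_compose_countable[where f="\<lambda>k z. P z ((real k + 1) / 2 ^ m)"
        and g="\<lambda>z. nat \<lfloor>2 ^ m * R z\<rfloor>"]) (use * in simp, measurable)
qed

text \<open>
  The lower bound on the distance to the complement makes \<open>alive\<close> fail as soon as a left limit
  leaves \<open>D\<close>, even if the path itself stays in \<open>D\<close>. If \<open>D\<close> is the whole space, \<open>infdist\<close> is \<open>0\<close>
  and \<open>alive\<close> is never satisfied.
\<close>

definition alive :: "'a::euclidean_space set \<Rightarrow> (real \<Rightarrow> 'a) \<Rightarrow> real \<Rightarrow> bool" where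
  "alive D p t \<longleftrightarrow> (\<exists>n::nat. \<forall>r\<in>{0..t}. 1 / (Suc n) \<le> infdist (p r) (- D))"

text \<open>Times are written as rational fractions of \<open>t\<close>, so one countable family of
  conditions serves every \<open>t\<close> and the predicate is jointly measurable in path and time.
  The fraction 1 keeps the endpoint \<open>t\<close> itself under control.\<close>

definition alive_rat :: "'a::euclidean_space set \<Rightarrow> (real \<Rightarrow> 'a) \<Rightarrow> real \<Rightarrow> bool" where
  "alive_rat D p t \<longleftrightarrow> (\<exists>n::nat. \<forall>q::rat. of_rat q \<in> {0..1::real} \<longrightarrow> 1 / (Suc n) \<le> infdist (right_eval p (of_rat q * t)) (- D))"

lemma borel_measurable_infdist [measurable]: "(\<lambda>x. infdist x A) \<in> borel_measurable borel"
  by (intro borel_measurable_continuous_onI continuous_intros)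

lemma measurable_alive_rat [measurable (raw)]:
  assumes [measurable]: "P \<in> measurable N path_space" "R \<in> borel_measurable N"
  shows "Measurable.pred N (\<lambda>z. alive_rat D (P z) (R z))"
  unfolding alive_rat_def by measurable

lemma cadlag_right:
  "cadlag p \<Longrightarrow> 0 \<le> t \<Longrightarrow> (p \<longlongrightarrow> p t) (at_right t)"
  by (simp add: cadlag_def)

lemma right_dense_le:
  fixes g :: "real \<Rightarrow> real"
  assumes "(g \<longlongrightarrow> g r) (at_right r)" and "r < t" and "\<And>e. 0 < e \<Longrightarrow> \<exists>s. r < s \<and> s < r + e \<and> c \<le> g s"
  shows "c \<le> g r"
proof (rule ccontr)
  assume "\<not> c \<le> g r"
  then have "g r < c" by simp
  from order_tendstoD(2)[OF assms(1) this] obtain b where "b > r" "\<And>y. r < y \<Longrightarrow> y < b \<Longrightarrow> g y < c"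
    unfolding eventually_at_right_field by blast
  with assms(3)[of "b - r"] show False by force
qed

text \<open>Right-continuity carries the lower bound from the rational fractions of
  \<open>t\<close>, which are dense to the right of every \<open>r < t\<close>, to \<open>r\<close>
  itself; for \<open>r = t\<close> the fraction 1 is used. The margin \<open>1 / Suc n\<close> is
  the same on both sides.\<close>

lemma alive_rat_eq:
  assumes p: "cadlag p" and t: "0 \<le> t"
  shows "alive_rat D p t \<longleftrightarrow> alive D p t"
proof -
  have "(\<forall>q::rat. of_rat q \<in> {0..1::real} \<longrightarrow> c \<le> infdist (right_eval p (of_rat q * t)) (- D)) \<longleftrightarrow> (\<forall>r\<in>{0..t}. c \<le> infdist (p r) (- D))"
    (is "?L \<longleftrightarrow> ?R") for c
  proof
    assume ?R
    show ?L
    proof (intro allI impI)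
      fix q :: rat assume q: "of_rat q \<in> {0..1::real}"
      then have "0 \<le> of_rat q * t" "of_rat q * t \<le> t" using t
        using mult_left_le_one_le[of t "of_rat q"] by (simp_all del: zero_le_of_rat_iff of_rat_le_1_iff)
      with \<open>?R\<close> show "c \<le> infdist (right_eval p (of_rat q * t)) (- D)" by (simp add: right_eval_eq[OF p])
    qed
  next
    assume L: ?L
    have L': "c \<le> infdist (p (of_rat q * t)) (- D)" if "0 \<le> (of_rat q :: real)" "(of_rat q :: real) \<le> 1" for q
      using L[rule_format, of q] that t by (simp add: right_eval_eq[OF p])
    show ?R
    proof
      fix r assume r: "r \<in> {0..t}"
      show "c \<le> infdist (p r) (- D)"
      proof (cases "r = t")
        case True with L'[of 1] show ?thesis by simp
      next
        case False
        with r have rt: "r < t" "0 < t" by auto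
        have "((\<lambda>s. infdist (p s) (- D)) \<longlongrightarrow> infdist (p r) (- D)) (at_right r)"
          using cadlag_right[OF p, of r] r by (auto intro!: tendsto_infdist)
        then show ?thesis
        proof (rule right_dense_le[where t=t])
          fix e :: real assume "0 < e"
          then have "r / t < min (r + e) t / t" using rt by (auto simp: divide_strict_right_mono)
          then obtain q where q: "r / t < of_rat q" "of_rat q < min (r + e) t / t" 
            using of_rat_dense by blast
          then have *: "r < of_rat q * t" "of_rat q * t < r + e" "of_rat q * t < t"
            using rt by (auto simp: field_simps)
          have "0 \<le> (of_rat q :: real)" using q(1) r rt by (meson atLeastAtMost_iff divide_nonneg_pos less_imp_le order_trans)
          moreover have "(of_rat q :: real) \<le> 1" using *(3) rt by auto
          ultimately show "\<exists>s>r. s < r + e \<and> c \<le> infdist (p s) (- D)"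
            using * L'[of q] by auto
        qed (use rt in auto)
      qed
    qed
  qed
  then show ?thesis unfolding alive_def alive_rat_def by simp
qed

section \<open>Translation, shift and concatenation of right-continuous paths\<close>

lemma cadlag_translate: "cadlag p \<Longrightarrow> cadlag (\<lambda>r. (x::'a::euclidean_space) + p r)"
proof -
  assume p: "cadlag p"
  have "\<exists>l. ((\<lambda>r. x + p r) \<longlongrightarrow> l) (at_left t)" if "t > 0" for t
  proof -
    obtain l where "(p \<longlongrightarrow> l) (at_left t)" using p \<open>t > 0\<close> unfolding cadlag_def by blast
    then show ?thesis by (intro exI[of _ "x + l"] tendsto_intros)
  qed
  with p show ?thesis unfolding cadlag_def by (auto intro!: tendsto_intros)
qed

text \<open>The second path is an increment path: it is meant to start at 0, so that both formulas
  agree at time \<open>t\<close>. With an independent copy as \<open>q\<close> this is the process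
  restarted at time \<open>t\<close>.\<close>

definition glue :: "real \<Rightarrow> (real \<Rightarrow> 'a::euclidean_space) \<Rightarrow> (real \<Rightarrow> 'a) \<Rightarrow> real \<Rightarrow> 'a" where
  "glue t p q = (\<lambda>r. if r \<le> t then p r else p t + q (r - t))"

lemma tendsto_shift_right:
  fixes q :: "real \<Rightarrow> 'a::topological_space"
  shows "(q \<longlongrightarrow> l) (at_right (r - t)) \<Longrightarrow> ((\<lambda>s. q (s - t)) \<longlongrightarrow> l) (at_right r)"
  unfolding at_right_to_0[of r] at_right_to_0[of "r-t"] filterlim_filtermap
  by (simp add: algebra_simps)

lemma tendsto_shift_left:
  fixes q :: "real \<Rightarrow> 'a::topological_space"
  shows "(q \<longlongrightarrow> l) (at_left (r - t)) \<Longrightarrow> ((\<lambda>s. q (s - t)) \<longlongrightarrow> l) (at_left r)"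
  unfolding at_left_minus[of r] at_left_minus[of "r-t"] at_right_to_0[of "- r"] at_right_to_0[of "- (r-t)"] filterlim_filtermap
  by (simp add: algebra_simps)

lemma cadlag_shift: 
  assumes "cadlag p" "0 \<le> t" shows "cadlag (\<lambda>r. p (t + r))"
  unfolding cadlag_def
proof (intro conjI allI impI)
  fix r :: real assume "0 \<le> r"
  then show "((\<lambda>r. p (t + r)) \<longlongrightarrow> p (t + r)) (at_right r)"
    using tendsto_shift_right[of p "p (t + r)" r "-t"] assms by (simp add: cadlag_def add.commute)
next
  fix r :: real assume "0 < r"
  then have "0 < t + r" using assms by simp
  then obtain l where "(p \<longlongrightarrow> l) (at_left (t + r))" using assms by (auto simp: cadlag_def)
  then show "\<exists>l. ((\<lambda>r. p (t + r)) \<longlongrightarrow> l) (at_left r)"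
    using tendsto_shift_left[of p l r "-t"] by (auto simp add: add.commute)
qed

lemma cadlag_glue:
  assumes p: "cadlag p" and q: "cadlag q" "q 0 = 0" and t: "0 \<le> t"
  shows "cadlag (glue t p q)"
  unfolding cadlag_def
proof (intro conjI allI impI)
  fix r :: real assume r: "0 \<le> r"
  show "(glue t p q \<longlongrightarrow> glue t p q r) (at_right r)"
  proof (cases "r < t")
    case True
    then have "\<forall>\<^sub>F s in at_right r. glue t p q s = p s"
      unfolding eventually_at_right_field glue_def by (auto intro!: exI[of _ t])
    moreover have "glue t p q r = p r" using True by (simp add: glue_def)
    ultimately show ?thesis using p r by (simp add: cadlag_def filterlim_cong)
  next
    case False
    then have right_eval: "\<forall>\<^sub>F s in at_right r. glue t p q s = p t + q (s - t)"
      unfolding eventually_at_right_field glue_def by (auto intro!: exI[of _ "r + 1"])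
    have "((\<lambda>s. p t + q (s - t)) \<longlongrightarrow> p t + q (r - t)) (at_right r)"
      using q False by (auto intro!: tendsto_intros tendsto_shift_right simp: cadlag_def)
    moreover have "glue t p q r = p t + q (r - t)" using False q by (auto simp: glue_def)
    ultimately show ?thesis using right_eval by (simp add: filterlim_cong)
  qed
next
  fix r :: real assume r: "0 < r"
  show "\<exists>l. (glue t p q \<longlongrightarrow> l) (at_left r)"
  proof (cases "r \<le> t")
    case True
    then have "\<forall>\<^sub>F s in at_left r. glue t p q s = p s"
      unfolding eventually_at_left_field glue_def by (auto intro!: exI[of _ 0] r)
    moreover obtain l where "(p \<longlongrightarrow> l) (at_left r)" using p r by (auto simp: cadlag_def)
    ultimately show ?thesis by (auto simp: filterlim_cong)
  next
    case False
    then have right_eval: "\<forall>\<^sub>F s in at_left r. glue t p q s = p t + q (s - t)"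
      unfolding eventually_at_left_field glue_def by (auto intro!: exI[of _ t])
    obtain l where "(q \<longlongrightarrow> l) (at_left (r - t))" using q(1) False unfolding cadlag_def by (metis diff_gt_0_iff_gt not_le)
    then have "((\<lambda>s. p t + q (s - t)) \<longlongrightarrow> p t + l) (at_left r)"
      by (auto intro!: tendsto_intros tendsto_shift_left)
    then show ?thesis using right_eval by (auto simp: filterlim_cong)
  qed
qed

lemma alive_mono: "alive D p t \<Longrightarrow> s \<le> t \<Longrightarrow> alive D p s"
  unfolding alive_def by fastforce

lemma alive_in:
  assumes "alive D p t" "0 \<le> r" "r \<le> t" shows "p r \<in> D"
proof -
  obtain n where "\<And>r. r\<in>{0..t} \<Longrightarrow> 1 / real (Suc n) \<le> infdist (p r) (- D)"
    using assms unfolding alive_def by blast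
  from this[of r] have "0 < infdist (p r) (- D)"
    using assms by (meson atLeastAtMost_iff less_le_trans of_nat_0_less_iff zero_less_Suc divide_pos_pos zero_less_one)
  then show ?thesis by (metis ComplI infdist_zero less_irrefl)
qed

text \<open>The countable margins of the definition serve measurability, the free margin here serves
  estimates.\<close>

lemma alive_iff_pos: "alive D p t \<longleftrightarrow> (\<exists>e>0. \<forall>r\<in>{0..t}. e \<le> infdist (p r) (- D))"
proof
  assume "\<exists>e>0. \<forall>r\<in>{0..t}. e \<le> infdist (p r) (- D)"
  then obtain e where e: "e>0" "\<forall>r\<in>{0..t}. e \<le> infdist (p r) (- D)" by blast
  obtain n where "inverse (real (Suc n)) < e" using reals_Archimedean e(1) by blast
  then show "alive D p t" using e(2) unfolding alive_def
    by (intro exI[of _ n]) (auto simp: inverse_eq_divide intro: order_trans[OF less_imp_le])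
next
  assume "alive D p t" then show "\<exists>e>0. \<forall>r\<in>{0..t}. e \<le> infdist (p r) (- D)"
    unfolding alive_def by (metis of_nat_0_less_iff zero_less_Suc zero_less_divide_1_iff)
qed

lemma alive_glue:
  assumes q: "q 0 = 0" and t: "0 \<le> t" and s: "0 \<le> s"
  shows "alive D (glue t p q) (t + s) \<longleftrightarrow> alive D p t \<and> alive D (\<lambda>r. p t + q r) s"
proof
  assume "alive D (glue t p q) (t + s)"
  then obtain e where e: "e > 0" "\<forall>r\<in>{0..t+s}. e \<le> infdist (glue t p q r) (- D)"
    unfolding alive_iff_pos by blast
  have "\<forall>r\<in>{0..t}. e \<le> infdist (p r) (- D)"
    using e(2) s by (auto simp: glue_def split: if_splits)
  moreover have "e \<le> infdist (p t + q r) (- D)" if r: "r \<in> {0..s}" for r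
    using e(2)[rule_format, of "t + r"] t r q by (auto simp: glue_def split: if_splits)
  ultimately show "alive D p t \<and> alive D (\<lambda>r. p t + q r) s" unfolding alive_iff_pos using e(1) by blast
next
  assume "alive D p t \<and> alive D (\<lambda>r. p t + q r) s"
  then obtain e1 e2 where e: "e1 > 0" "\<forall>r\<in>{0..t}. e1 \<le> infdist (p r) (- D)"
     "e2 > 0" "\<forall>r\<in>{0..s}. e2 \<le> infdist (p t + q r) (- D)" unfolding alive_iff_pos by blast
  have "min e1 e2 \<le> infdist (glue t p q r) (- D)" if "r\<in>{0..t+s}" for r
    using e(2)[rule_format, of r] e(4)[rule_format, of "r - t"] that
    by (auto simp: glue_def)
  then show "alive D (glue t p q) (t + s)" unfolding alive_iff_pos using e
    by (intro exI[of _ "min e1 e2"]) auto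
qed

section \<open>Gaussian densities and uniqueness of characteristic functions\<close>

text \<open>Density of Brownian motion at time \<open>u\<close> when the generator is the full
  Laplacian: each coordinate has variance \<open>2 * u\<close>.\<close>

definition gauss :: "real \<Rightarrow> 'a::euclidean_space \<Rightarrow> real" where
  "gauss u y = (\<Prod>b\<in>Basis. normal_density 0 (sqrt (2 * u)) (y \<bullet> b))"

abbreviation gaussian :: "real \<Rightarrow> 'a::euclidean_space measure" where
  "gaussian u \<equiv> density lborel (\<lambda>y. ennreal (gauss u y))"

lemma gauss_nonneg [simp]: "0 \<le> gauss u y"
  by (simp add: gauss_def prod_nonneg)

lemma gauss_pos: "0 < u \<Longrightarrow> 0 < gauss u y"
  by (simp add: gauss_def prod_pos normal_density_pos)

lemma gauss_measurable [measurable]: "gauss u \<in> borel_measurable borel"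
  unfolding gauss_def[abs_def] by measurable

lemma gauss_continuous: "0 < u \<Longrightarrow> continuous_on UNIV (gauss u)"
  unfolding gauss_def[abs_def] normal_density_def by (intro continuous_intros) auto

lemma gauss_eq:
  assumes "0 < u"
  shows "gauss u (y::'a::euclidean_space) = (1 / sqrt (4 * pi * u)) ^ DIM('a) * exp (- (norm y)\<^sup>2 / (4 * u))"
proof -
  have "gauss u y = (\<Prod>b\<in>(Basis::'a set). (1 / sqrt (4 * pi * u)) * exp (- (y \<bullet> b)\<^sup>2 / (4 * u)))"
    unfolding gauss_def normal_density_def using assms by (intro prod.cong) (simp_all add: mult.commute mult.left_commute)
  also have "\<dots> = (1 / sqrt (4 * pi * u)) ^ DIM('a) * exp (\<Sum>b\<in>(Basis::'a set). - (y \<bullet> b)\<^sup>2 / (4 * u))"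
    by (simp add: prod_dividef exp_sum power_divide)
  also have "(\<Sum>b\<in>(Basis::'a set). - (y \<bullet> b)\<^sup>2 / (4 * u)) = - (norm y)\<^sup>2 / (4 * u)"
    unfolding sum_divide_distrib[symmetric] sum_negf
    unfolding power2_norm_eq_inner euclidean_inner[of y y] by (simp add: power2_eq_square)
  finally show ?thesis .
qed

lemma gauss_le:
  assumes "0 < u"
  shows "gauss u (y::'a::euclidean_space) \<le> (1 / sqrt (4 * pi * u)) ^ DIM('a)"
  unfolding gauss_eq[OF assms] using assms by (intro mult_left_le) auto

lemma nn_integral_gauss: "0 < u \<Longrightarrow> (\<integral>\<^sup>+y. ennreal (gauss u (y::'a::euclidean_space)) \<partial>lborel) = 1"
proof -
  assume u: "0 < u"
  have "(\<integral>\<^sup>+y. ennreal (normal_density 0 (sqrt (2 * u)) y) \<partial>lborel) = 1"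
    using prob_space.emeasure_space_1[OF prob_space_normal_density[of "sqrt (2*u)" 0]] u
    by (simp add: emeasure_density)
  then show ?thesis
    unfolding gauss_def using nn_integral_lborel_prod[of "\<lambda>(_::'a) x. ennreal (normal_density 0 (sqrt (2 * u)) x)"]
    by (simp add: prod_ennreal)
qed

lemma prob_space_gaussian: "0 < u \<Longrightarrow> prob_space (gaussian u)"
  by (rule prob_spaceI) (simp add: emeasure_density nn_integral_gauss)

lemma integral_lborel_prod:
  fixes f :: "'a::euclidean_space \<Rightarrow> real \<Rightarrow> complex"
  assumes "\<And>b. b \<in> Basis \<Longrightarrow> integrable lborel (f b)"
  shows "(\<integral>x. (\<Prod>b\<in>Basis. f b (x \<bullet> b)) \<partial>lborel) = (\<Prod>b\<in>Basis. (\<integral>x. f b x \<partial>lborel))"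
proof -
  interpret product_sigma_finite "\<lambda>_::'a. lborel :: real measure" ..
  have [measurable]: "b \<in> Basis \<Longrightarrow> f b \<in> borel_measurable borel" for b
    using borel_measurable_integrable[OF assms] by simp
  have "(\<integral>x. (\<Prod>b\<in>Basis. f b (x \<bullet> b)) \<partial>lborel) =
     (\<integral>x. (\<Prod>b\<in>Basis. f b ((\<Sum>b\<in>Basis. x b *\<^sub>R b) \<bullet> b)) \<partial>(\<Pi>\<^sub>M b\<in>(Basis::'a set). lborel))"
    by (subst lborel_eq, subst integral_distr) measurable
  also have "\<dots> = (\<integral>x. (\<Prod>b\<in>Basis. f b (x b)) \<partial>(\<Pi>\<^sub>M b\<in>(Basis::'a set). lborel))"
    by simp
  also have "\<dots> = (\<Prod>b\<in>Basis. (\<integral>x. f b x \<partial>lborel))"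
    using assms by (intro product_integral_prod) auto
  finally show ?thesis .
qed

lemma char_normal_density:
  assumes s: "0 < s"
  shows "(\<integral>x. normal_density 0 s x *\<^sub>R iexp (t * x) \<partial>lborel) = complex_of_real (exp (- (s * t)\<^sup>2 / 2))"
proof -
  have "(\<integral>x. normal_density 0 s x *\<^sub>R iexp (t * x) \<partial>lborel)
     = \<bar>s\<bar> *\<^sub>R (\<integral>x. normal_density 0 s (0 + s * x) *\<^sub>R iexp (t * (0 + s * x)) \<partial>lborel)"
    using s by (intro lborel_integral_real_affine) auto
  also have "\<dots> = (\<integral>x. (s * normal_density 0 s (s * x)) *\<^sub>R iexp (t * (s * x)) \<partial>lborel)"
    using s by (simp flip: integral_scaleR_right)
  also have "\<dots> = (\<integral>x. std_normal_density x *\<^sub>R iexp (s * t * x) \<partial>lborel)"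
    using s by (intro Bochner_Integration.integral_cong refl arg_cong2[where f=scaleR])
       (auto simp: normal_density_def power_mult_distrib real_sqrt_mult mult_ac)
  also have "\<dots> = char std_normal_distribution (s * t)"
    unfolding char_def by (subst integral_density) auto
  also have "\<dots> = complex_of_real (exp (- (s * t)\<^sup>2 / 2))"
    by (simp add: char_std_normal_distribution)
  finally show ?thesis .
qed

lemma char_gaussian:
  assumes u: "0 < u"
  shows "(CLINT y|gaussian u. iexp (\<xi> \<bullet> y)) = complex_of_real (exp (- u * (norm (\<xi>::'a::euclidean_space))\<^sup>2))"
proof -
  have "(CLINT y|gaussian u. iexp (\<xi> \<bullet> y)) = (CLINT y|lborel. gauss u y *\<^sub>R iexp (\<xi> \<bullet> y))"
    by (subst integral_density) auto
  also have "\<dots> = (CLINT y|lborel. (\<Prod>b\<in>Basis. normal_density 0 (sqrt (2 * u)) (y \<bullet> b) *\<^sub>R iexp ((\<xi> \<bullet> b) * (y \<bullet> b))))"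
  proof (intro Bochner_Integration.integral_cong refl)
    fix y :: 'a
    have "iexp (\<xi> \<bullet> y) = (\<Prod>b\<in>(Basis::'a set). iexp ((\<xi> \<bullet> b) * (y \<bullet> b)))"
      unfolding euclidean_inner[of \<xi> y] by (simp add: exp_sum[symmetric] sum_distrib_left)
    then show "gauss u y *\<^sub>R iexp (\<xi> \<bullet> y) = (\<Prod>b\<in>Basis. normal_density 0 (sqrt (2 * u)) (y \<bullet> b) *\<^sub>R iexp ((\<xi> \<bullet> b) * (y \<bullet> b)))"
      by (simp add: gauss_def scaleR_conv_of_real prod.distrib)
  qed
  also have "\<dots> = (\<Prod>b\<in>(Basis::'a set). complex_of_real (exp (- (sqrt (2 * u) * (\<xi> \<bullet> b))\<^sup>2 / 2)))"
  proof (subst integral_lborel_prod)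
    fix b :: 'a
    have "integrable lborel (\<lambda>x. normal_density 0 (sqrt (2 * u)) x)" using u by auto
    then show "integrable lborel (\<lambda>x. normal_density 0 (sqrt (2 * u)) x *\<^sub>R iexp ((\<xi> \<bullet> b) * x))"
      by (rule Bochner_Integration.integrable_bound) (auto simp: norm_mult)
  qed (use u in \<open>simp add: char_normal_density del: of_real_mult\<close>)
  also have "\<dots> = complex_of_real (exp (- u * (norm \<xi>)\<^sup>2))"
    using u unfolding of_real_prod[symmetric] exp_sum[OF finite_Basis, symmetric]
    by (simp add: power2_norm_eq_inner euclidean_inner[of \<xi> \<xi>] power2_eq_square[of "_ \<bullet> _"]
       power_mult_distrib sum_distrib_left sum_negf)
  finally show ?thesis .
qed

section \<open>Gaussian mollification and uniqueness of the characteristic function\<close>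

lemma gaussian_affine:
  fixes F :: "'a::euclidean_space \<Rightarrow> ennreal"
  assumes [measurable]: "F \<in> borel_measurable borel" and c: "0 < c"
  shows "(\<integral>\<^sup>+y. F y * gauss (c\<^sup>2) (y - x) \<partial>lborel) = (\<integral>\<^sup>+w. F (x + c *\<^sub>R w) \<partial>gaussian 1)"
proof -
  have *: "c ^ DIM('a) * gauss (c\<^sup>2) (c *\<^sub>R w) = gauss 1 (w::'a)" for w
    using c by (simp add: gauss_eq real_sqrt_mult power_mult_distrib power_divide)
  have "(\<integral>\<^sup>+y. F y * gauss (c\<^sup>2) (y - x) \<partial>lborel) =
     (\<integral>\<^sup>+w. ennreal (c ^ DIM('a)) * (F (x + c *\<^sub>R w) * gauss (c\<^sup>2) (c *\<^sub>R w)) \<partial>lborel)"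
    using c by (subst lborel_affine[of c x]) (simp_all add: nn_integral_density nn_integral_distr)
  also have "\<dots> = (\<integral>\<^sup>+w. gauss 1 w * F (x + c *\<^sub>R w) \<partial>lborel)"
    using c by (intro nn_integral_cong) (simp add: *[symmetric] ennreal_mult mult_ac)
  also have "\<dots> = (\<integral>\<^sup>+w. F (x + c *\<^sub>R w) \<partial>gaussian 1)"
    by (simp add: nn_integral_density)
  finally show ?thesis .
qed

text \<open>The bump is itself the characteristic function of \<open>gaussian r\<close>. Inserting
  this and exchanging the integrals, whose integrand has modulus 1, leaves an expression in which
  \<open>\<mu>\<close> enters only through its characteristic function.\<close>

lemma integral_exp_eq_of_char_eq:
  fixes \<mu> \<nu> :: "'a::euclidean_space measure"
  assumes "prob_space \<mu>" and s[measurable_cong]: "sets \<mu> = sets borel" and r: "0 < r"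
  shows "complex_of_real (LINT x|\<mu>. exp (- r * (norm (y - x))\<^sup>2)) =
     (CLINT \<xi>|gaussian r. iexp (\<xi> \<bullet> y) * (CLINT x|\<mu>. iexp ((- \<xi>) \<bullet> x)))"
proof -
  interpret \<mu>: prob_space \<mu> by fact
  interpret G: prob_space "gaussian r :: 'a measure" by (rule prob_space_gaussian) fact
  interpret P: pair_prob_space \<mu> "gaussian r :: 'a measure" ..
  have "complex_of_real (LINT x|\<mu>. exp (- r * (norm (y - x))\<^sup>2)) =
    (CLINT x|\<mu>. CLINT \<xi>|gaussian r. iexp ((y - x) \<bullet> \<xi>))"
    by (simp add: char_gaussian[OF r])
  also have "\<dots> = (CLINT \<xi>|gaussian r. CLINT x|\<mu>. iexp ((y - x) \<bullet> \<xi>))"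
  proof (rule P.Fubini_integral[symmetric])
    show "integrable (\<mu> \<Otimes>\<^sub>M gaussian r) (\<lambda>(x, \<xi>). iexp ((y - x) \<bullet> \<xi>))"
      by (rule P.integrable_const_bound[of _ 1]) auto
  qed
  also have "\<dots> = (CLINT \<xi>|gaussian r. iexp (\<xi> \<bullet> y) * (CLINT x|\<mu>. iexp ((- \<xi>) \<bullet> x)))"
    unfolding integral_mult_right_zero[symmetric]
    by (intro Bochner_Integration.integral_cong refl)
       (simp add: exp_add[symmetric] inner_diff_left inner_diff_right algebra_simps inner_commute)
  finally show ?thesis .
qed

lemma continuous_integral_eq_of_char_eq:
  fixes \<mu> \<nu> :: "'a::euclidean_space measure"
  assumes \<mu>: "prob_space \<mu>" and [measurable_cong]: "sets \<mu> = sets borel"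
    and \<nu>: "prob_space \<nu>" and [measurable_cong]: "sets \<nu> = sets borel"
    and eq: "\<And>\<xi>. (CLINT x|\<mu>. iexp (\<xi> \<bullet> x)) = (CLINT x|\<nu>. iexp (\<xi> \<bullet> x))"
    and h: "continuous_on UNIV h" "\<And>x. h x \<le> (1::real)"
  shows "(\<integral>\<^sup>+x. ennreal (h x) \<partial>\<mu>) = (\<integral>\<^sup>+x. ennreal (h x) \<partial>\<nu>)"
proof -
  have [measurable]: "h \<in> borel_measurable borel" using h(1) by (rule borel_measurable_continuous_onI)
  define G where "G = (gaussian 1 :: 'a measure)"
  interpret G: prob_space G unfolding G_def by (rule prob_space_gaussian) simp
  have [measurable_cong]: "sets G = sets borel" by (simp add: G_def)
  \<comment> \<open>Continuity of \<open>h\<close> removes the smoothing as its width tends to 0.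
    The constant 1 dominates, since \<open>ennreal\<close> cuts off negative values.\<close>
  have lim: "(\<lambda>n. \<integral>\<^sup>+x. \<integral>\<^sup>+w. ennreal (h (x + (1 / Suc n) *\<^sub>R w)) \<partial>G \<partial>M) \<longlonglongrightarrow> (\<integral>\<^sup>+x. ennreal (h x) \<partial>M)"
    if "prob_space M" and [measurable_cong]: "sets M = sets borel" for M :: "'a measure"
  proof -
    interpret M: prob_space M by fact
    interpret P: pair_prob_space M G ..
    have 0: "(\<lambda>n. 1 / real (Suc n)) \<longlonglongrightarrow> 0"
      using LIMSEQ_inverse_real_of_nat by (simp add: inverse_eq_divide)
    have "(\<lambda>n. \<integral>\<^sup>+z. (case z of (x, w) \<Rightarrow> ennreal (h (x + (1 / Suc n) *\<^sub>R w))) \<partial>(M \<Otimes>\<^sub>M G))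
        \<longlonglongrightarrow> (\<integral>\<^sup>+z. (case z of (x, w) \<Rightarrow> ennreal (h x)) \<partial>(M \<Otimes>\<^sub>M G))"
    proof (rule nn_integral_dominated_convergence[where w="\<lambda>_. 1"])
      have "(\<lambda>n. h (x + (1 / Suc n) *\<^sub>R w)) \<longlonglongrightarrow> h x" for x w
      proof (rule continuous_on_tendsto_compose[OF h(1)])
        show "(\<lambda>n. x + (1 / Suc n) *\<^sub>R w) \<longlonglongrightarrow> x"
          using tendsto_add[OF tendsto_const[of x] tendsto_scaleR[OF 0 tendsto_const[of w]]] by simp
      qed auto
      then show "AE z in M \<Otimes>\<^sub>M G. (\<lambda>n. case z of (x, w) \<Rightarrow> ennreal (h (x + (1 / Suc n) *\<^sub>R w))) \<longlonglongrightarrow> (case z of (x, w) \<Rightarrow> ennreal (h x))"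
        by (intro AE_I2) (auto intro!: tendsto_ennrealI)
    qed (auto simp: P.emeasure_space_1 h(2))
    then show ?thesis
      by (simp add: G.nn_integral_fst[symmetric] G.emeasure_space_1)
  qed
  have "(\<integral>\<^sup>+x. \<integral>\<^sup>+w. ennreal (h (x + c *\<^sub>R w)) \<partial>G \<partial>\<mu>) = (\<integral>\<^sup>+x. \<integral>\<^sup>+w. ennreal (h (x + c *\<^sub>R w)) \<partial>G \<partial>\<nu>)"
    if c: "0 < c" for c
  proof -
    have e: "(\<integral>\<^sup>+x. ennreal (gauss (c\<^sup>2) (y - x)) \<partial>\<mu>) = (\<integral>\<^sup>+x. ennreal (gauss (c\<^sup>2) (y - x)) \<partial>\<nu>)" for y
    proof -
      \<comment> \<open>Makes the exponent of the bump that of \<open>gauss (c\<^sup>2)\<close>, so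
        that the two differ by the normalising constant only.\<close>
      define r where "r = 1 / (4 * c\<^sup>2)"
      have r: "r > 0" using c by (simp add: r_def)
      have "complex_of_real (LINT x|\<mu>. exp (- r * (norm (y - x))\<^sup>2)) = complex_of_real (LINT x|\<nu>. exp (- r * (norm (y - x))\<^sup>2))"
        using assms r by (simp only: integral_exp_eq_of_char_eq)
      then have *: "(LINT x|\<mu>. exp (- r * (norm (y - x))\<^sup>2)) = (LINT x|\<nu>. exp (- r * (norm (y - x))\<^sup>2))" by simp
      have **: "(\<integral>\<^sup>+x. ennreal (gauss (c\<^sup>2) (y - x)) \<partial>M) =
         ennreal ((1 / sqrt (4 * pi * c\<^sup>2)) ^ DIM('a) * (LINT x|M. exp (- r * (norm (y - x))\<^sup>2)))" 
        if M: "prob_space M" and [measurable_cong]: "sets M = sets borel" for M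
      proof -
        interpret M: prob_space M by fact
        have "integrable M (\<lambda>x. exp (- r * (norm (y - x))\<^sup>2))"
          using r by (intro M.integrable_const_bound[of _ 1]) auto
        then have "(\<integral>\<^sup>+x. ennreal (gauss (c\<^sup>2) (y - x)) \<partial>M) = ennreal (LINT x|M. gauss (c\<^sup>2) (y - x))"
          using c by (intro nn_integral_eq_integral) (auto simp: gauss_eq r_def)
        then show ?thesis using c by (simp add: gauss_eq r_def)
      qed
      show ?thesis using * **[OF \<mu>] **[OF \<nu>] assms by simp
    qed
    have "(\<integral>\<^sup>+x. \<integral>\<^sup>+w. ennreal (h (x + c *\<^sub>R w)) \<partial>G \<partial>M) = (\<integral>\<^sup>+y. ennreal (h y) * (\<integral>\<^sup>+x. ennreal (gauss (c\<^sup>2) (y - x)) \<partial>M) \<partial>lborel)"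
      if M: "prob_space M" and [measurable_cong]: "sets M = sets borel" for M
    proof -
      interpret M: prob_space M by fact
      interpret P: pair_sigma_finite M "lborel :: 'a measure" ..
      have "(\<integral>\<^sup>+x. \<integral>\<^sup>+w. ennreal (h (x + c *\<^sub>R w)) \<partial>G \<partial>M) = (\<integral>\<^sup>+x. \<integral>\<^sup>+y. ennreal (h y) * gauss (c\<^sup>2) (y - x) \<partial>lborel \<partial>M)"
        unfolding G_def by (subst gaussian_affine) (use c in auto)
      also have "\<dots> = (\<integral>\<^sup>+y. \<integral>\<^sup>+x. ennreal (h y) * gauss (c\<^sup>2) (y - x) \<partial>M \<partial>lborel)"
        by (rule P.Fubini'[symmetric]) measurable
      finally show ?thesis by (simp add: nn_integral_cmult)
    qed
    then show ?thesis using assms by (simp add: e)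
  qed
  then have "(\<integral>\<^sup>+x. \<integral>\<^sup>+w. ennreal (h (x + (1 / Suc n) *\<^sub>R w)) \<partial>G \<partial>\<mu>) = (\<integral>\<^sup>+x. \<integral>\<^sup>+w. ennreal (h (x + (1 / Suc n) *\<^sub>R w)) \<partial>G \<partial>\<nu>)" for n
    by simp
  with lim[of \<mu>] lim[of \<nu>] assms show ?thesis using LIMSEQ_unique by auto
qed

text \<open>
  Both measures have the same integrals against Gaussian bumps, since these are Fourier transforms
  of Gaussians; mollifying by bumps of vanishing width recovers all bounded continuous functions.
\<close>

lemma measure_eqI_char:
  fixes \<mu> \<nu> :: "'a::euclidean_space measure"
  assumes \<mu>: "prob_space \<mu>" and s\<mu>[measurable_cong]: "sets \<mu> = sets borel"
    and \<nu>: "prob_space \<nu>" and s\<nu>[measurable_cong]: "sets \<nu> = sets borel"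
    and eq: "\<And>\<xi>. (CLINT x|\<mu>. iexp (\<xi> \<bullet> x)) = (CLINT x|\<nu>. iexp (\<xi> \<bullet> x))"
  shows "\<mu> = \<nu>"
proof (rule measure_eqI_generator_eq[where E="Collect closed" and \<Omega>=UNIV and A="\<lambda>_. UNIV"])
  fix C :: "'a set" assume "C \<in> Collect closed"
  then have C: "closed C" by simp
  show "emeasure \<mu> C = emeasure \<nu> C"
  \<comment> \<open>For the empty set \<open>infdist\<close> is 0, and the approximations below
    would all equal 1.\<close>
  proof (cases "C = {}")
    case False
    define h where "h n x = max 0 (1 - real n * infdist x C)" for n x
    have lim: "(\<lambda>n. \<integral>\<^sup>+x. ennreal (h n x) \<partial>M) \<longlonglongrightarrow> (\<integral>\<^sup>+x. indicator C x \<partial>M)" 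
      if "prob_space M" and [measurable_cong]: "sets M = sets borel" for M
    proof -
      interpret M: prob_space M by fact
      show ?thesis
      proof (rule nn_integral_dominated_convergence[where w="\<lambda>_. 1"])
        show "(\<lambda>x. ennreal (h n x)) \<in> borel_measurable M" for n unfolding h_def by measurable
        have [measurable]: "C \<in> sets borel" using C by simp
        show "indicator C \<in> borel_measurable M" by measurable
        show "AE x in M. (\<lambda>n. ennreal (h n x)) \<longlonglongrightarrow> indicator C x"
        proof (rule AE_I2)
          fix x
          show "(\<lambda>n. ennreal (h n x)) \<longlonglongrightarrow> indicator C x"
          proof (cases "x \<in> C")
            case True then show ?thesis by (simp add: h_def)
          next
            case F: False
            then have pos: "0 < infdist x C" using C False
              by (metis in_closed_iff_infdist_zero infdist_nonneg less_eq_real_def)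
            then obtain N :: nat where N: "1 / infdist x C < real N" using reals_Archimedean2 by blast
            have "h n x = 0" if "n \<ge> N" for n
            proof -
              have "1 \<le> real N * infdist x C" using N pos by (simp add: field_simps)
              also have "\<dots> \<le> real n * infdist x C" using that pos by (intro mult_right_mono) auto
              finally show ?thesis by (simp add: h_def)
            qed
            then have "\<forall>\<^sub>F n in sequentially. ennreal (h n x) = indicator C x"
              using F by (auto simp: eventually_sequentially intro!: exI[of _ N])
            then show ?thesis by (rule tendsto_eventually)
          qed
        qed
        show "AE x in M. ennreal (h n x) \<le> 1" for n by (auto simp: h_def infdist_nonneg)
        show "(\<integral>\<^sup>+x. 1 \<partial>M) < \<infinity>" unfolding nn_integral_const M.emeasure_space_1 by simp
      qed simp
    qed
    have "(\<integral>\<^sup>+x. ennreal (h n x) \<partial>\<mu>) = (\<integral>\<^sup>+x. ennreal (h n x) \<partial>\<nu>)" for n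
      by (rule continuous_integral_eq_of_char_eq[OF assms])
         (auto simp: h_def infdist_nonneg intro!: continuous_intros)
    with lim[OF \<mu> s\<mu>] lim[OF \<nu> s\<nu>] have "(\<integral>\<^sup>+x. indicator C x \<partial>\<mu>) = (\<integral>\<^sup>+x. indicator C x \<partial>\<nu>)"
      using LIMSEQ_unique by auto
    then show ?thesis using C s\<mu> s\<nu> by simp
  qed simp
next
  show "sets \<mu> = sigma_sets UNIV (Collect closed)" "sets \<nu> = sigma_sets UNIV (Collect closed)"
    unfolding s\<mu> s\<nu> by (subst borel_eq_closed, simp)+
  show "emeasure \<mu> UNIV \<noteq> \<infinity>" 
    using prob_space.emeasure_space_1[OF \<mu>] sets_eq_imp_space_eq[OF s\<mu>] by simp
qed (auto simp: Int_stable_def)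

section \<open>The subordinate process\<close>

lemma cadlag_continuous:
  fixes p :: "real \<Rightarrow> 'a::euclidean_space"
  assumes "continuous_on {0..} p" shows "cadlag p"
  unfolding cadlag_def
proof (intro conjI allI impI)
  fix t :: real assume t: "0 \<le> t"
  then have "(p \<longlongrightarrow> p t) (at t within {0..})" using assms by (auto simp: continuous_on_def)
  then show "(p \<longlongrightarrow> p t) (at_right t)" by (rule tendsto_within_subset) (use t in auto)
next
  fix t :: real assume t: "0 < t"
  then have "(p \<longlongrightarrow> p t) (at t within {0..})" using assms by (auto simp: continuous_on_def)
  moreover have "at t within {0..} = at t" using t by (intro at_within_interior) auto
  ultimately show "\<exists>l. (p \<longlongrightarrow> l) (at_left t)"
    by (auto intro: tendsto_within_subset)
qed

lemma cadlag_subordinate: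
  fixes p :: "real \<Rightarrow> 'a::euclidean_space" and s :: "real \<Rightarrow> real"
  assumes p: "continuous_on {0..} p" and s: "cadlag s" "\<And>t. 0 \<le> t \<Longrightarrow> 0 \<le> s t"
  shows "cadlag (\<lambda>t. p (s t))"
proof -
  have c: "((\<lambda>t. p (s t)) \<longlongrightarrow> p l) F" if "(s \<longlongrightarrow> l) F" "0 \<le> l" "\<forall>\<^sub>F t in F. 0 \<le> s t" for l F
    using that by (intro continuous_on_tendsto_compose[OF p]) auto
  show ?thesis unfolding cadlag_def
  proof (intro conjI allI impI)
    fix t :: real assume t: "0 \<le> t"
    show "((\<lambda>t. p (s t)) \<longlongrightarrow> p (s t)) (at_right t)"
    proof (intro c)
      show "(s \<longlongrightarrow> s t) (at_right t)" using s(1) t by (simp add: cadlag_def)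
      show "\<forall>\<^sub>F r in at_right t. 0 \<le> s r"
        unfolding eventually_at_right_field using s(2) t by (meson less_imp_le order_trans less_add_one)
    qed (use s t in simp)
  next
    fix t :: real assume t: "0 < t"
    then obtain l where l: "(s \<longlongrightarrow> l) (at_left t)" using s by (auto simp: cadlag_def)
    have right_eval: "\<forall>\<^sub>F r in at_left t. 0 \<le> s r"
      unfolding eventually_at_left_field using s(2) t by (meson less_imp_le)
    have "0 \<le> l" using l right_eval by (rule tendsto_lowerbound) simp
    from c[OF l this right_eval] show "\<exists>l. ((\<lambda>t. p (s t)) \<longlongrightarrow> l) (at_left t)" by blast
  qed
qed

section \<open>Increments, and the independence of Brownian motion and clock\<close>

lemma nn_integral_cong_AE_imp:
  assumes "AE x in M. P x" "\<And>x. x \<in> space M \<Longrightarrow> P x \<Longrightarrow> f x = g x"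
  shows "(\<integral>\<^sup>+x. f x \<partial>M) = (\<integral>\<^sup>+x. g x \<partial>M)"
  using assms by (intro nn_integral_cong_AE) (auto elim: AE_mp)

lemma levy_processD:
  assumes "levy_process M Z"
  shows "prob_space M" "0 \<le> t \<Longrightarrow> Z t \<in> borel_measurable M" "AE \<omega> in M. Z 0 \<omega> = 0"
    "0 \<le> u 0 \<Longrightarrow> incseq u \<Longrightarrow>
        prob_space.indep_vars M (\<lambda>_. borel) (\<lambda>i \<omega>. Z (u (Suc i)) \<omega> - Z (u i) \<omega>) {..<n::nat}"
    "0 \<le> t \<Longrightarrow> 0 \<le> h \<Longrightarrow> distr M borel (\<lambda>\<omega>. Z (t + h) \<omega> - Z t \<omega>) = distr M borel (Z h)"
    "AE \<omega> in M. cadlag (\<lambda>t. Z t \<omega>)"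
  using assms unfolding levy_process_def by blast+

lemmas levy_process_measurable = levy_processD(2)

text \<open>Independence factorises the product, stationarity replaces every increment by the
  process at the elapsed time. Test functions in \<open>ennreal\<close> avoid questions of
  integrability.\<close>

lemma levy_process_nn_integral:
  fixes Z :: "real \<Rightarrow> 'w \<Rightarrow> 'b::euclidean_space"
  assumes Z: "levy_process M Z" and t: "incseq t" "0 \<le> t (0::nat)"
    and g[measurable]: "\<And>i. i < n \<Longrightarrow> g i \<in> borel_measurable borel"
  shows "(\<integral>\<^sup>+\<omega>. (\<Prod>i<n. g i (Z (t (Suc i)) \<omega> - Z (t i) \<omega>) :: ennreal) \<partial>M) =
    (\<Prod>i<n. \<integral>\<^sup>+\<omega>. g i (Z (t (Suc i) - t i) \<omega>) \<partial>M)"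
proof -
  interpret prob_space M using Z by (rule levy_processD)
  have t0: "0 \<le> t i" for i using t incseqD[OF t(1), of 0 i] by simp
  have tS: "0 \<le> t (Suc i) - t i" for i using incseqD[OF t(1), of i "Suc i"] by simp
  note [measurable] = levy_process_measurable[OF Z]
  have "indep_vars (\<lambda>_. borel) (\<lambda>i \<omega>. Z (t (Suc i)) \<omega> - Z (t i) \<omega>) {..<n}"
    using levy_processD(4)[OF Z t(2,1)] .
  then have "indep_vars (\<lambda>_. borel) (\<lambda>i \<omega>. g i (Z (t (Suc i)) \<omega> - Z (t i) \<omega>)) {..<n}"
    by (rule indep_vars_compose2) auto
  then have "(\<integral>\<^sup>+\<omega>. (\<Prod>i<n. g i (Z (t (Suc i)) \<omega> - Z (t i) \<omega>)) \<partial>M) =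
      (\<Prod>i<n. \<integral>\<^sup>+\<omega>. g i (Z (t (Suc i)) \<omega> - Z (t i) \<omega>) \<partial>M)"
    by (intro indep_vars_nn_integral) auto
  also have "\<dots> = (\<Prod>i<n. \<integral>\<^sup>+\<omega>. g i (Z (t (Suc i) - t i) \<omega>) \<partial>M)"
  proof (intro prod.cong refl)
    fix i assume "i \<in> {..<n}"
    then have [measurable]: "g i \<in> borel_measurable borel" using g by auto
    have m[measurable]: "Z (t (Suc i)) \<in> borel_measurable M" "Z (t i) \<in> borel_measurable M" "Z (t (Suc i) - t i) \<in> borel_measurable M"
      using t0 tS by measurable
    have "distr M borel (\<lambda>\<omega>. Z (t i + (t (Suc i) - t i)) \<omega> - Z (t i) \<omega>) = distr M borel (Z (t (Suc i) - t i))"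
      using levy_processD(5)[OF Z t0[of i] tS[of i]] .
    then have d: "distr M borel (\<lambda>\<omega>. Z (t (Suc i)) \<omega> - Z (t i) \<omega>) = distr M borel (Z (t (Suc i) - t i))" by simp
    have "(\<integral>\<^sup>+x. g i x \<partial>distr M borel (\<lambda>\<omega>. Z (t (Suc i)) \<omega> - Z (t i) \<omega>)) = (\<integral>\<^sup>+x. g i x \<partial>distr M borel (Z (t (Suc i) - t i)))"
      by (simp only: d)
    then show "(\<integral>\<^sup>+\<omega>. g i (Z (t (Suc i)) \<omega> - Z (t i) \<omega>) \<partial>M) = (\<integral>\<^sup>+\<omega>. g i (Z (t (Suc i) - t i) \<omega>) \<partial>M)"
      by (simp add: nn_integral_distr)
  qed
  finally show ?thesis .
qed

lemma brownian_motion_distr: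
  fixes B :: "real \<Rightarrow> 'w \<Rightarrow> 'a::euclidean_space"
  assumes B: "brownian_motion M B" and u: "0 < u"
  shows "distr M borel (B u) = gaussian u"
proof -
  interpret prob_space M using B unfolding brownian_motion_def by (blast intro: levy_processD(1))
  have [measurable]: "B u \<in> borel_measurable M"
    using B u unfolding brownian_motion_def by (blast intro: levy_processD(2) less_imp_le)
  show ?thesis
  proof (rule measure_eqI_char)
    fix \<xi> :: 'a
    have "(CLINT x|distr M borel (B u). iexp (\<xi> \<bullet> x)) = (CLINT \<omega>|M. iexp (\<xi> \<bullet> B u \<omega>))"
      by (subst integral_distr) auto
    also have "\<dots> = complex_of_real (exp (- u * (norm \<xi>)\<^sup>2))"
      using B u unfolding brownian_motion_def by (blast intro: less_imp_le)
    finally show "(CLINT x|distr M borel (B u). iexp (\<xi> \<bullet> x)) = (CLINT y|gaussian u. iexp (\<xi> \<bullet> y))"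
      by (simp add: char_gaussian[OF u])
  qed (auto intro: prob_space_distr prob_space_gaussian u)
qed

definition path_of :: "(real \<Rightarrow> 'w \<Rightarrow> 'b) \<Rightarrow> 'w \<Rightarrow> real \<Rightarrow> 'b" where
  "path_of Z \<omega> = (\<lambda>t\<in>{0..}. Z t \<omega>)"

lemma measurable_path_of:
  assumes "\<And>t. 0 \<le> t \<Longrightarrow> Z t \<in> borel_measurable M"
  shows "path_of Z \<in> measurable M path_space"
  unfolding path_of_def[abs_def] using assms by (intro measurable_restrict) auto

lemma right_eval_path_of: "right_eval (path_of Z \<omega>) = right_eval (\<lambda>t. Z t \<omega>)"
  unfolding path_of_def by simp

locale subordinated_bm =
  fixes M :: "'w measure" and \<Psi> :: "real \<Rightarrow> real"
    and B :: "real \<Rightarrow> 'w \<Rightarrow> 'a::euclidean_space" and S :: "real \<Rightarrow> 'w \<Rightarrow> real"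
  assumes B: "brownian_motion M B" and S: "subordinator M \<Psi> S"
    and indep: "prob_space.indep_set M (process_events M B) (process_events M S)"
begin

lemma levy_B: "levy_process M B" using B unfolding brownian_motion_def by blast
lemma levy_S: "levy_process M S" using S unfolding subordinator_def by blast

sublocale prob_space M using levy_B by (rule levy_processD)

lemmas [measurable] = levy_process_measurable[OF levy_B] levy_process_measurable[OF levy_S]
lemmas path_B [measurable] = measurable_path_of[of B M, OF levy_process_measurable[OF levy_B]]
lemmas path_S [measurable] = measurable_path_of[of S M, OF levy_process_measurable[OF levy_S]]

lemma process_events_path_of:
  assumes "A \<in> sets path_space"
  shows "path_of Z -` A \<inter> space M \<in> process_events M Z"
  unfolding process_events_def path_of_def[abs_def] using assms by (intro in_vimage_algebra) auto

text \<open>Independence of the two generated sigma-algebras says, on rectangles, that the joint law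
  of both paths is a product measure. Tonelli then freezes the clock path and integrates over the
  Brownian path alone.\<close>

lemma nn_integral_indep:
  assumes F[measurable]: "F \<in> borel_measurable (path_space \<Otimes>\<^sub>M path_space)"
  shows "(\<integral>\<^sup>+\<omega>. F (path_of B \<omega>, path_of S \<omega>) \<partial>M) = (\<integral>\<^sup>+\<omega>'. \<integral>\<^sup>+\<omega>. F (path_of B \<omega>, path_of S \<omega>') \<partial>M \<partial>M)"
proof -
  define P1 where "P1 = distr M path_space (path_of B)"
  define P2 where "P2 = distr M path_space (path_of S)"
  interpret P1: prob_space P1 unfolding P1_def by (rule prob_space_distr) measurable
  interpret P2: prob_space P2 unfolding P2_def by (rule prob_space_distr) measurable
  interpret P: pair_prob_space P1 P2 ..
  have s[measurable_cong]: "sets P1 = sets path_space" "sets P2 = sets path_space"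
    by (simp_all add: P1_def P2_def)
  have "P1 \<Otimes>\<^sub>M P2 = distr M (path_space \<Otimes>\<^sub>M path_space) (\<lambda>\<omega>. (path_of B \<omega>, path_of S \<omega>))"
  proof (rule pair_measure_eqI)
    fix A C assume "A \<in> sets P1" "C \<in> sets P2"
    then have AC[measurable]: "A \<in> sets path_space" "C \<in> sets path_space" by (simp_all add: s)
    have "prob ((path_of B -` A \<inter> space M) \<inter> (path_of S -` C \<inter> space M)) =
       prob (path_of B -` A \<inter> space M) * prob (path_of S -` C \<inter> space M)"
      by (rule indep_setD[OF indep]) (auto intro!: process_events_path_of)
    moreover have "(\<lambda>\<omega>. (path_of B \<omega>, path_of S \<omega>)) -` (A \<times> C) \<inter> space M = (path_of B -` A \<inter> space M) \<inter> (path_of S -` C \<inter> space M)" by auto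
    ultimately show "emeasure P1 A * emeasure P2 C =
      emeasure (distr M (path_space \<Otimes>\<^sub>M path_space) (\<lambda>\<omega>. (path_of B \<omega>, path_of S \<omega>))) (A \<times> C)"
      by (simp add: P1_def P2_def emeasure_distr emeasure_eq_measure ennreal_mult)
  qed (auto simp: s P1.sigma_finite_measure_axioms P2.sigma_finite_measure_axioms)
  then have "(\<integral>\<^sup>+\<omega>. F (path_of B \<omega>, path_of S \<omega>) \<partial>M) = integral\<^sup>N (P1 \<Otimes>\<^sub>M P2) F"
    by (simp add: nn_integral_distr)
  also have "\<dots> = (\<integral>\<^sup>+q. \<integral>\<^sup>+p. F (p, q) \<partial>P1 \<partial>P2)"
    by (subst P.nn_integral_snd[symmetric]) (auto cong: measurable_cong_sets simp: s)
  also have "\<dots> = (\<integral>\<^sup>+\<omega>'. \<integral>\<^sup>+p. F (p, path_of S \<omega>') \<partial>P1 \<partial>M)"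
    unfolding P2_def by (subst nn_integral_distr) measurable
  also have "\<dots> = (\<integral>\<^sup>+\<omega>'. \<integral>\<^sup>+\<omega>. F (path_of B \<omega>, path_of S \<omega>') \<partial>M \<partial>M)"
  proof (intro nn_integral_cong)
    fix \<omega>' assume "\<omega>' \<in> space M"
    then have [measurable]: "path_of S \<omega>' \<in> space path_space"
      using measurable_space[OF path_S] by blast
    show "(\<integral>\<^sup>+p. F (p, path_of S \<omega>') \<partial>P1) = (\<integral>\<^sup>+\<omega>. F (path_of B \<omega>, path_of S \<omega>') \<partial>M)"
      unfolding P1_def by (subst nn_integral_distr) measurable
  qed
  finally show ?thesis .
qed

definition good :: "'w \<Rightarrow> bool" where
  "good \<omega> \<longleftrightarrow> continuous_on {0..} (\<lambda>t. B t \<omega>) \<and> B 0 \<omega> = 0 \<and> mono_on {0..} (\<lambda>t. S t \<omega>) \<and> S 0 \<omega> = 0 \<and> cadlag (\<lambda>t. S t \<omega>)"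

lemma AE_good: "AE \<omega> in M. good \<omega>"
proof -
  have "AE \<omega> in M. continuous_on {0..} (\<lambda>t. B t \<omega>)" using B unfolding brownian_motion_def by blast
  moreover have "AE \<omega> in M. B 0 \<omega> = 0" by (rule levy_processD(3)[OF levy_B])
  moreover have "AE \<omega> in M. mono_on {0..} (\<lambda>t. S t \<omega>)" using S unfolding subordinator_def by blast
  moreover have "AE \<omega> in M. S 0 \<omega> = 0" "AE \<omega> in M. cadlag (\<lambda>t. S t \<omega>)" using levy_processD(3,6)[OF levy_S] by simp_all
  ultimately show ?thesis unfolding good_def by eventually_elim simp
qed

lemma good_S_nonneg: "good \<omega> \<Longrightarrow> 0 \<le> t \<Longrightarrow> 0 \<le> S t \<omega>"
  unfolding good_def mono_on_def by force

lemma good_right_eval: "good \<omega> \<Longrightarrow> 0 \<le> u \<Longrightarrow> right_eval (path_of B \<omega>) u = B u \<omega>"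
  unfolding right_eval_path_of by (intro right_eval_eq cadlag_continuous) (auto simp: good_def)

lemma AE_right_eval: "0 \<le> u \<Longrightarrow> AE \<omega> in M. right_eval (path_of B \<omega>) u = B u \<omega>"
  using AE_good by eventually_elim (simp add: good_right_eval)

text \<open>Given the clock, the increments of \<open>B\<close> between successive clock values are
  independent, and their expectations \<open>K i\<close> depend on the elapsed clock time only.
  These elapsed times are increments of \<open>S\<close>, hence themselves independent and
  stationary, so the composition inherits both properties.\<close>

lemma nn_integral_BS:
  fixes g :: "nat \<Rightarrow> 'a \<Rightarrow> ennreal"
  assumes [measurable]: "\<And>i. i < n \<Longrightarrow> g i \<in> borel_measurable borel" and t: "incseq t" "0 \<le> t 0"
  shows "(\<integral>\<^sup>+\<omega>. (\<Prod>i<n. g i (B (S (t (Suc i)) \<omega>) \<omega> - B (S (t i) \<omega>) \<omega>)) \<partial>M) =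
    (\<Prod>i<n. \<integral>\<^sup>+\<omega>. g i (B (S (t (Suc i) - t i) \<omega>) \<omega>) \<partial>M)"
proof -
  have t0: "0 \<le> t i" for i using t incseqD[OF t(1), of 0 i] by simp
  have tS: "0 \<le> t (Suc i) - t i" for i using incseqD[OF t(1), of i "Suc i"] by simp
  \<comment> \<open>\<open>right_eval\<close> in place of \<open>B v\<close> makes
    \<open>K i\<close> measurable in \<open>v\<close>, so that it can be integrated against the law
    of the clock.\<close>
  define K where "K i v = (\<integral>\<^sup>+\<omega>. g i (right_eval (path_of B \<omega>) v) \<partial>M)" for i v
  have K[measurable]: "K i \<in> borel_measurable borel" if "i < n" for i
  proof -
    have [measurable]: "g i \<in> borel_measurable borel" using that by simp
    show ?thesis unfolding K_def[abs_def] by measurable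
  qed
  have KS: "(\<integral>\<^sup>+\<omega>. K i (S r \<omega>) \<partial>M) = (\<integral>\<^sup>+\<omega>. g i (B (S r \<omega>) \<omega>) \<partial>M)" if "i < n" and r: "0 \<le> r" for i r
  proof -
    have [measurable]: "g i \<in> borel_measurable borel" using that by simp
    have "(\<integral>\<^sup>+\<omega>. g i (B (S r \<omega>) \<omega>) \<partial>M) = (\<integral>\<^sup>+\<omega>. g i (right_eval (path_of B \<omega>) (path_of S \<omega> r)) \<partial>M)"
      by (intro nn_integral_cong_AE_imp[OF AE_good]) (use r in \<open>auto simp: path_of_def[of S] good_right_eval good_S_nonneg\<close>)
    also have "\<dots> = (\<integral>\<^sup>+\<omega>'. \<integral>\<^sup>+\<omega>. g i (right_eval (path_of B \<omega>) (path_of S \<omega>' r)) \<partial>M \<partial>M)"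
      using r nn_integral_indep[of "\<lambda>(p, q). g i (right_eval p (q r))"] by simp
    finally show ?thesis using r by (simp add: K_def path_of_def[of S])
  qed
  have "(\<integral>\<^sup>+\<omega>. (\<Prod>i<n. g i (B (S (t (Suc i)) \<omega>) \<omega> - B (S (t i) \<omega>) \<omega>)) \<partial>M) =
    (\<integral>\<^sup>+\<omega>. (\<Prod>i<n. g i (right_eval (path_of B \<omega>) (path_of S \<omega> (t (Suc i))) - right_eval (path_of B \<omega>) (path_of S \<omega> (t i)))) \<partial>M)"
    by (intro nn_integral_cong_AE_imp[OF AE_good]) (auto simp: path_of_def[of S] good_right_eval good_S_nonneg t0)
  also have "\<dots> = (\<integral>\<^sup>+\<omega>'. \<integral>\<^sup>+\<omega>. (\<Prod>i<n. g i (right_eval (path_of B \<omega>) (path_of S \<omega>' (t (Suc i))) - right_eval (path_of B \<omega>) (path_of S \<omega>' (t i)))) \<partial>M \<partial>M)"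
    using t0 nn_integral_indep[of "\<lambda>(p, q). (\<Prod>i<n. g i (right_eval p (q (t (Suc i))) - right_eval p (q (t i))))"] by simp
  also have "\<dots> = (\<integral>\<^sup>+\<omega>'. (\<Prod>i<n. K i (S (t (Suc i)) \<omega>' - S (t i) \<omega>')) \<partial>M)"
  proof (intro nn_integral_cong_AE_imp[OF AE_good])
    fix \<omega>' assume g': "good \<omega>'"
    define u where "u i = S (t i) \<omega>'" for i
    have u: "incseq u" using g' t0 t(1) unfolding good_def mono_on_def incseq_def u_def by auto
    have u0: "0 \<le> u i" for i unfolding u_def using g' t0 by (simp add: good_S_nonneg)
    have uS: "0 \<le> u (Suc i) - u i" for i using incseqD[OF u, of i "Suc i"] by simp
    have "(\<integral>\<^sup>+\<omega>. (\<Prod>i<n. g i (right_eval (path_of B \<omega>) (path_of S \<omega>' (t (Suc i))) - right_eval (path_of B \<omega>) (path_of S \<omega>' (t i)))) \<partial>M) = 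
      (\<integral>\<^sup>+\<omega>. (\<Prod>i<n. g i (B (u (Suc i)) \<omega> - B (u i) \<omega>)) \<partial>M)"
      by (intro nn_integral_cong_AE_imp[OF AE_good])
        (auto simp: path_of_def[of S] good_right_eval u0 t0 u_def[symmetric])
    also have "\<dots> = (\<Prod>i<n. \<integral>\<^sup>+\<omega>. g i (B (u (Suc i) - u i) \<omega>) \<partial>M)"
      using levy_B u u0 by (intro levy_process_nn_integral) auto
    also have "\<dots> = (\<Prod>i<n. K i (u (Suc i) - u i))"
    proof (intro prod.cong refl)
      fix i
      show "(\<integral>\<^sup>+\<omega>. g i (B (u (Suc i) - u i) \<omega>) \<partial>M) = K i (u (Suc i) - u i)"
        unfolding K_def by (rule nn_integral_cong_AE_imp[OF AE_right_eval[OF uS[of i]]]) simp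
    qed
    finally show "(\<integral>\<^sup>+\<omega>. (\<Prod>i<n. g i (right_eval (path_of B \<omega>) (path_of S \<omega>' (t (Suc i))) - right_eval (path_of B \<omega>) (path_of S \<omega>' (t i)))) \<partial>M) =
      (\<Prod>i<n. K i (S (t (Suc i)) \<omega>' - S (t i) \<omega>'))" by (simp add: u_def)
  qed
  also have "\<dots> = (\<Prod>i<n. \<integral>\<^sup>+\<omega>. K i (S (t (Suc i) - t i) \<omega>) \<partial>M)"
    using levy_S t K by (intro levy_process_nn_integral) auto
  also have "\<dots> = (\<Prod>i<n. \<integral>\<^sup>+\<omega>. g i (B (S (t (Suc i) - t i) \<omega>) \<omega>) \<partial>M)"
    using tS by (intro prod.cong refl KS) auto
  finally show ?thesis .
qed

text \<open>Given a positive clock value the law is Gaussian with that time parameter, so the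
  composition is a Gaussian mixture; \<open>pos\<close> excludes an atom at the origin.\<close>

lemma nn_integral_BS_gauss:
  fixes h :: "'a \<Rightarrow> ennreal"
  assumes [measurable]: "h \<in> borel_measurable borel" and t: "0 \<le> t" and pos: "AE \<omega> in M. 0 < S t \<omega>"
  shows "(\<integral>\<^sup>+\<omega>. h (B (S t \<omega>) \<omega>) \<partial>M) = (\<integral>\<^sup>+\<omega>. (\<integral>\<^sup>+y. h y * gauss (S t \<omega>) y \<partial>lborel) \<partial>M)"
proof -
  have "(\<integral>\<^sup>+\<omega>. h (B (S t \<omega>) \<omega>) \<partial>M) = (\<integral>\<^sup>+\<omega>. h (right_eval (path_of B \<omega>) (path_of S \<omega> t)) \<partial>M)"
    by (intro nn_integral_cong_AE_imp[OF AE_good]) (use t in \<open>auto simp: path_of_def[of S] good_right_eval good_S_nonneg\<close>)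
  also have "\<dots> = (\<integral>\<^sup>+\<omega>'. \<integral>\<^sup>+\<omega>. h (right_eval (path_of B \<omega>) (path_of S \<omega>' t)) \<partial>M \<partial>M)"
    using t nn_integral_indep[of "\<lambda>(p, q). h (right_eval p (q t))"] by simp
  also have "\<dots> = (\<integral>\<^sup>+\<omega>. (\<integral>\<^sup>+y. h y * gauss (S t \<omega>) y \<partial>lborel) \<partial>M)"
  proof (intro nn_integral_cong_AE_imp[OF pos])
    fix \<omega>' assume u: "0 < S t \<omega>'"
    have [measurable]: "B (S t \<omega>') \<in> borel_measurable M"
      using u by (intro levy_process_measurable[OF levy_B]) simp
    have "(\<integral>\<^sup>+\<omega>. h (right_eval (path_of B \<omega>) (path_of S \<omega>' t)) \<partial>M) = (\<integral>\<^sup>+\<omega>. h (B (S t \<omega>') \<omega>) \<partial>M)"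
      using t AE_right_eval[of "S t \<omega>'"] u by (intro nn_integral_cong_AE) (auto simp: path_of_def[of S])
    also have "\<dots> = (\<integral>\<^sup>+y. h y \<partial>distr M borel (B (S t \<omega>')))"
      by (simp add: nn_integral_distr)
    also have "\<dots> = (\<integral>\<^sup>+y. h y * gauss (S t \<omega>') y \<partial>lborel)"
      by (simp add: brownian_motion_distr[OF B u] nn_integral_density mult.commute)
    finally show "(\<integral>\<^sup>+\<omega>. h (right_eval (path_of B \<omega>) (path_of S \<omega>' t)) \<partial>M) = (\<integral>\<^sup>+y. h y * gauss (S t \<omega>') y \<partial>lborel)" .
  qed
  finally show ?thesis .
qed

text \<open>Redefining the process to be \<open>0\<close> on a null set makes all its paths right-continuous with left limits.\<close>

definition exceptional :: "'w set" where "exceptional = (SOME N. N \<in> null_sets M \<and> {\<omega>\<in>space M. \<not> good \<omega>} \<subseteq> N)"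

lemma exceptional: "exceptional \<in> null_sets M" "{\<omega>\<in>space M. \<not> good \<omega>} \<subseteq> exceptional"
proof -
  have "\<exists>N. N \<in> null_sets M \<and> {\<omega>\<in>space M. \<not> good \<omega>} \<subseteq> N"
    using AE_good by (auto elim!: AE_E)
  from someI_ex[OF this] show "exceptional \<in> null_sets M" "{\<omega>\<in>space M. \<not> good \<omega>} \<subseteq> exceptional"
    unfolding exceptional_def by auto
qed

definition Y :: "real \<Rightarrow> 'w \<Rightarrow> 'a" where
  "Y t \<omega> = (if \<omega> \<in> space M - exceptional then B (S t \<omega>) \<omega> else 0)"

lemma Y_good: "\<omega> \<in> space M - exceptional \<Longrightarrow> good \<omega>" using exceptional(2) by auto

lemma AE_Y: "AE \<omega> in M. \<forall>t. B (S t \<omega>) \<omega> = Y t \<omega>"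
  by (rule AE_I'[OF exceptional(1)]) (auto simp: Y_def)

text \<open>The time \<open>S t\<close> is random, so measurability of each single
  \<open>B u\<close> says nothing yet. Off the exceptional set the value is
  \<open>right_eval\<close> of the Brownian path, which is jointly measurable in path and
  time.\<close>

lemma Y_measurable [measurable]: "0 \<le> t \<Longrightarrow> Y t \<in> borel_measurable M"
proof -
  assume t: "0 \<le> t"
  have [measurable]: "exceptional \<in> sets M" using exceptional(1) by auto
  have [measurable]: "S t \<in> borel_measurable M" using t by measurable
  have "(\<lambda>\<omega>. if \<omega> \<in> space M - exceptional then right_eval (path_of B \<omega>) (S t \<omega>) else 0) \<in> borel_measurable M"
    by measurable
  then show "Y t \<in> borel_measurable M"
    unfolding Y_def[abs_def] by (rule measurable_cong[THEN iffD1, rotated]) (use t Y_good in \<open>auto simp: good_right_eval good_S_nonneg\<close>)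
qed

lemma Y_cadlag: "cadlag (\<lambda>t. Y t \<omega>)"
proof (cases "\<omega> \<in> space M - exceptional")
  case True
  with Y_good[OF this] show ?thesis using cadlag_subordinate[of "\<lambda>t. B t \<omega>" "\<lambda>t. S t \<omega>"] 
    by (simp add: Y_def good_S_nonneg) (simp add: good_def)
next
  case False
  then show ?thesis by (auto simp: Y_def cadlag_def intro!: exI[of _ 0])
qed

lemma Y_0: "Y 0 \<omega> = 0"
  using Y_good[of \<omega>] by (auto simp: Y_def good_def)

end

section \<open>The Markov property\<close>

text \<open>Rectangles generate the product and are stable under intersection, and their indicators
  are products of indicators; equality of laws then extends to every measurable functional.\<close>

lemma nn_integral_eqI_rectangles:
  fixes U :: "nat \<Rightarrow> 'w \<Rightarrow> 'b::topological_space" and W :: "nat \<Rightarrow> 'v \<Rightarrow> 'b"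
  assumes "prob_space M" "prob_space N"
    and U[measurable]: "\<And>i. i < n \<Longrightarrow> U i \<in> borel_measurable M"
    and W[measurable]: "\<And>i. i < n \<Longrightarrow> W i \<in> borel_measurable N"
    and eq: "\<And>A. (\<And>i. A i \<in> sets borel) \<Longrightarrow>
      (\<integral>\<^sup>+\<omega>. (\<Prod>i<n. indicator (A i) (U i \<omega>) :: ennreal) \<partial>M) = (\<integral>\<^sup>+\<omega>. (\<Prod>i<n. indicator (A i) (W i \<omega>)) \<partial>N)"
    and \<Phi>[measurable]: "\<Phi> \<in> borel_measurable (Pi\<^sub>M {..<n} (\<lambda>_. borel))"
  shows "(\<integral>\<^sup>+\<omega>. \<Phi> (\<lambda>i\<in>{..<n}. U i \<omega>) \<partial>M) = (\<integral>\<^sup>+\<omega>. \<Phi> (\<lambda>i\<in>{..<n}. W i \<omega>) \<partial>N)"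
proof -
  interpret M: prob_space M by fact
  interpret N: prob_space N by fact
  have mU[measurable]: "(\<lambda>\<omega>. \<lambda>i\<in>{..<n}. U i \<omega>) \<in> measurable M (Pi\<^sub>M {..<n} (\<lambda>_. borel))"
    by (intro measurable_restrict) auto
  have mW[measurable]: "(\<lambda>\<omega>. \<lambda>i\<in>{..<n}. W i \<omega>) \<in> measurable N (Pi\<^sub>M {..<n} (\<lambda>_. borel))"
    by (intro measurable_restrict) auto
  define P where "P = distr M (Pi\<^sub>M {..<n} (\<lambda>_. borel)) (\<lambda>\<omega>. \<lambda>i\<in>{..<n}. U i \<omega>)"
  define Q where "Q = distr N (Pi\<^sub>M {..<n} (\<lambda>_. borel)) (\<lambda>\<omega>. \<lambda>i\<in>{..<n}. W i \<omega>)"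
  interpret P: prob_space P unfolding P_def by (rule M.prob_space_distr) measurable
  have "P = Q"
  proof (rule measure_eqI_PiM_finite[where I="{..<n}" and M="\<lambda>_. borel" and A="\<lambda>_. Pi\<^sub>E {..<n} (\<lambda>_. UNIV)"])
    fix A :: "nat \<Rightarrow> 'b set" assume A: "\<And>i. i \<in> {..<n} \<Longrightarrow> A i \<in> sets borel"
    define A' where "A' i = (if i < n then A i else {})" for i
    have A': "A' i \<in> sets borel" for i using A by (auto simp: A'_def)
    have PE[measurable]: "Pi\<^sub>E {..<n} A \<in> sets (Pi\<^sub>M {..<n} (\<lambda>_. borel))"
      using A by (intro sets_PiM_I_finite) auto
    have "(\<Prod>i<n. indicator (A' i) (x i) :: ennreal) = indicator (Pi\<^sub>E {..<n} A) (\<lambda>i\<in>{..<n}. x i)" for x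
    proof (cases "\<forall>i<n. x i \<in> A i")
      case True then show ?thesis by (auto simp: A'_def indicator_def)
    next
      case False then show ?thesis by (auto simp: A'_def indicator_def PiE_iff)
    qed
    note e = this
    have "(\<integral>\<^sup>+\<omega>. (\<Prod>i<n. indicator (A' i) (U i \<omega>) :: ennreal) \<partial>M) = (\<integral>\<^sup>+\<omega>. (\<Prod>i<n. indicator (A' i) (W i \<omega>)) \<partial>N)"
      using A' by (rule eq)
    then show "emeasure P (Pi\<^sub>E {..<n} A) = emeasure Q (Pi\<^sub>E {..<n} A)"
      unfolding e by (simp add: P_def Q_def nn_integral_indicator[symmetric] nn_integral_distr del: nn_integral_indicator)
  next
    show "range (\<lambda>_. Pi\<^sub>E {..<n} (\<lambda>_. UNIV)) \<subseteq> prod_algebra {..<n} (\<lambda>_. borel :: 'b measure)"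
      by (auto intro!: prod_algebraI_finite)
    show "emeasure P (Pi\<^sub>E {..<n} (\<lambda>_. UNIV)) \<noteq> \<infinity>" for i :: nat by simp
  qed (auto simp: P_def Q_def space_PiM)
  then have "integral\<^sup>N P \<Phi> = integral\<^sup>N Q \<Phi>" by simp
  then show ?thesis by (simp add: P_def Q_def nn_integral_distr)
qed

lemma prod_lessThan_add:
  "(\<Prod>i<k + m. f i) = (\<Prod>i<k. f i) * (\<Prod>i<m. f (k + i))" for f :: "nat \<Rightarrow> 'b::comm_monoid_mult"
  by (induction m) (auto simp: mult_ac)

text \<open>With 0 and \<open>t\<close> inserted into \<open>J\<close>, the values of a path on
  \<open>J\<close> become functions of finitely many increments, none of which straddles
  \<open>t\<close>.\<close>

lemma finite_set_grid:
  fixes J :: "real set"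
  assumes "finite J" "J \<subseteq> {0..}" "0 \<le> t"
  obtains u :: "nat \<Rightarrow> real" and k m where "incseq u" "u 0 = 0" "u k = t" "J \<subseteq> u ` {..k + m}"
proof -
  define L where "L = sorted_list_of_set (J \<union> {0, t})"
  define n where "n = length L - 1"
  \<comment> \<open>The last entry is repeated forever, which turns the sorted list into a monotone
    sequence on all of \<open>nat\<close>.\<close>
  define u where "u i = L ! min i n" for i
  have "finite (J \<union> {0, t})" using assms by simp
  then have L: "set L = J \<union> {0, t}" "sorted L"
    unfolding L_def by (simp_all only: set_sorted_list_of_set sorted_sorted_list_of_set)
  have len: "length L = Suc n"
  proof -
    have "L \<noteq> []" using L(1) by auto
    then show ?thesis by (cases L) (auto simp: n_def)
  qed
  have inc: "incseq u"
    unfolding incseq_def u_def using L(2) len by (auto intro!: sorted_nth_mono)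
  have surj: "\<exists>i\<le>n. u i = x" if "x \<in> J \<union> {0, t}" for x
  proof -
    obtain i where "i < length L" "L ! i = x" using \<open>x \<in> _\<close> unfolding L(1)[symmetric] in_set_conv_nth by blast
    then show ?thesis using len by (intro exI[of _ i]) (auto simp: u_def min_def)
  qed
  have "u 0 \<in> set L" unfolding u_def using len by (intro nth_mem) auto
  then have "0 \<le> u 0" using L(1) assms by auto
  moreover obtain i where "u i = 0" using surj[of 0] by auto
  ultimately have "u 0 = 0" using incseqD[OF inc, of 0 i] by simp
  moreover obtain k where k: "k \<le> n" "u k = t" using surj[of t] by auto
  moreover have "J \<subseteq> u ` {..k + (n - k)}" using surj k by force
  ultimately show thesis using that inc by blast
qed

text \<open>The interface for the path arguments: every path, not only almost every one, is
  right-continuous with left limits, and \<open>Y_incr\<close> expresses independent and stationary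
  increments in integrated form. How the process arises from \<open>B\<close> and \<open>S\<close>
  is hidden.\<close>

locale cadlag_levy = prob_space M for M :: "'w measure" +
  fixes Y :: "real \<Rightarrow> 'w \<Rightarrow> 'a::euclidean_space"
  assumes Y_measurable [measurable]: "\<And>t. 0 \<le> t \<Longrightarrow> Y t \<in> borel_measurable M"
    and Y_cadlag: "\<And>\<omega>. cadlag (\<lambda>t. Y t \<omega>)"
    and Y_0 [simp]: "\<And>\<omega>. Y 0 \<omega> = 0"
    and Y_incr: "\<And>(t::nat \<Rightarrow> real) n g. incseq t \<Longrightarrow> 0 \<le> t 0 \<Longrightarrow> (\<And>i. i < n \<Longrightarrow> g i \<in> borel_measurable borel) \<Longrightarrow>
      (\<integral>\<^sup>+\<omega>. (\<Prod>i<n. g i (Y (t (Suc i)) \<omega> - Y (t i) \<omega>) :: ennreal) \<partial>M) =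
        (\<Prod>i<n. \<integral>\<^sup>+\<omega>. g i (Y (t (Suc i) - t i) \<omega>) \<partial>M)"
begin

lemmas path_Y [measurable] = measurable_path_of[of Y M, OF Y_measurable]

lemma right_eval_Y [simp]: "0 \<le> r \<Longrightarrow> right_eval (\<lambda>t. Y t \<omega>) r = Y r \<omega>"
  by (rule right_eval_eq[OF Y_cadlag])

text \<open>The first sample up to time \<open>t\<close>, followed by the increments of an
  independent second sample, as a process on the product space.\<close>

abbreviation Z where "Z t r \<equiv> (\<lambda>(\<omega>, \<omega>'). glue t (\<lambda>r. Y r \<omega>) (\<lambda>r. Y r \<omega>') r)"

lemma Z_measurable: "0 \<le> t \<Longrightarrow> 0 \<le> r \<Longrightarrow> Z t r \<in> borel_measurable (M \<Otimes>\<^sub>M M)"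
proof (cases "r \<le> t")
  case False
  assume t: "0 \<le> t" "0 \<le> r"
  then have [measurable]: "Y t \<in> borel_measurable M" "Y (r - t) \<in> borel_measurable M" using False by auto
  show ?thesis using False unfolding glue_def by simp
next
  case True
  assume t: "0 \<le> t" "0 \<le> r"
  then have [measurable]: "Y r \<in> borel_measurable M" by auto
  show ?thesis using True unfolding glue_def by simp
qed

text \<open>Since \<open>t\<close> is the grid point \<open>u k\<close>, the first \<open>k\<close>
  increments involve only the first sample and the last \<open>m\<close> only the second, so the
  integral over the product space factorises. By stationarity each factor is the one of the original
  process.\<close>

lemma Z_incr:
  assumes t: "0 \<le> t" and u: "incseq u" "u 0 = 0" "u k = t"
    and g[measurable]: "\<And>i. g i \<in> borel_measurable borel"
  shows "(\<integral>\<^sup>+z. (\<Prod>i<k + m. g i (Z t (u (Suc i)) z - Z t (u i) z) :: ennreal) \<partial>(M \<Otimes>\<^sub>M M)) =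
     (\<integral>\<^sup>+\<omega>. (\<Prod>i<k + m. g i (Y (u (Suc i)) \<omega> - Y (u i) \<omega>) :: ennreal) \<partial>M)"
proof -
  have u0: "0 \<le> u i" for i using u incseqD[OF u(1), of 0 i] by simp
  have ut: "i \<le> k \<Longrightarrow> u i \<le> t" for i using incseqD[OF u(1), of i k] u by simp
  have ut': "t \<le> u (k + i)" for i using incseqD[OF u(1), of k "k + i"] u by simp
  have m[measurable]: "Y (u i) \<in> borel_measurable M" "Y (u (k + i) - t) \<in> borel_measurable M" for i
    using u0 ut' by auto
  note m(2)[of "Suc i" for i, unfolded add_Suc_right, measurable]
  have m'[measurable]: "Z t (u i) \<in> borel_measurable (M \<Otimes>\<^sub>M M)" for i using t u0 by (rule Z_measurable)
  have lo: "Z t (u i) (\<omega>, \<omega>') = Y (u i) \<omega>" if "i \<le> k" for i \<omega> \<omega>'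
    using ut[OF that] by (simp add: glue_def)
  have hi: "Z t (u (k + i)) (\<omega>, \<omega>') = Y t \<omega> + Y (u (k + i) - t) \<omega>'" for i \<omega> \<omega>'
    using ut'[of i] by (simp add: glue_def)
  interpret MM: pair_prob_space M M ..
  have "(\<integral>\<^sup>+z. (\<Prod>i<k + m. g i (Z t (u (Suc i)) z - Z t (u i) z)) \<partial>(M \<Otimes>\<^sub>M M)) =
    (\<integral>\<^sup>+\<omega>. \<integral>\<^sup>+\<omega>'. (\<Prod>i<k + m. g i (Z t (u (Suc i)) (\<omega>, \<omega>') - Z t (u i) (\<omega>, \<omega>'))) \<partial>M \<partial>M)"
    by (rule nn_integral_fst[symmetric]) measurable
  also have "\<dots> = (\<integral>\<^sup>+\<omega>. \<integral>\<^sup>+\<omega>'. (\<Prod>i<k. g i (Y (u (Suc i)) \<omega> - Y (u i) \<omega>)) *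
      (\<Prod>i<m. g (k + i) (Y (u (k + Suc i) - t) \<omega>' - Y (u (k + i) - t) \<omega>')) \<partial>M \<partial>M)"
  proof (intro nn_integral_cong)
    fix \<omega> \<omega>'
    have "(\<Prod>i<k. g i (Z t (u (Suc i)) (\<omega>, \<omega>') - Z t (u i) (\<omega>, \<omega>'))) = (\<Prod>i<k. g i (Y (u (Suc i)) \<omega> - Y (u i) \<omega>))"
      by (intro prod.cong refl) (simp only: lo lessThan_iff Suc_leI less_imp_le)
    moreover have "(\<Prod>i<m. g (k + i) (Z t (u (Suc (k + i))) (\<omega>, \<omega>') - Z t (u (k + i)) (\<omega>, \<omega>'))) =
       (\<Prod>i<m. g (k + i) (Y (u (k + Suc i) - t) \<omega>' - Y (u (k + i) - t) \<omega>'))"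
      by (simp only: hi add_Suc_right[symmetric] add_diff_cancel_left)
    ultimately show "(\<Prod>i<k + m. g i (Z t (u (Suc i)) (\<omega>, \<omega>') - Z t (u i) (\<omega>, \<omega>'))) = (\<Prod>i<k. g i (Y (u (Suc i)) \<omega> - Y (u i) \<omega>)) *
      (\<Prod>i<m. g (k + i) (Y (u (k + Suc i) - t) \<omega>' - Y (u (k + i) - t) \<omega>'))"
      by (simp only: prod_lessThan_add)
  qed
  also have "\<dots> = (\<integral>\<^sup>+\<omega>. (\<Prod>i<k. g i (Y (u (Suc i)) \<omega> - Y (u i) \<omega>)) \<partial>M) *
     (\<integral>\<^sup>+\<omega>'. (\<Prod>i<m. g (k + i) (Y (u (k + Suc i) - t) \<omega>' - Y (u (k + i) - t) \<omega>')) \<partial>M)"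
    by (simp add: nn_integral_cmult nn_integral_multc)
  also have "(\<integral>\<^sup>+\<omega>. (\<Prod>i<k. g i (Y (u (Suc i)) \<omega> - Y (u i) \<omega>)) \<partial>M) = (\<Prod>i<k. \<integral>\<^sup>+\<omega>. g i (Y (u (Suc i) - u i) \<omega>) \<partial>M)"
    using u by (intro Y_incr) auto
  also have "(\<integral>\<^sup>+\<omega>'. (\<Prod>i<m. g (k + i) (Y (u (k + Suc i) - t) \<omega>' - Y (u (k + i) - t) \<omega>')) \<partial>M) =
     (\<Prod>i<m. \<integral>\<^sup>+\<omega>. g (k + i) (Y (u (k + Suc i) - t - (u (k + i) - t)) \<omega>) \<partial>M)"
    by (rule Y_incr[where t="\<lambda>i. u (k + i) - t" and g="\<lambda>i. g (k + i)"])
       (use u(1) ut'[of 0] in \<open>auto simp: incseq_def\<close>)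
  also have "(\<Prod>i<k. \<integral>\<^sup>+\<omega>. g i (Y (u (Suc i) - u i) \<omega>) \<partial>M) * \<dots> = (\<Prod>i<k + m. \<integral>\<^sup>+\<omega>. g i (Y (u (Suc i) - u i) \<omega>) \<partial>M)"
    by (simp add: prod_lessThan_add)
  also have "\<dots> = (\<integral>\<^sup>+\<omega>. (\<Prod>i<k + m. g i (Y (u (Suc i)) \<omega> - Y (u i) \<omega>)) \<partial>M)"
    using u by (intro Y_incr[symmetric]) auto
  finally show ?thesis .
qed

text \<open>Partial sums of increments telescope to the path values because the path starts at 0; a
  cylinder condition thus becomes a functional of finitely many increments.\<close>

lemma grid_functional:
  fixes A :: "real \<Rightarrow> 'a set"
  assumes "u 0 = (0::real)" "J \<subseteq> u ` {..n}" "p 0 = (0::'a)"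
  shows "(indicator {p. \<forall>r\<in>J. p r \<in> A r} p :: ennreal) =
    (\<Prod>j\<le>n. indicator (if u j \<in> J then A (u j) else UNIV) (\<Sum>i<j. (\<lambda>i\<in>{..<n}. p (u (Suc i)) - p (u i)) i))"
proof -
  have *: "(\<Sum>i<j. (\<lambda>i\<in>{..<n}. p (u (Suc i)) - p (u i)) i) = p (u j)" if "j \<le> n" for j
  proof -
    have "(\<Sum>i<j. (\<lambda>i\<in>{..<n}. p (u (Suc i)) - p (u i)) i) = (\<Sum>i<j. p (u (Suc i)) - p (u i))"
      using that by (intro sum.cong) auto
    then show ?thesis using sum_lessThan_telescope[of "\<lambda>i. p (u i)" j] assms by simp
  qed
  have "(\<Prod>j\<le>n. indicator (if u j \<in> J then A (u j) else UNIV) (\<Sum>i<j. (\<lambda>i\<in>{..<n}. p (u (Suc i)) - p (u i)) i)) =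
     (\<Prod>j\<le>n. indicator (if u j \<in> J then A (u j) else UNIV) (p (u j)) :: ennreal)"
    by (intro prod.cong refl) (simp only: * atMost_iff)
  also have "\<dots> = indicator {p. \<forall>r\<in>J. p r \<in> A r} p"
  proof (cases "\<forall>r\<in>J. p r \<in> A r")
    case True then show ?thesis by (auto simp: indicator_def intro!: prod.neutral)
  next
    case False
    then obtain r where r: "r \<in> J" "p r \<notin> A r" by blast
    then obtain j where "j \<le> n" "u j = r" using assms(2) by auto
    then show ?thesis using r by (auto simp: indicator_def intro!: bexI[of _ j])
  qed
  finally show ?thesis by simp
qed

text \<open>Cylinder sets determine a law on \<open>path_space\<close>. Each concerns finitely many
  times, and along a grid that contains these times and \<open>t\<close> both processes have the
  same joint law of increments.\<close>

lemma distr_glue: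
  assumes t: "0 \<le> t"
  shows "distr M path_space (path_of Y) = distr (M \<Otimes>\<^sub>M M) path_space (path_of (Z t))"
    (is "?P = ?Q")
proof (rule measure_eqI_PiM_infinite)
  interpret MM: pair_prob_space M M ..
  note [measurable] = measurable_path_of[of "Z t" "M \<Otimes>\<^sub>M M", OF Z_measurable[OF t]]
  show "finite_measure ?P" by (intro finite_measure_distr) measurable
  fix A and J :: "real set" assume J: "finite J" "J \<subseteq> {0..}" and A: "\<And>i. i \<in> J \<Longrightarrow> A i \<in> sets (borel :: 'a measure)"
  obtain u k m where u: "incseq u" "u 0 = 0" "u k = t" "J \<subseteq> u ` {..k + m}"
    using finite_set_grid[OF J t] by blast
  have u0: "0 \<le> u i" for i using u incseqD[OF u(1), of 0 i] by simp
  define \<Phi> :: "(nat \<Rightarrow> 'a) \<Rightarrow> ennreal" where "\<Phi> v = (\<Prod>j\<le>k + m. indicator (if u j \<in> J then A (u j) else UNIV) (\<Sum>i<j. v i))" for v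
  have [measurable]: "(if u j \<in> J then A (u j) else UNIV) \<in> sets borel" for j using A by auto
  have m\<Phi>[measurable]: "\<Phi> \<in> borel_measurable (Pi\<^sub>M {..<k + m} (\<lambda>_. borel))"
    unfolding \<Phi>_def by measurable
  have mY[measurable]: "Y (u i) \<in> borel_measurable M" for i using u0 by auto
  have mZ[measurable]: "Z t (u i) \<in> borel_measurable (M \<Otimes>\<^sub>M M)" for i using t u0 by (rule Z_measurable)
  have s[measurable]: "prod_emb {0..} (\<lambda>_. borel) J (Pi\<^sub>E J A) \<in> sets path_space"
    using J A by (intro sets_PiM_I) auto
  have ind: "indicator (prod_emb {0..} (\<lambda>_. borel) J (Pi\<^sub>E J A)) (path_of X \<omega>) = \<Phi> (\<lambda>i\<in>{..<k+m}. X (u (Suc i)) \<omega> - X (u i) \<omega>)"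
    if "X 0 \<omega> = 0" for X :: "real \<Rightarrow> 'c \<Rightarrow> 'a" and \<omega>
  proof -
    have "indicator (prod_emb {0..} (\<lambda>_. borel) J (Pi\<^sub>E J A)) (path_of X \<omega>) = (indicator {p. \<forall>r\<in>J. p r \<in> A r} (\<lambda>r. X r \<omega>) :: ennreal)"
      using J(2) by (auto simp: indicator_def prod_emb_iff path_of_def PiE_iff)
    also have "\<dots> = \<Phi> (\<lambda>i\<in>{..<k+m}. X (u (Suc i)) \<omega> - X (u i) \<omega>)"
      unfolding \<Phi>_def using u that by (intro grid_functional) auto
    finally show ?thesis .
  qed
  have "emeasure ?P (prod_emb {0..} (\<lambda>_. borel) J (Pi\<^sub>E J A)) = (\<integral>\<^sup>+\<omega>. \<Phi> (\<lambda>i\<in>{..<k+m}. Y (u (Suc i)) \<omega> - Y (u i) \<omega>) \<partial>M)"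
    by (simp add: nn_integral_indicator[symmetric] nn_integral_distr ind del: nn_integral_indicator)
  also have "\<dots> = (\<integral>\<^sup>+z. \<Phi> (\<lambda>i\<in>{..<k+m}. Z t (u (Suc i)) z - Z t (u i) z) \<partial>(M \<Otimes>\<^sub>M M))"
  proof (rule nn_integral_eqI_rectangles)
    fix A :: "nat \<Rightarrow> 'a set" assume "\<And>i. A i \<in> sets borel"
    then show "(\<integral>\<^sup>+\<omega>. (\<Prod>i<k + m. indicator (A i) (Y (u (Suc i)) \<omega> - Y (u i) \<omega>) :: ennreal) \<partial>M) =
      (\<integral>\<^sup>+z. (\<Prod>i<k + m. indicator (A i) (Z t (u (Suc i)) z - Z t (u i) z)) \<partial>(M \<Otimes>\<^sub>M M))"
      by (intro Z_incr[OF t u(1-3), symmetric]) auto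
  qed (use prob_space_axioms MM.prob_space_axioms in auto)
  also have "\<dots> = emeasure ?Q (prod_emb {0..} (\<lambda>_. borel) J (Pi\<^sub>E J A))"
  proof -
    have "Z t 0 z = 0" for z using t by (cases z) (simp add: glue_def)
    then show ?thesis
      by (simp only: nn_integral_indicator[symmetric] sets_distr s)
        (simp add: nn_integral_distr ind del: nn_integral_indicator)
  qed
  finally show "emeasure ?P (prod_emb {0..} (\<lambda>_. borel) J (Pi\<^sub>E J A)) = emeasure ?Q (prod_emb {0..} (\<lambda>_. borel) J (Pi\<^sub>E J A))" .
qed auto

text \<open>The Markov property at a fixed time: the future is replaced by a fresh copy continuing
  from the state at \<open>t\<close>, and the iterated integral takes the role of conditioning on
  the past.\<close>

lemma markov:
  assumes F[measurable]: "F \<in> borel_measurable path_space" and t: "0 \<le> t"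
  shows "(\<integral>\<^sup>+\<omega>. F (path_of Y \<omega>) \<partial>M) =
    (\<integral>\<^sup>+\<omega>. \<integral>\<^sup>+\<omega>'. F (restrict (glue t (\<lambda>r. Y r \<omega>) (\<lambda>r. Y r \<omega>')) {0..}) \<partial>M \<partial>M)"
proof -
  note [measurable] = measurable_path_of[of "Z t" "M \<Otimes>\<^sub>M M", OF Z_measurable[OF t]]
  have "integral\<^sup>N (distr M path_space (path_of Y)) F = integral\<^sup>N (distr (M \<Otimes>\<^sub>M M) path_space (path_of (Z t))) F"
    by (simp only: distr_glue[OF t])
  then have "(\<integral>\<^sup>+\<omega>. F (path_of Y \<omega>) \<partial>M) = (\<integral>\<^sup>+z. F (path_of (Z t) z) \<partial>(M \<Otimes>\<^sub>M M))"
    by (simp add: nn_integral_distr)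
  also have "\<dots> = (\<integral>\<^sup>+\<omega>. \<integral>\<^sup>+\<omega>'. F (path_of (Z t) (\<omega>, \<omega>')) \<partial>M \<partial>M)"
    by (rule nn_integral_fst[symmetric]) measurable
  also have "\<dots> = (\<integral>\<^sup>+\<omega>. \<integral>\<^sup>+\<omega>'. F (restrict (glue t (\<lambda>r. Y r \<omega>) (\<lambda>r. Y r \<omega>')) {0..}) \<partial>M \<partial>M)"
    by (intro nn_integral_cong arg_cong[where f=F]) (simp add: path_of_def)
  finally show ?thesis .
qed

end

lemma (in subordinated_bm) nn_integral_Y_incr:
  fixes g :: "nat \<Rightarrow> 'a \<Rightarrow> ennreal"
  assumes t: "incseq t" "0 \<le> t 0" and g: "\<And>i. i < n \<Longrightarrow> g i \<in> borel_measurable borel"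
  shows "(\<integral>\<^sup>+\<omega>. (\<Prod>i<n. g i (Y (t (Suc i)) \<omega> - Y (t i) \<omega>)) \<partial>M) =
    (\<Prod>i<n. \<integral>\<^sup>+\<omega>. g i (Y (t (Suc i) - t i) \<omega>) \<partial>M)"
proof -
  have "(\<integral>\<^sup>+\<omega>. (\<Prod>i<n. g i (Y (t (Suc i)) \<omega> - Y (t i) \<omega>)) \<partial>M) =
    (\<integral>\<^sup>+\<omega>. (\<Prod>i<n. g i (B (S (t (Suc i)) \<omega>) \<omega> - B (S (t i) \<omega>) \<omega>)) \<partial>M)"
    by (rule nn_integral_cong_AE_imp[OF AE_Y]) simp
  also have "\<dots> = (\<Prod>i<n. \<integral>\<^sup>+\<omega>. g i (B (S (t (Suc i) - t i) \<omega>) \<omega>) \<partial>M)"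
    using g t by (rule nn_integral_BS)
  also have "\<dots> = (\<Prod>i<n. \<integral>\<^sup>+\<omega>. g i (Y (t (Suc i) - t i) \<omega>) \<partial>M)"
    by (intro prod.cong refl nn_integral_cong_AE_imp[OF AE_Y]) simp
  finally show ?thesis .
qed

sublocale subordinated_bm \<subseteq> cadlag_levy M Y
  by unfold_locales (auto simp: Y_cadlag Y_0 Y_measurable nn_integral_Y_incr)

lemma (in prob_space) AE_ex:
  assumes "AE x in M. P x" shows "\<exists>x. P x"
proof (rule ccontr)
  assume "\<not> ?thesis"
  with assms have "AE x in M. False" by simp
  then show False by simp
qed

text \<open>The inequality \<open>x \<le> exp x\<close> at \<open>x = y / b\<close>, raised to the
  power \<open>b\<close> and inverted. It trades the exponential decay of the Laplace transform for
  a power of time.\<close>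

lemma exp_minus_le_powr:
  fixes y b :: real assumes "0 < y" "0 < b" shows "exp (- y) \<le> (y / b) powr (- b)"
proof -
  have "y / b \<le> exp (y / b)" using exp_ge_add_one_self[of "y / b"] by linarith
  then have "(y / b) powr b \<le> exp (y / b) powr b" using assms by (intro powr_mono2) auto
  also have "\<dots> = exp y" using assms by (simp add: powr_def)
  finally have "inverse (exp y) \<le> inverse ((y / b) powr b)"
    using assms by (intro le_imp_inverse_le) auto
  then show ?thesis by (simp add: exp_minus powr_minus)
qed

section \<open>Heat kernel bounds\<close>

text \<open>A dyadic majorant of \<open>s \<mapsto> s\<^bsup>-a\<^esup>\<close> whose expectation reduces to tail probabilities of the subordinator.\<close>

definition small_moment :: "real \<Rightarrow> real \<Rightarrow> ennreal" where
  "small_moment a s = 1 + (\<Sum>n. ennreal (2 powr (a * (real n + 1))) * indicator {..1 / 2 ^ n} s)"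

lemma small_moment_measurable [measurable]: "small_moment a \<in> borel_measurable borel"
  unfolding small_moment_def[abs_def] by measurable

text \<open>Every term of the series is then at least 1. A finite expectation of
  \<open>small_moment a (S t)\<close> therefore shows that the clock is almost surely
  positive.\<close>

lemma small_moment_nonpos:
  assumes "0 \<le> a" "s \<le> 0" shows "small_moment a s = \<infinity>"
proof -
  have "s \<le> 1 / 2 ^ n" for n :: nat using assms(2) by (meson order_trans zero_le_divide_1_iff zero_le_numeral zero_le_power)
  then have "1 \<le> ennreal (2 powr (a * (real n + 1))) * indicator {..1 / 2 ^ n} s" for n
    using assms by (auto simp: ge_one_powr_ge_zero)
  then have "(\<Sum>n. 1 :: ennreal) \<le> (\<Sum>n. ennreal (2 powr (a * (real n + 1))) * indicator {..1 / 2 ^ n} s)"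
    by (intro suminf_le) auto
  moreover have "(\<Sum>n. 1 :: ennreal) = \<infinity>"
  proof (rule ccontr)
    assume "(\<Sum>n. 1 :: ennreal) \<noteq> \<infinity>"
    then have "summable (\<lambda>n::nat. 1 :: real)"
      using summable_suminf_not_top[of "\<lambda>_. 1"] by simp
    then show False by (simp add: summable_const_iff)
  qed
  ultimately show ?thesis by (simp add: small_moment_def top_unique)
qed

lemma small_moment_ge:
  assumes a: "0 \<le> a" and s: "0 < s" shows "ennreal (s powr (- a)) \<le> small_moment a s"
proof (cases "1 < s")
  case True
  then have "s powr (- a) \<le> 1 powr (- a)" using a by (intro powr_mono2') auto
  then have "ennreal (s powr (- a)) \<le> 1" by simp
  also have "\<dots> \<le> small_moment a s" by (simp add: small_moment_def)
  finally show ?thesis .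
next
  case False
  \<comment> \<open>The dyadic level of \<open>s\<close>: \<open>1 / 2 ^ (n + 1) < s\<close> and
    \<open>s \<le> 1 / 2 ^ n\<close>. The term of this level alone dominates the power.\<close>
  define n where "n = nat \<lfloor>- log 2 s\<rfloor>"
  have "0 \<le> - log 2 s" using s False by simp
  then have n: "real n \<le> - log 2 s" "- log 2 s < real n + 1" unfolding n_def by linarith+
  have "log 2 s \<le> - real n" using n by simp
  then have "s \<le> 2 powr (- real n)" using s by (simp add: log_le_iff)
  then have 1: "s \<le> 1 / 2 ^ n" by (simp add: powr_minus powr_realpow inverse_eq_divide)
  have "s powr (- a) = 2 powr (a * (- log 2 s))"
    using s by (simp add: powr_def log_def)
  also have "\<dots> \<le> 2 powr (a * (real n + 1))"
    using n a by (intro powr_mono mult_left_mono) auto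
  finally have "ennreal (s powr (- a)) \<le> ennreal (2 powr (a * (real n + 1))) * indicator {..1 / 2 ^ n} s"
    using 1 by (simp add: ennreal_leI)
  also have "\<dots> \<le> (\<Sum>n. ennreal (2 powr (a * (real n + 1))) * indicator {..1 / 2 ^ n} s)"
    using sum_le_suminf[of "\<lambda>n. ennreal (2 powr (a * (real n + 1))) * indicator {..1 / 2 ^ n} s" "{n}"]
    by (simp del: ennreal_indicator sum_mult_indicator)
  also have "\<dots> \<le> small_moment a s" by (simp add: small_moment_def)
  finally show ?thesis .
qed

text \<open>The peak of the density is \<open>(4 * pi * u) powr (- d / 2)\<close> with
  \<open>d = DIM('a)\<close>; this is where the order \<open>d / 2\<close> of the moment comes
  from.\<close>

lemma gauss_le_small_moment:
  assumes u: "0 < u"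
  shows "ennreal (gauss u (y::'a::euclidean_space)) \<le> small_moment (DIM('a) / 2) u"
proof -
  have "sqrt u \<le> sqrt (4 * pi * u)" using u pi_gt3 by simp
  then have "1 / sqrt (4 * pi * u) \<le> 1 / sqrt u" using u by (intro divide_left_mono) auto
  then have "(1 / sqrt (4 * pi * u)) ^ DIM('a) \<le> (1 / sqrt u) ^ DIM('a)"
    by (intro power_mono) (use u in auto)
  also have "\<dots> = u powr (- (DIM('a) / 2))"
    using u by (simp add: powr_half_sqrt[symmetric] powr_minus powr_powr divide_simps powr_realpow[symmetric] power_one_over)
  finally have "ennreal (gauss u y) \<le> ennreal (u powr (- (DIM('a) / 2)))"
    using gauss_le[OF u, of y] by (intro ennreal_leI) linarith
  also have "\<dots> \<le> small_moment (DIM('a) / 2) u" by (rule small_moment_ge) (use u in auto)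
  finally show ?thesis .
qed

text \<open>Scaling holds only above \<open>\<theta>\<close>, so it is started at
  \<open>u = \<theta> + 1\<close>. For powers of 2 below \<open>u\<close> the factor
  \<open>c * (2 ^ n / u) powr \<mu>\<close> is at most 1 and monotonicity suffices. Strict
  monotonicity gives \<open>\<Psi> 1 > 0\<close>.\<close>

lemma weak_lower_scaling_dyadic:
  assumes psi: "weak_lower_scaling \<Psi> \<mu> c \<theta>" "strict_mono_on {0<..} \<Psi>" "\<And>u. 0 < u \<Longrightarrow> 0 \<le> \<Psi> u"
    and pos: "0 < \<mu>" "0 < c" "c \<le> 1" "0 \<le> \<theta>"
  obtains C where "0 < C" "\<And>n::nat. C * (2 powr \<mu>) ^ n \<le> \<Psi> (2 ^ n)"
proof -
  define u where "u = \<theta> + 1"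
  have u: "1 \<le> u" "\<theta> < u" using pos by (auto simp: u_def)
  have mono: "\<Psi> x \<le> \<Psi> y" if "0 < x" "x \<le> y" for x y
    using strict_mono_on_leD[OF psi(2)] that by auto
  have p1: "0 < \<Psi> 1" 
    using psi(3)[of "1/2"] strict_mono_onD[OF psi(2), of "1/2" 1] by auto
  define C where "C = c * \<Psi> 1 * u powr (- \<mu>)"
  have eq: "(2 powr \<mu>) ^ n = (2 ^ n) powr \<mu>" for n :: nat
    by (simp add: powr_realpow[symmetric] powr_powr mult.commute)
  have dv: "(2 ^ n / u) powr \<mu> = (2 ^ n) powr \<mu> * u powr (- \<mu>)" for n :: nat
    using u by (simp add: powr_divide powr_minus_divide)
  have "C * (2 powr \<mu>) ^ n \<le> \<Psi> (2 ^ n)" for n :: nat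
  proof (cases "u \<le> 2 ^ n")
    case True
    then have "1 \<le> 2 ^ n / u" using u by simp
    then have "c * (2 ^ n / u) powr \<mu> * \<Psi> u \<le> \<Psi> (2 ^ n / u * u)"
      using psi(1) u unfolding weak_lower_scaling_def by blast
    moreover have "c * (2 ^ n / u) powr \<mu> * \<Psi> 1 \<le> c * (2 ^ n / u) powr \<mu> * \<Psi> u"
      using pos u by (intro mult_left_mono mono) auto
    moreover have "c * (2 ^ n / u) powr \<mu> * \<Psi> 1 = C * (2 powr \<mu>) ^ n"
      unfolding eq C_def dv by (simp only: mult_ac)
    ultimately show ?thesis using u by simp
  next
    case False
    then have "(2 ^ n / u) powr \<mu> \<le> 1 powr \<mu>" using pos u by (intro powr_mono2) auto
    then have "c * (2 ^ n / u) powr \<mu> * \<Psi> 1 \<le> 1 * 1 * \<Psi> 1"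
      using pos p1 by (intro mult_mono) auto
    also have "\<dots> \<le> \<Psi> (2 ^ n)" by (simp add: mono)
    finally show ?thesis unfolding eq C_def dv by (simp add: mult_ac)
  qed
  moreover have "0 < C" using pos p1 u by (simp add: C_def)
  ultimately show thesis using that by blast
qed

section \<open>Negative moments of the clock, the strong Feller property and unbounded
  support\<close>

context subordinated_bm
begin

text \<open>Markov's inequality for \<open>exp (- u * S t)\<close>, which is at least
  \<open>exp (- 1)\<close> on the event.\<close>

lemma chernoff:
  assumes t: "0 \<le> t" and u: "0 < u"
  shows "emeasure M {\<omega>\<in>space M. S t \<omega> \<le> 1 / u} \<le> ennreal (exp 1 * exp (- t * \<Psi> u))"
proof -
  have [measurable]: "S t \<in> borel_measurable M" using t by measurable
  have L: "(LINT \<omega>|M. exp (- u * S t \<omega>)) = exp (- t * \<Psi> u)"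
    using S t u unfolding subordinator_def by blast
  \<comment> \<open>The Bochner integral of a non-integrable function would be 0, but the Laplace
    transform is positive.\<close>
  then have int: "integrable M (\<lambda>\<omega>. exp (- u * S t \<omega>))"
    by (metis exp_not_eq_zero not_integrable_integral_eq)
  have "emeasure M {\<omega>\<in>space M. S t \<omega> \<le> 1 / u} = (\<integral>\<^sup>+\<omega>. indicator {\<omega>\<in>space M. S t \<omega> \<le> 1 / u} \<omega> \<partial>M)"
    by simp
  also have "\<dots> \<le> (\<integral>\<^sup>+\<omega>. ennreal (exp 1 * exp (- u * S t \<omega>)) \<partial>M)"
  proof (intro nn_integral_mono)
    fix \<omega>
    show "indicator {\<omega>\<in>space M. S t \<omega> \<le> 1 / u} \<omega> \<le> ennreal (exp 1 * exp (- u * S t \<omega>))"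
    proof (cases "S t \<omega> \<le> 1 / u")
      case True
      then have "0 \<le> 1 - u * S t \<omega>" using u by (simp add: field_simps)
      then have "1 \<le> exp 1 * exp (- u * S t \<omega>)" by (simp add: exp_add[symmetric])
      then show ?thesis by (auto simp: indicator_def)
    qed simp
  qed
  also have "\<dots> = ennreal (LINT \<omega>|M. exp 1 * exp (- u * S t \<omega>))"
    using int by (intro nn_integral_eq_integral) auto
  also have "\<dots> = ennreal (exp 1 * exp (- t * \<Psi> u))" using L by simp
  finally show ?thesis .
qed

text \<open>The Chernoff bound at \<open>u = 2 ^ n\<close>, with exponential decay exchanged for the
  power \<open>b\<close>, bounds the term of level \<open>n\<close> by a constant times
  \<open>t powr (- b) * 2 powr ((a - \<mu> * b) * n)\<close>. The series is geometric because
  \<open>a < \<mu> * b\<close>.\<close>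

lemma small_moment_bound:
  assumes C: "0 < C" "\<And>n::nat. C * (2 powr \<mu>) ^ n \<le> \<Psi> (2 ^ n)" and a: "0 \<le> a" "a < \<mu> * b" and b: "0 < b"
  obtains K where "0 \<le> K" "\<And>t. 0 < t \<Longrightarrow> (\<integral>\<^sup>+\<omega>. small_moment a (S t \<omega>) \<partial>M) \<le> ennreal (1 + K * t powr (- b))"
proof -
  define q where "q = 2 powr (a - \<mu> * b)"
  have q: "0 < q" "q < 1" using a by (auto simp: q_def powr_less_one)
  define K0 where "K0 = 2 powr a * (exp 1 * (C / b) powr (- b))"
  have K0: "0 \<le> K0" by (simp add: K0_def)
  have "(\<integral>\<^sup>+\<omega>. small_moment a (S t \<omega>) \<partial>M) \<le> ennreal (1 + (K0 / (1 - q)) * t powr (- b))" if t: "0 < t" for t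
  proof -
    have [measurable]: "S t \<in> borel_measurable M" using t by (intro levy_process_measurable[OF levy_S]) simp
    have trm: "ennreal (2 powr (a * (real n + 1))) * emeasure M {\<omega>\<in>space M. S t \<omega> \<le> 1 / 2 ^ n} \<le>
        ennreal (K0 * t powr (- b) * q ^ n)" for n
    proof -
      have "exp (- t * \<Psi> (2 ^ n)) \<le> exp (- (t * (C * (2 powr \<mu>) ^ n)))"
        using C(2)[of n] t by simp
      also have "\<dots> \<le> (t * (C * (2 powr \<mu>) ^ n) / b) powr (- b)"
        using t C b by (intro exp_minus_le_powr) auto
      also have "\<dots> = (C / b) powr (- b) * t powr (- b) * ((2 powr \<mu>) ^ n) powr (- b)"
        using t C b by (simp add: powr_mult[symmetric] mult_ac)
      finally have 1: "exp (- t * \<Psi> (2 ^ n)) \<le> (C / b) powr (- b) * t powr (- b) * ((2 powr \<mu>) ^ n) powr (- b)" .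
      have 2: "2 powr (a * (real n + 1)) * ((2 powr \<mu>) ^ n) powr (- b) = 2 powr a * q ^ n"
        by (simp add: q_def powr_realpow[symmetric] powr_powr powr_add[symmetric] algebra_simps)
      have "ennreal (2 powr (a * (real n + 1))) * emeasure M {\<omega>\<in>space M. S t \<omega> \<le> 1 / 2 ^ n} \<le>
        ennreal (2 powr (a * (real n + 1))) * ennreal (exp 1 * exp (- t * \<Psi> (2 ^ n)))"
        using t chernoff[OF less_imp_le[OF t], of "2 ^ n"] by (intro mult_left_mono) auto
      also have "\<dots> = ennreal (2 powr (a * (real n + 1)) * (exp 1 * exp (- t * \<Psi> (2 ^ n))))"
        by (simp add: ennreal_mult)
      also have "\<dots> \<le> ennreal (2 powr (a * (real n + 1)) * (exp 1 * ((C / b) powr (- b) * t powr (- b) * ((2 powr \<mu>) ^ n) powr (- b))))"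
        using 1 by (intro ennreal_leI mult_left_mono) auto
      also have "2 powr (a * (real n + 1)) * (exp 1 * ((C / b) powr (- b) * t powr (- b) * ((2 powr \<mu>) ^ n) powr (- b))) =
         (2 powr (a * (real n + 1)) * ((2 powr \<mu>) ^ n) powr (- b)) * (exp 1 * ((C / b) powr (- b) * t powr (- b)))"
        by (simp only: mult_ac)
      also have "\<dots> = K0 * t powr (- b) * q ^ n"
        unfolding 2 K0_def by (simp only: mult_ac)
      finally show ?thesis .
    qed
    have "(\<integral>\<^sup>+\<omega>. small_moment a (S t \<omega>) \<partial>M) =
       1 + (\<Sum>n. ennreal (2 powr (a * (real n + 1))) * emeasure M {\<omega>\<in>space M. S t \<omega> \<le> 1 / 2 ^ n})"
    proof -
      have "(\<integral>\<^sup>+\<omega>. indicator {..1 / 2 ^ n} (S t \<omega>) \<partial>M) = emeasure M {\<omega>\<in>space M. S t \<omega> \<le> 1 / 2 ^ n}" for n :: nat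
      proof -
        have "(\<integral>\<^sup>+\<omega>. indicator {..1 / 2 ^ n} (S t \<omega>) \<partial>M) = (\<integral>\<^sup>+\<omega>. indicator {\<omega>\<in>space M. S t \<omega> \<le> 1 / 2 ^ n} \<omega> \<partial>M)"
          by (intro nn_integral_cong) (auto simp: indicator_def)
        then show ?thesis by (subst (asm) nn_integral_indicator) auto
      qed
      then show ?thesis unfolding small_moment_def
        by (subst nn_integral_add) (auto simp: emeasure_space_1 nn_integral_suminf nn_integral_cmult)
    qed
    also have "\<dots> \<le> 1 + (\<Sum>n. ennreal (K0 * t powr (- b) * q ^ n))"
      by (intro add_left_mono suminf_le trm) auto
    also have "(\<Sum>n. ennreal (K0 * t powr (- b) * q ^ n)) = ennreal (\<Sum>n. K0 * t powr (- b) * q ^ n)"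
      using q K0 by (intro suminf_ennreal2) (auto intro!: summable_mult summable_geometric)
    also have "(\<Sum>n. K0 * t powr (- b) * q ^ n) = K0 * t powr (- b) * (1 / (1 - q))"
      using q by (subst suminf_mult) (auto simp: suminf_geometric intro!: summable_geometric)
    also have "1 + ennreal (K0 * t powr (- b) * (1 / (1 - q))) = ennreal (1 + (K0 / (1 - q)) * t powr (- b))"
      using q K0 by (subst ennreal_plus) (auto simp: mult_ac)
    finally show ?thesis .
  qed
  then show thesis using that[of "K0 / (1 - q)"] K0 q by simp
qed

lemma nn_integral_Y_gauss:
  fixes h :: "'a \<Rightarrow> ennreal"
  assumes [measurable]: "h \<in> borel_measurable borel" and t: "0 \<le> t" and pos: "AE \<omega> in M. 0 < S t \<omega>"
  shows "(\<integral>\<^sup>+\<omega>. h (x + Y t \<omega>) \<partial>M) = (\<integral>\<^sup>+\<omega>. (\<integral>\<^sup>+y. h y * gauss (S t \<omega>) (y - x) \<partial>lborel) \<partial>M)"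
proof -
  have "(\<integral>\<^sup>+\<omega>. h (x + Y t \<omega>) \<partial>M) = (\<integral>\<^sup>+\<omega>. h (x + B (S t \<omega>) \<omega>) \<partial>M)"
    by (rule nn_integral_cong_AE_imp[OF AE_Y]) simp
  also have "\<dots> = (\<integral>\<^sup>+\<omega>. (\<integral>\<^sup>+y. h (x + y) * gauss (S t \<omega>) y \<partial>lborel) \<partial>M)"
    using nn_integral_BS_gauss[of "\<lambda>y. h (x + y)" t] t pos by simp
  also have "\<dots> = (\<integral>\<^sup>+\<omega>. (\<integral>\<^sup>+y. h y * gauss (S t \<omega>) (y - x) \<partial>lborel) \<partial>M)"
  proof (rule nn_integral_cong)
    fix \<omega>
    let ?u = "S t \<omega>"
    have "(\<integral>\<^sup>+y. h y * gauss ?u (y - x) \<partial>lborel) = (\<integral>\<^sup>+y. h y * gauss ?u (y - x) \<partial>distr lborel borel ((+) x))"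
      by (simp add: lborel_distr_plus)
    also have "\<dots> = (\<integral>\<^sup>+y. h (x + y) * gauss ?u y \<partial>lborel)"
      by (subst nn_integral_distr) auto
    finally show "(\<integral>\<^sup>+y. h (x + y) * gauss ?u y \<partial>lborel) = (\<integral>\<^sup>+y. h y * gauss ?u (y - x) \<partial>lborel)" by simp
  qed
  finally show ?thesis .
qed

text \<open>For a fixed clock value the Gaussian density is continuous in the starting point, and
  \<open>c\<close> times its peak on a ball containing \<open>D\<close> is an integrable majorant. A
  second dominated convergence, with majorant \<open>c\<close>, averages over the clock. The
  smoothing comes from the Gaussian; \<open>h\<close> is merely measurable.\<close>

lemma strong_feller:
  fixes h :: "'a \<Rightarrow> real"
  assumes [measurable]: "h \<in> borel_measurable borel" and t: "0 \<le> t" and pos: "AE \<omega> in M. 0 < S t \<omega>"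
    and h: "\<And>y. 0 \<le> h y" "\<And>y. h y \<le> c" "\<And>y. y \<notin> D \<Longrightarrow> h y = 0" and D: "bounded D" and z: "z \<longlonglongrightarrow> x"
  shows "(\<lambda>n. \<integral>\<^sup>+\<omega>. h (z n + Y t \<omega>) \<partial>M) \<longlonglongrightarrow> (\<integral>\<^sup>+\<omega>. h (x + Y t \<omega>) \<partial>M)"
proof -
  have [measurable]: "S t \<in> borel_measurable M" using t by measurable
  obtain R where R: "D \<subseteq> cball 0 R" using D by (auto simp: bounded_iff subset_iff)
  have c: "0 \<le> c" using h(1,2)[of 0] by linarith
  have inner: "(\<lambda>n. \<integral>\<^sup>+y. ennreal (h y) * gauss u (y - z n) \<partial>lborel) \<longlonglongrightarrow> (\<integral>\<^sup>+y. ennreal (h y) * gauss u (y - x) \<partial>lborel)"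
    if u: "0 < u" for u
  proof (rule nn_integral_dominated_convergence[where w="\<lambda>y. ennreal (c * (1 / sqrt (4 * pi * u)) ^ DIM('a)) * indicator (cball 0 R) y"])
    show "AE y in lborel. ennreal (h y) * ennreal (gauss u (y - z n)) \<le> ennreal (c * (1 / sqrt (4 * pi * u)) ^ DIM('a)) * indicator (cball 0 R) y" for n
    proof (rule AE_I2)
      fix y
      show "ennreal (h y) * ennreal (gauss u (y - z n)) \<le> ennreal (c * (1 / sqrt (4 * pi * u)) ^ DIM('a)) * indicator (cball 0 R) y"
      proof (cases "y \<in> D")
        case True
        then have "y \<in> cball 0 R" using R by auto
        then show ?thesis using h c u gauss_le[OF u, of "y - z n"]
          by (simp add: ennreal_mult[symmetric] ennreal_leI mult_mono del: mem_cball power_one_over)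
      qed (simp add: h)
    qed
    show "(\<integral>\<^sup>+y. ennreal (c * (1 / sqrt (4 * pi * u)) ^ DIM('a)) * indicator (cball (0::'a) R) y \<partial>lborel) < \<infinity>"
      using emeasure_lborel_cball_finite[of "0::'a" R]
      by (subst nn_integral_cmult_indicator) (auto simp: ennreal_mult_less_top)
    show "AE y in lborel. (\<lambda>n. ennreal (h y) * ennreal (gauss u (y - z n))) \<longlonglongrightarrow> ennreal (h y) * ennreal (gauss u (y - x))"
    proof (rule AE_I2)
      fix y
      have "(\<lambda>n. gauss u (y - z n)) \<longlonglongrightarrow> gauss u (y - x)"
        by (rule continuous_on_tendsto_compose[OF gauss_continuous[OF u]]) (auto intro!: tendsto_intros z)
      then have "(\<lambda>n. ennreal (h y * gauss u (y - z n))) \<longlonglongrightarrow> ennreal (h y * gauss u (y - x))"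
        by (intro tendsto_ennrealI tendsto_intros)
      then show "(\<lambda>n. ennreal (h y) * ennreal (gauss u (y - z n))) \<longlonglongrightarrow> ennreal (h y) * ennreal (gauss u (y - x))"
        by (simp add: ennreal_mult h)
    qed
    have [measurable]: "cball (0::'a) R \<in> sets borel" by simp
    show "(\<lambda>y. ennreal (c * (1 / sqrt (4 * pi * u)) ^ DIM('a)) * indicator (cball (0::'a) R) y) \<in> borel_measurable lborel"
      by measurable
  qed auto
  have "(\<lambda>n. \<integral>\<^sup>+\<omega>. (\<integral>\<^sup>+y. ennreal (h y) * gauss (S t \<omega>) (y - z n) \<partial>lborel) \<partial>M) \<longlonglongrightarrow> 
      (\<integral>\<^sup>+\<omega>. (\<integral>\<^sup>+y. ennreal (h y) * gauss (S t \<omega>) (y - x) \<partial>lborel) \<partial>M)"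
  proof (rule nn_integral_dominated_convergence[where w="\<lambda>_. ennreal c"])
    show "AE \<omega> in M. (\<integral>\<^sup>+y. ennreal (h y) * gauss (S t \<omega>) (y - z n) \<partial>lborel) \<le> ennreal c" for n
      using pos
    proof eventually_elim
      fix \<omega> assume u: "0 < S t \<omega>"
      have "(\<integral>\<^sup>+y. ennreal (h y) * gauss (S t \<omega>) (y - z n) \<partial>lborel) \<le> (\<integral>\<^sup>+y. ennreal c * gauss (S t \<omega>) (y - z n) \<partial>lborel)"
        by (intro nn_integral_mono mult_right_mono ennreal_leI h) auto
      also have "\<dots> = ennreal c * (\<integral>\<^sup>+y. gauss (S t \<omega>) (y - z n) \<partial>distr lborel borel ((+) (z n)))"
        by (simp add: lborel_distr_plus nn_integral_cmult)
      also have "\<dots> = ennreal c"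
        using u by (subst nn_integral_distr) (auto simp: nn_integral_gauss)
      finally show "(\<integral>\<^sup>+y. ennreal (h y) * gauss (S t \<omega>) (y - z n) \<partial>lborel) \<le> ennreal c" .
    qed
    show "AE \<omega> in M. (\<lambda>n. \<integral>\<^sup>+y. ennreal (h y) * gauss (S t \<omega>) (y - z n) \<partial>lborel) \<longlonglongrightarrow> (\<integral>\<^sup>+y. ennreal (h y) * gauss (S t \<omega>) (y - x) \<partial>lborel)"
      using pos by eventually_elim (rule inner)
    show "(\<lambda>\<omega>. \<integral>\<^sup>+y. ennreal (h y) * ennreal (gauss (S t \<omega>) (y - z n)) \<partial>lborel) \<in> borel_measurable M" for n
      unfolding gauss_def normal_density_def by measurable
    show "(\<lambda>\<omega>. \<integral>\<^sup>+y. ennreal (h y) * ennreal (gauss (S t \<omega>) (y - x)) \<partial>lborel) \<in> borel_measurable M"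
      unfolding gauss_def normal_density_def by measurable
  qed (auto simp: emeasure_space_1)
  then show ?thesis using t pos by (simp add: nn_integral_Y_gauss[where h="\<lambda>y. ennreal (h y)"])
qed

text \<open>The law is a mixture of Gaussians with everywhere positive densities. Were it
  concentrated on a ball, the complement of the ball would be a Lebesgue null set.\<close>

lemma prob_ball_less_1:
  assumes t: "0 \<le> t" and pos: "AE \<omega> in M. 0 < S t \<omega>"
  shows "prob {\<omega>\<in>space M. norm (Y t \<omega>) \<le> R} < 1"
proof (rule ccontr)
  have [measurable]: "S t \<in> borel_measurable M" "Y t \<in> borel_measurable M" using t by measurable
  assume "\<not> ?thesis"
  then have "prob {\<omega>\<in>space M. norm (Y t \<omega>) \<le> R} = 1" using prob_le_1 by (simp add: antisym)
  then have "AE \<omega> in M. norm (Y t \<omega>) \<le> R" by (subst (asm) prob_eq_1) (auto intro!: measurable_sets_Collect)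
  then have "(\<integral>\<^sup>+\<omega>. (indicator (- cball 0 R) (0 + Y t \<omega>) :: ennreal) \<partial>M) = 0"
    by (subst nn_integral_0_iff_AE) (auto simp: indicator_def)
  then have "(\<integral>\<^sup>+\<omega>. (\<integral>\<^sup>+y. (indicator (- cball 0 R) y :: ennreal) * gauss (S t \<omega>) (y - (0::'a)) \<partial>lborel) \<partial>M) = 0"
    using nn_integral_Y_gauss[OF _ t pos, of "indicator (- cball 0 R)" 0] by simp
  then have "AE \<omega> in M. (\<integral>\<^sup>+y. (indicator (- cball 0 R) y :: ennreal) * gauss (S t \<omega>) (y::'a) \<partial>lborel) = 0"
    unfolding gauss_def normal_density_def by (subst (asm) nn_integral_0_iff_AE) auto
  with pos have "AE \<omega> in M. 0 < S t \<omega> \<and> (\<integral>\<^sup>+y. (indicator (- cball 0 R) y :: ennreal) * gauss (S t \<omega>) (y::'a) \<partial>lborel) = 0" by auto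
  then have "\<exists>\<omega>. 0 < S t \<omega> \<and> (\<integral>\<^sup>+y. (indicator (- cball 0 R) y :: ennreal) * gauss (S t \<omega>) (y::'a) \<partial>lborel) = 0"
    by (rule AE_ex)
  then obtain \<omega> where u: "0 < S t \<omega>" and 0: "(\<integral>\<^sup>+y. (indicator (- cball 0 R) y :: ennreal) * gauss (S t \<omega>) (y::'a) \<partial>lborel) = 0"
    by blast
  have "AE y in lborel. y \<in> cball (0::'a) R"
    using 0
    by (subst (asm) nn_integral_0_iff_AE)
       (auto simp: indicator_def not_less gauss_pos[OF u, THEN less_imp_neq, THEN not_sym] elim!: AE_mp)
  then have "emeasure lborel (UNIV :: 'a set) = emeasure lborel (cball (0::'a) R)"
    by (intro emeasure_eq_AE) auto
  then show False using emeasure_lborel_cball_finite[of "0::'a" R] by (simp add: emeasure_lborel_UNIV)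
qed

end

section \<open>Quasi-left-continuity\<close>

lemma eventually_at_right_rat:
  assumes "eventually P (at_right (s::real))" "s < s'"
  obtains a :: rat where "s < q + of_rat a" "q + of_rat a < s'" "P (q + of_rat a)"
proof -
  obtain b where b: "b > s" "\<And>y. s < y \<Longrightarrow> y < b \<Longrightarrow> P y"
    using assms(1) unfolding eventually_at_right_field by blast
  have "s - q < min b s' - q" using b assms by auto
  then obtain a where "s - q < of_rat a" "of_rat a < min b s' - q" using of_rat_dense by blast
  then show thesis using that[of a] b(2)[of "q + of_rat a"] by auto
qed

lemma eventually_at_left_rat:
  assumes "eventually P (at_left (s::real))" "s' < s"
  obtains a :: rat where "s' < q + of_rat a" "q + of_rat a < s" "P (q + of_rat a)"
proof -
  obtain b where b: "b < s" "\<And>y. b < y \<Longrightarrow> y < s \<Longrightarrow> P y"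
    using assms(1) unfolding eventually_at_left_field by blast
  have "max b s' - q < s - q" using b assms by auto
  then obtain a where "max b s' - q < of_rat a" "of_rat a < s - q" using of_rat_dense by blast
  then show thesis using that[of a] b(2)[of "q + of_rat a"] by auto
qed

definition entered :: "'a::euclidean_space set \<Rightarrow> nat \<Rightarrow> (real \<Rightarrow> 'a) \<Rightarrow> real \<Rightarrow> bool" where
  "entered D n p q \<longleftrightarrow> (\<exists>a::rat. 0 \<le> (of_rat a :: real) \<and> of_rat a < q \<and> infdist (right_eval p (of_rat a)) (- D) < 1 / Suc n)"

definition big_move :: "real \<Rightarrow> real \<Rightarrow> (real \<Rightarrow> 'a::euclidean_space) \<Rightarrow> real \<Rightarrow> bool" where
  "big_move \<delta> h p q \<longleftrightarrow> (\<exists>a::rat. 0 < (of_rat a :: real) \<and> of_rat a < h \<and> \<delta> < norm (right_eval p (q + of_rat a) - right_eval p q))"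

text \<open>The first approach to the complement falls into the dyadic interval with index
  \<open>k\<close>. For right-continuous paths this is decided before the grid time
  \<open>(k + 1) / 2 ^ m\<close>, so the Markov property can be applied at a fixed time although the
  entry time is random.\<close>

definition entry_at :: "'a::euclidean_space set \<Rightarrow> nat \<Rightarrow> nat \<Rightarrow> nat \<Rightarrow> (real \<Rightarrow> 'a) \<Rightarrow> bool" where
  "entry_at D n m k p \<longleftrightarrow> entered D n p ((real k + 1) / 2 ^ m) \<and> \<not> entered D n p (real k / 2 ^ m)"

lemma entered_restrict [simp]: "entered D n (restrict p {0..}) = entered D n p"
  by (simp add: entered_def fun_eq_iff)

lemma big_move_restrict [simp]: "big_move \<delta> h (restrict p {0..}) = big_move \<delta> h p"
  by (simp add: big_move_def fun_eq_iff)

lemma entry_at_restrict [simp]: "entry_at D n m k (restrict p {0..}) = entry_at D n m k p"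
  by (simp add: entry_at_def)

lemma measurable_entered [measurable (raw)]:
  assumes [measurable]: "P \<in> measurable N path_space"
  shows "Measurable.pred N (\<lambda>z. entered D n (P z) q)"
  unfolding entered_def by measurable

lemma measurable_entry_at [measurable (raw)]:
  assumes [measurable]: "P \<in> measurable N path_space"
  shows "Measurable.pred N (\<lambda>z. entry_at D n m k (P z))"
  unfolding entry_at_def by measurable

lemma measurable_big_move [measurable (raw)]:
  assumes [measurable]: "P \<in> measurable N path_space"
  shows "Measurable.pred N (\<lambda>z. big_move \<delta> h (P z) q)"
  unfolding big_move_def by measurable

text \<open>
  If the path jumps at the moment its left limit leaves \<open>D\<close>, then it enters every small neighbourhood
  of the complement shortly before, so a large move follows within time \<open>h\<close> of a grid point
  just after that entry. By the Markov property such a move has a probability that vanishes as \<open>h \<down> 0\<close>.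
\<close>

lemma jump_at_exit_detected:
  assumes p: "cadlag p" and D: "open D" and s: "0 < s"
    and al: "\<And>r. 0 \<le> r \<Longrightarrow> r < s \<Longrightarrow> alive D p r" and ps: "p s \<in> D" and nal: "\<not> alive D p s"
  shows "\<exists>j::nat. \<forall>i::nat. \<exists>n0. \<forall>n\<ge>n0. \<exists>m0. \<forall>m\<ge>m0. \<exists>k. entry_at D n m k p \<and>
    big_move (1 / Suc j) (1 / Suc i) p ((real k + 1) / 2 ^ m)"
proof -
  obtain l where l: "(p \<longlongrightarrow> l) (at_left s)" using p s unfolding cadlag_def by blast
  have ne: "- D \<noteq> {}" 
  proof
    assume "- D = {}" 
    moreover have "alive D p 0" using al[of 0] s by simp
    ultimately show False unfolding alive_iff_pos by (auto simp: infdist_def)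
  qed
  have cl: "closed (- D)" by (rule closed_Compl[OF D])
  have posD: "0 < infdist y (- D)" if "y \<in> D" for y
    using that in_closed_iff_infdist_zero[OF cl ne, of y] infdist_nonneg[of y "- D"] by force
  have linf: "((\<lambda>r. infdist (p r) (- D)) \<longlongrightarrow> infdist l (- D)) (at_left s)"
    using l by (rule tendsto_infdist)
  \<comment> \<open>If the left limit lay in \<open>D\<close>, the path would keep a positive margin
    just before \<open>s\<close>, at earlier times by survival, and at \<open>s\<close> by
    \<open>ps\<close>; it would then survive up to \<open>s\<close>.\<close>
  have lD: "l \<notin> D"
  proof
    assume "l \<in> D"
    then have "infdist l (- D) / 2 < infdist l (- D)" using posD by simp
    from order_tendstoD(1)[OF linf this] obtain b where b: "b < s" "\<And>y. b < y \<Longrightarrow> y < s \<Longrightarrow> infdist l (- D) / 2 < infdist (p y) (- D)"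
      unfolding eventually_at_left_field by blast
    have "alive D p (max b 0)" using al[of "max b 0"] b s by simp
    then obtain e where e: "e > 0" "\<forall>r\<in>{0..max b 0}. e \<le> infdist (p r) (- D)" unfolding alive_iff_pos by blast
    have "min e (min (infdist l (- D) / 2) (infdist (p s) (- D))) \<le> infdist (p r) (- D)" if "r \<in> {0..s}" for r
      using that e(2)[rule_format, of r] b(2)[of r] by (cases "r \<le> b"; cases "r = s") (auto simp: min_le_iff_disj)
    moreover have "0 < min e (min (infdist l (- D) / 2) (infdist (p s) (- D)))"
      using e posD[OF ps] posD[OF \<open>l \<in> D\<close>] by simp
    ultimately show False using nal unfolding alive_iff_pos by blast
  qed
  then have l0: "infdist l (- D) = 0" by simp
  have "0 < norm (p s - l) / 2" using ps lD by auto
  then obtain j where j: "inverse (real (Suc j)) < norm (p s - l) / 2" using reals_Archimedean by blast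
  \<comment> \<open>Less than half the jump, so no point is within \<open>\<delta>\<close> of both
    the left limit and the value at \<open>s\<close>.\<close>
  define \<delta> where "\<delta> = 1 / real (Suc j)"
  have \<delta>: "2 * \<delta> < norm (p s - l)" using j by (simp add: \<delta>_def inverse_eq_divide)
  have "\<exists>n0. \<forall>n\<ge>n0. \<exists>m0. \<forall>m\<ge>m0. \<exists>k. entry_at D n m k p \<and> big_move \<delta> (1 / Suc i) p ((real k + 1) / 2 ^ m)" for i
  proof -
    define h where "h = 1 / real (Suc i)"
    have h: "0 < h" by (simp add: h_def)
    \<comment> \<open>Survival up to \<open>s0\<close> gives a margin, so for large \<open>n\<close>
      there is no entry before \<open>s0\<close>, while the left limit forces one before
      \<open>s\<close>. For large \<open>m\<close> the grid time following the first entry then lies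
      between \<open>s0\<close> and \<open>s\<close>, hence less than \<open>h\<close> before
      \<open>s\<close>.\<close>
    define s0 where "s0 = max 0 (s - h / 2)"
    have s0: "0 \<le> s0" "s0 < s" "s - s0 < h" using s h by (auto simp: s0_def)
    obtain e where e: "e > 0" "\<forall>r\<in>{0..s0}. e \<le> infdist (p r) (- D)"
      using al[of s0] s0 unfolding alive_iff_pos by blast
    obtain n0 where n0: "inverse (real (Suc n0)) < e" using reals_Archimedean e(1) by blast
    show ?thesis
    proof (rule exI[of _ n0], intro allI impI)
      fix n assume "n0 \<le> n"
      then have "inverse (real (Suc n)) \<le> inverse (real (Suc n0))" by (intro le_imp_inverse_le) auto
      then have n: "1 / real (Suc n) < e" using n0 by (simp add: inverse_eq_divide)
      have "0 < 1 / real (Suc n)" by simp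
      then have "\<forall>\<^sub>F r in at_left s. infdist (p r) (- D) < 1 / real (Suc n)"
        using order_tendstoD(2)[OF linf] l0 by simp
      then obtain a :: rat where a: "s0 < 0 + of_rat a" "0 + of_rat a < s" "infdist (p (0 + of_rat a)) (- D) < 1 / real (Suc n)"
        using s0(2) by (rule eventually_at_left_rat)
      have a0: "0 \<le> (of_rat a :: real)" using a s0 by linarith
      have ent: "entered D n p q" if "of_rat a < q" for q
        unfolding entered_def using that a a0 by (intro exI[of _ a]) (simp add: right_eval_eq[OF p])
      have nent: "\<not> entered D n p q" if "q \<le> s0" for q
      proof
        assume "entered D n p q"
        then obtain a' :: rat where a': "0 \<le> (of_rat a' :: real)" "of_rat a' < q" "infdist (p (of_rat a')) (- D) < 1 / Suc n"
          unfolding entered_def by (auto simp: right_eval_eq[OF p])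
        have "e \<le> infdist (p (of_rat a')) (- D)" using e(2) a' that by auto
        then show False using a' n by linarith
      qed
      obtain m0 where m0: "(1/2::real) ^ m0 < s - of_rat a" using real_arch_pow_inv[of "s - of_rat a" "1/2"] a by auto
      show "\<exists>m0. \<forall>m\<ge>m0. \<exists>k. entry_at D n m k p \<and> big_move \<delta> (1 / Suc i) p ((real k + 1) / 2 ^ m)"
      proof (rule exI[of _ m0], intro allI impI)
        fix m assume "m0 \<le> m"
        then have "(1/2::real) ^ m \<le> (1/2) ^ m0" by (intro power_decreasing) auto
        then have m: "1 / 2 ^ m < s - of_rat a" using m0 by (simp add: power_one_over)
        define k1 where "k1 = nat \<lfloor>2 ^ m * of_rat a :: real\<rfloor> + 1"
        have k1: "of_rat a < real k1 / 2 ^ m" "real k1 / 2 ^ m \<le> of_rat a + 1 / 2 ^ m"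
          using rgrid_gt[OF a0, of m] rgrid_le[OF a0, of m] by (simp_all add: k1_def rgrid_def add.commute)
        define k where "k = (LEAST k. entered D n p (real k / 2 ^ m))"
        have k: "entered D n p (real k / 2 ^ m)" unfolding k_def by (rule LeastI[of _ k1]) (rule ent[OF k1(1)])
        have kk1: "k \<le> k1" unfolding k_def by (rule Least_le) (rule ent[OF k1(1)])
        have "k \<noteq> 0" using k nent[of 0] s0 by (intro notI) simp
        then obtain k' where k': "k = Suc k'" by (cases k) auto
        have "\<not> entered D n p (real k' / 2 ^ m)" using not_less_Least[of k' "\<lambda>k. entered D n p (real k / 2 ^ m)"] k' unfolding k_def by auto
        with k have E: "entry_at D n m k' p" unfolding entry_at_def k' by (simp add: add.commute)
        define q where "q = (real k' + 1) / 2 ^ m"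
        have qk: "q = real k / 2 ^ m" by (simp add: q_def k' add.commute)
        have "real k / 2 ^ m \<le> real k1 / 2 ^ m" using kk1 by (intro divide_right_mono) auto
        then have qs: "q < s" using k1 m qk by linarith
        have qs0: "s0 < q" using nent[of q] k qk by fastforce
        have q0: "0 \<le> q" using qs0 s0 by linarith
        have "\<delta> < norm (p s - p q) \<or> \<delta> < norm (l - p q)"
        proof (rule ccontr)
          assume "\<not> ?thesis"
          then have "norm (p s - p q) + norm (l - p q) \<le> 2 * \<delta>" by simp
          moreover have "norm (p s - l) \<le> norm (p s - p q) + norm (l - p q)"
            using norm_triangle_ineq4[of "p s - p q" "l - p q"] by simp
          ultimately show False using \<delta> by linarith
        qed
        then have "big_move \<delta> h p q"
        proof
          assume *: "\<delta> < norm (p s - p q)"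
          have "((\<lambda>r. norm (p r - p q)) \<longlongrightarrow> norm (p s - p q)) (at_right s)"
            using p s by (intro tendsto_intros) (simp add: cadlag_def)
          from order_tendstoD(1)[OF this *] have "\<forall>\<^sub>F r in at_right s. \<delta> < norm (p r - p q)" .
          moreover have "s < q + h" using qs0 s0 by linarith
          ultimately obtain a' :: rat where a': "s < q + of_rat a'" "q + of_rat a' < q + h" "\<delta> < norm (p (q + of_rat a') - p q)"
            by (rule eventually_at_right_rat)
          moreover have "0 < (of_rat a' :: real)" using a' qs by linarith
          ultimately show ?thesis unfolding big_move_def using q0 qs
            by (intro exI[of _ a']) (auto simp: right_eval_eq[OF p])
        next
          assume *: "\<delta> < norm (l - p q)"
          have "((\<lambda>r. norm (p r - p q)) \<longlongrightarrow> norm (l - p q)) (at_left s)"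
            using l by (intro tendsto_intros)
          from order_tendstoD(1)[OF this *] have "\<forall>\<^sub>F r in at_left s. \<delta> < norm (p r - p q)" .
          then obtain a' :: rat where "q < q + of_rat a'" "q + of_rat a' < s" "\<delta> < norm (p (q + of_rat a') - p q)"
            using qs by (rule eventually_at_left_rat)
          moreover have "s < q + h" using qs0 s0 by linarith
          ultimately show ?thesis unfolding big_move_def using q0 qs
            by (intro exI[of _ a']) (auto simp: right_eval_eq[OF p])
        qed
        then show "\<exists>k. entry_at D n m k p \<and> big_move \<delta> (1 / Suc i) p ((real k + 1) / 2 ^ m)"
          using E unfolding q_def h_def by blast
      qed
    qed
  qed
  then show ?thesis unfolding \<delta>_def by blast
qed

lemma alive_extend:
  assumes p: "cadlag p" and r: "0 \<le> r" and al: "alive D p r"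
  shows "\<exists>r'>r. alive D p r'"
proof -
  obtain e where e: "e > 0" "\<forall>u\<in>{0..r}. e \<le> infdist (p u) (- D)" using al unfolding alive_iff_pos by blast
  have "((\<lambda>u. infdist (p u) (- D)) \<longlongrightarrow> infdist (p r) (- D)) (at_right r)"
    using p r by (intro tendsto_infdist) (simp add: cadlag_def)
  moreover have "e / 2 < infdist (p r) (- D)" using e r by force
  ultimately have "\<forall>\<^sub>F u in at_right r. e / 2 < infdist (p u) (- D)" by (rule order_tendstoD(1))
  then obtain b where b: "b > r" "\<And>y. r < y \<Longrightarrow> y < b \<Longrightarrow> e / 2 < infdist (p y) (- D)"
    unfolding eventually_at_right_field by blast
  have "e / 2 \<le> infdist (p u) (- D)" if "u \<in> {0..(r + b) / 2}" for u
    using that e b(2)[of u] b(1) by (cases "u \<le> r") (force simp: field_simps)+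
  then have "alive D p ((r + b) / 2)" unfolding alive_iff_pos using e by (intro exI[of _ "e / 2"]) auto
  then show ?thesis using b by (intro exI[of _ "(r + b) / 2"]) auto
qed

text \<open>Let \<open>s\<close> be the infimum of the times without survival. The path survives at
  every earlier time, so \<open>q\<close> gives survival at \<open>s\<close> (for
  \<open>s = 0\<close> openness of \<open>D\<close> does), and right-continuity extends it beyond
  \<open>s\<close>, a contradiction.\<close>

lemma alive_if_inside:
  assumes p: "cadlag p" and D: "open D" "- D \<noteq> {}" and t: "0 \<le> t"
    and q: "\<And>s. 0 < s \<Longrightarrow> (\<And>r. 0 \<le> r \<Longrightarrow> r < s \<Longrightarrow> alive D p r) \<Longrightarrow> p s \<in> D \<Longrightarrow> alive D p s"
    and inside: "\<And>r. 0 \<le> r \<Longrightarrow> r \<le> t \<Longrightarrow> p r \<in> D"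
  shows "alive D p t"
proof (rule ccontr)
  assume nal: "\<not> alive D p t"
  define A where "A = {r. 0 \<le> r \<and> r \<le> t \<and> \<not> alive D p r}"
  define s where "s = Inf A"
  have A: "t \<in> A" "bdd_below A" using nal t by (auto simp: A_def intro!: bdd_belowI[of _ 0])
  have s: "0 \<le> s" "s \<le> t" unfolding s_def using A by (auto simp: A_def intro!: cInf_greatest cInf_lower)
  have al: "alive D p r" if "0 \<le> r" "r < s" for r
  proof (rule ccontr)
    assume "\<not> alive D p r"
    then have "r \<in> A" using that s by (auto simp: A_def)
    then have "s \<le> r" unfolding s_def using A by (intro cInf_lower)
    then show False using that by simp
  qed
  have ps: "p s \<in> D" using inside s by simp
  have als: "alive D p s"
  proof (cases "s = 0")
    case True
    have "closed (- D)" by (rule closed_Compl[OF D(1)])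
    then have "infdist (p s) (- D) \<noteq> 0" using ps in_closed_iff_infdist_zero[OF _ D(2)] by blast
    then have "0 < infdist (p s) (- D)" using infdist_nonneg[of "p s" "- D"] by linarith
    then show ?thesis unfolding alive_iff_pos using True by (intro exI[of _ "infdist (p s) (- D)"]) auto
  next
    case False
    with s have "0 < s" by simp
    then show ?thesis using al ps by (rule q)
  qed
  from alive_extend[OF p s(1) this] obtain r' where r': "s < r'" "alive D p r'" by blast
  obtain r where "r \<in> A" "r < r'" using cInf_lessD[of A r'] A(1) r'(1) unfolding s_def by blast
  then show False using alive_mono[OF r'(2), of r] by (auto simp: A_def)
qed

text \<open>The event is an increasing union of intersections, each contained in one
  \<open>A n\<close>; continuity from below preserves the bound.\<close>

lemma emeasure_eventually_le:
  assumes A[measurable]: "\<And>n::nat. A n \<in> sets M" and c: "\<And>n. emeasure M (A n) \<le> c"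
  shows "emeasure M {x\<in>space M. \<exists>n0. \<forall>n\<ge>n0. x \<in> A n} \<le> c"
proof -
  define B where "B n0 = {x\<in>space M. \<forall>n\<ge>n0. x \<in> A n}" for n0
  have B[measurable]: "B n \<in> sets M" for n unfolding B_def by measurable
  have "incseq B" by (auto simp: incseq_def B_def)
  have "{x\<in>space M. \<exists>n0. \<forall>n\<ge>n0. x \<in> A n} = (\<Union>n. B n)" by (auto simp: B_def)
  then have "emeasure M {x\<in>space M. \<exists>n0. \<forall>n\<ge>n0. x \<in> A n} = (SUP n. emeasure M (B n))"
    using SUP_emeasure_incseq[of B M] \<open>incseq B\<close> B by (simp add: image_subset_iff)
  also have "\<dots> \<le> c"
  proof (rule SUP_least)
    fix n
    have "emeasure M (B n) \<le> emeasure M (A n)" by (intro emeasure_mono) (auto simp: B_def)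
    then show "emeasure M (B n) \<le> c" using c order_trans by blast
  qed
  finally show ?thesis .
qed

section \<open>Large moves after an entry, and almost sure survival inside the domain\<close>

context cadlag_levy
begin

abbreviation walk :: "'a \<Rightarrow> 'w \<Rightarrow> real \<Rightarrow> 'a" where
  "walk x \<omega> \<equiv> \<lambda>r. x + Y r \<omega>"

lemma right_eval_X [simp]: "0 \<le> r \<Longrightarrow> right_eval (\<lambda>t. x + Y t \<omega>) r = x + Y r \<omega>"
  by (rule right_eval_eq[OF cadlag_translate[OF Y_cadlag]])

lemma right_eval_glue [simp]: "0 \<le> t \<Longrightarrow> 0 \<le> r \<Longrightarrow> right_eval (\<lambda>r. x + glue t (\<lambda>r. Y r \<omega>) (\<lambda>r. Y r \<omega>') r) r = x + glue t (\<lambda>r. Y r \<omega>) (\<lambda>r. Y r \<omega>') r"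
  by (rule right_eval_eq[OF cadlag_translate[OF cadlag_glue]]) (auto simp: Y_cadlag)

lemma measurable_X:
  assumes [measurable]: "x \<in> borel_measurable N" "\<omega> \<in> measurable N M"
  shows "(\<lambda>z. restrict (\<lambda>r. x z + Y r (\<omega> z)) {0..}) \<in> measurable N path_space"
proof (rule measurable_restrict)
  fix r :: real assume "r \<in> {0..}"
  then have [measurable]: "Y r \<in> borel_measurable M" by simp
  show "(\<lambda>z. x z + Y r (\<omega> z)) \<in> borel_measurable N" by measurable
qed

lemma measurable_translate_path [measurable]:
  "(\<lambda>p. restrict (\<lambda>r. x + p r) {0..}) \<in> measurable path_space (path_space :: (real \<Rightarrow> 'a) measure)"
  by (rule measurable_restrict) auto

lemma measurable_entry_at_X [measurable]:
  "Measurable.pred M (\<lambda>\<omega>. entry_at D n m k (walk x \<omega>))"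
  using measurable_entry_at[OF measurable_X[of "\<lambda>_. x" M "\<lambda>\<omega>. \<omega>"], of D n m k] by simp

lemma measurable_big_move_X [measurable]:
  "Measurable.pred M (\<lambda>\<omega>. big_move \<delta> h (walk x \<omega>) q)"
  using measurable_big_move[OF measurable_X[of "\<lambda>_. x" M "\<lambda>\<omega>. \<omega>"], of \<delta> h q] by simp

definition move_prob :: "real \<Rightarrow> real \<Rightarrow> ennreal" where
  "move_prob \<delta> h = emeasure M {\<omega>\<in>space M. big_move \<delta> h (path_of Y \<omega>) 0}"

text \<open>The events decrease as the window shrinks, and right-continuity at 0 together with
  \<open>Y 0 \<omega> = 0\<close> makes their intersection empty.\<close>

lemma move_prob_tendsto: 
  assumes \<delta>: "0 < \<delta>" shows "(\<lambda>n. move_prob \<delta> (1 / Suc n)) \<longlonglongrightarrow> 0"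
proof -
  define A where "A n = {\<omega>\<in>space M. big_move \<delta> (1 / Suc n) (path_of Y \<omega>) 0}" for n
  have [measurable]: "A n \<in> sets M" for n unfolding A_def by measurable
  have "(\<lambda>n. emeasure M (A n)) \<longlonglongrightarrow> emeasure M (\<Inter>n. A n)"
  proof (rule Lim_emeasure_decseq)
    have "A n \<subseteq> A m" if "m \<le> n" for m n
    proof -
      have "1 / real (Suc n) \<le> 1 / real (Suc m)" using that by (intro divide_left_mono) auto
      then show ?thesis unfolding A_def big_move_def by (force intro: less_le_trans)
    qed
    then show "decseq A" by (auto simp: decseq_def)
  qed auto
  moreover have "(\<Inter>n. A n) = {}"
  proof (rule ccontr)
    assume "(\<Inter>n. A n) \<noteq> {}"
    then obtain \<omega> where \<omega>: "\<And>n. \<omega> \<in> A n" by auto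
    have "((\<lambda>r. Y r \<omega>) \<longlongrightarrow> Y 0 \<omega>) (at_right 0)" using Y_cadlag[of \<omega>] unfolding cadlag_def by blast
    then have "((\<lambda>r. norm (Y r \<omega>)) \<longlongrightarrow> 0) (at_right 0)" using tendsto_norm by fastforce
    from order_tendstoD(2)[OF this \<delta>] obtain b where b: "b > 0" "\<And>y. 0 < y \<Longrightarrow> y < b \<Longrightarrow> norm (Y y \<omega>) < \<delta>"
      unfolding eventually_at_right_field by blast
    obtain n where "inverse (real (Suc n)) < b" using reals_Archimedean b(1) by blast
    then have n: "1 / real (Suc n) < b" by (simp add: inverse_eq_divide)
    from \<omega>[of n] obtain a :: rat where "0 < (of_rat a :: real)" "of_rat a < 1 / real (Suc n)" "\<delta> < norm (Y (of_rat a) \<omega>)"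
      unfolding A_def big_move_def by (auto simp: right_eval_path_of)
    then show False using b(2)[of "of_rat a"] n by simp
  qed
  ultimately show ?thesis by (simp add: A_def move_prob_def)
qed

text \<open>The path up to the grid time decides \<open>entry_at\<close>, the increments of the
  fresh copy decide \<open>big_move\<close>; the Markov property at the grid time therefore
  factorises the probability.\<close>

lemma entry_move_prob:
  shows "emeasure M {\<omega>\<in>space M. entry_at D n m k (walk x \<omega>) \<and> big_move \<delta> h (walk x \<omega>) ((real k + 1) / 2 ^ m)} =
    emeasure M {\<omega>\<in>space M. entry_at D n m k (walk x \<omega>)} * move_prob \<delta> h"
proof -
  define q where "q = (real k + 1) / 2 ^ m"
  have q: "0 \<le> q" by (simp add: q_def)
  define F :: "(real \<Rightarrow> 'a) \<Rightarrow> ennreal" where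
    "F p = indicator {p. entry_at D n m k (restrict (\<lambda>r. x + p r) {0..})} p * indicator {p. big_move \<delta> h (restrict (\<lambda>r. x + p r) {0..}) q} p" for p
  have F[measurable]: "F \<in> borel_measurable path_space" 
    unfolding F_def indicator_def by measurable
  have restr: "restrict (\<lambda>r. x + restrict p {0..} r) {0..} = restrict (\<lambda>r. x + p r) {0..}" for p :: "real \<Rightarrow> 'a"
    by (rule restrict_ext) simp
  have Fp: "F (restrict p {0..}) = indicator {p. entry_at D n m k (\<lambda>r. x + p r)} p * indicator {p. big_move \<delta> h (\<lambda>r. x + p r) q} p" for p
    unfolding F_def by (simp only: indicator_def mem_Collect_eq restr) simp
  have mB0: "{\<omega>\<in>space M. big_move \<delta> h (\<lambda>r. Y r \<omega>) 0} \<in> sets M"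
    using measurable_big_move[OF path_Y, of \<delta> h 0] by (simp add: path_of_def pred_def)
  have "emeasure M {\<omega>\<in>space M. entry_at D n m k (walk x \<omega>) \<and> big_move \<delta> h (walk x \<omega>) q} = (\<integral>\<^sup>+\<omega>. F (path_of Y \<omega>) \<partial>M)"
    by (subst nn_integral_indicator[symmetric], measurable)
      (auto intro!: nn_integral_cong simp: path_of_def Fp indicator_def simp del: nn_integral_indicator)
  also have "\<dots> = (\<integral>\<^sup>+\<omega>. \<integral>\<^sup>+\<omega>'. F (restrict (glue q (\<lambda>r. Y r \<omega>) (\<lambda>r. Y r \<omega>')) {0..}) \<partial>M \<partial>M)"
    by (rule markov[OF F q])
  also have "\<dots> = (\<integral>\<^sup>+\<omega>. \<integral>\<^sup>+\<omega>'. indicator {\<omega>\<in>space M. entry_at D n m k (walk x \<omega>)} \<omega> * indicator {\<omega>\<in>space M. big_move \<delta> h (\<lambda>r. Y r \<omega>) 0} \<omega>' \<partial>M \<partial>M)"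
  proof (intro nn_integral_cong)
    fix \<omega> \<omega>' assume "\<omega> \<in> space M" "\<omega>' \<in> space M"
    let ?c = "glue q (\<lambda>r. Y r \<omega>) (\<lambda>r. Y r \<omega>')"
    have lo: "right_eval (\<lambda>r. x + ?c r) a = x + Y a \<omega>" if "0 \<le> a" "a \<le> q" for a
      using that q by (subst right_eval_glue) (auto simp: glue_def)
    have hi: "right_eval (\<lambda>r. x + ?c r) (q + a) = x + (Y q \<omega> + Y a \<omega>')" if "0 \<le> a" for a
      using that q by (subst right_eval_glue) (auto simp: glue_def)
    have e: "entered D n (\<lambda>r. x + ?c r) q' = entered D n (walk x \<omega>) q'" if "q' \<le> q" for q'
      unfolding entered_def using q that
      by (intro ex_cong1 conj_cong refl) (simp add: lo del: right_eval_glue)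
    have "real k / 2 ^ m \<le> q" by (simp add: q_def divide_right_mono)
    then have 1: "entry_at D n m k (\<lambda>r. x + ?c r) = entry_at D n m k (walk x \<omega>)"
      unfolding entry_at_def q_def[symmetric] using e[of q] e[of "real k / 2 ^ m"] by simp
    have 2: "big_move \<delta> h (\<lambda>r. x + ?c r) q = big_move \<delta> h (\<lambda>r. Y r \<omega>') 0"
      unfolding big_move_def using q hi[of 0]
      by (intro ex_cong1 conj_cong refl) (simp add: hi del: right_eval_glue)
    show "F (restrict ?c {0..}) = indicator {\<omega>\<in>space M. entry_at D n m k (walk x \<omega>)} \<omega> * indicator {\<omega>\<in>space M. big_move \<delta> h (\<lambda>r. Y r \<omega>) 0} \<omega>'"
      unfolding Fp using \<open>\<omega> \<in> space M\<close> \<open>\<omega>' \<in> space M\<close> by (simp add: 1 2 indicator_def)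
  qed
  also have "\<dots> = emeasure M {\<omega>\<in>space M. entry_at D n m k (walk x \<omega>)} * emeasure M {\<omega>\<in>space M. big_move \<delta> h (\<lambda>r. Y r \<omega>) 0}"
    using mB0 by (simp add: nn_integral_cmult nn_integral_multc)
  finally show ?thesis unfolding q_def move_prob_def by (simp add: path_of_def)
qed

text \<open>\<open>entered\<close> is monotone in time, so it can switch on in one dyadic interval
  only.\<close>

lemma entry_at_disjoint: "entry_at D n m k p \<Longrightarrow> entry_at D n m k' p \<Longrightarrow> k = k'"
proof -
  have *: "\<not> (entry_at D n m k p \<and> entry_at D n m k' p)" if "k < k'" for k k'
  proof
    assume e: "entry_at D n m k p \<and> entry_at D n m k' p"
    have "real k + 1 \<le> real k'" using that by simp
    then have "(real k + 1) / 2 ^ m \<le> real k' / 2 ^ m" by (intro divide_right_mono) auto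
    moreover obtain a :: rat where "0 \<le> (of_rat a :: real)" "of_rat a < (real k + 1) / 2 ^ m" "infdist (right_eval p (of_rat a)) (- D) < 1 / Suc n"
      using e unfolding entry_at_def entered_def by blast
    ultimately have "entered D n p (real k' / 2 ^ m)" unfolding entered_def by force
    then show False using e unfolding entry_at_def by blast
  qed
  assume "entry_at D n m k p" "entry_at D n m k' p"
  then show ?thesis using *[of k k'] *[of k' k] by (cases k k' rule: linorder_cases) auto
qed

text \<open>The entry events for different \<open>k\<close> are disjoint and have total probability
  at most 1, so summing over \<open>k\<close> costs nothing and the bound is independent of
  \<open>n\<close> and \<open>m\<close>.\<close>

lemma entry_some_prob_le:
  "emeasure M {\<omega>\<in>space M. \<exists>k. entry_at D n m k (walk x \<omega>) \<and> big_move \<delta> h (walk x \<omega>) ((real k + 1) / 2 ^ m)} \<le> move_prob \<delta> h"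
  "{\<omega>\<in>space M. \<exists>k. entry_at D n m k (walk x \<omega>) \<and> big_move \<delta> h (walk x \<omega>) ((real k + 1) / 2 ^ m)} \<in> sets M"
proof -
  define E where "E k = {\<omega>\<in>space M. entry_at D n m k (walk x \<omega>)}" for k
  define EB where "EB k = {\<omega>\<in>space M. entry_at D n m k (walk x \<omega>) \<and> big_move \<delta> h (walk x \<omega>) ((real k + 1) / 2 ^ m)}" for k
  have E: "E k \<in> sets M" and EB: "EB k \<in> sets M" for k
    unfolding E_def EB_def by measurable
  have eq: "{\<omega>\<in>space M. \<exists>k. entry_at D n m k (walk x \<omega>) \<and> big_move \<delta> h (walk x \<omega>) ((real k + 1) / 2 ^ m)} = (\<Union>k. EB k)"
    by (auto simp: EB_def)
  show "{\<omega>\<in>space M. \<exists>k. entry_at D n m k (walk x \<omega>) \<and> big_move \<delta> h (walk x \<omega>) ((real k + 1) / 2 ^ m)} \<in> sets M"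
    unfolding eq using EB by auto
  have "emeasure M (\<Union>k. EB k) \<le> (\<Sum>k. emeasure M (EB k))"
    using EB by (intro emeasure_subadditive_countably) auto
  also have "\<dots> = (\<Sum>k. emeasure M (E k) * move_prob \<delta> h)"
    unfolding EB_def E_def entry_move_prob ..
  also have "\<dots> = emeasure M (\<Union>k. E k) * move_prob \<delta> h"
  proof -
    have "disjoint_family E"
      unfolding disjoint_family_on_def E_def using entry_at_disjoint by blast
    then have "(\<Sum>k. emeasure M (E k)) = emeasure M (\<Union>k. E k)" using E by (intro suminf_emeasure) auto
    then show ?thesis by simp
  qed
  also have "\<dots> \<le> 1 * move_prob \<delta> h"
    by (intro mult_right_mono emeasure_le_1) auto
  finally show "emeasure M {\<omega>\<in>space M. \<exists>k. entry_at D n m k (walk x \<omega>) \<and> big_move \<delta> h (walk x \<omega>) ((real k + 1) / 2 ^ m)} \<le> move_prob \<delta> h"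
    unfolding eq by simp
qed

text \<open>A failure produces some jump size \<open>1 / Suc j\<close> for which every window
  \<open>1 / Suc i\<close> contains a large move, for all large \<open>n\<close> and then all large
  \<open>m\<close>. For fixed \<open>j\<close> and \<open>i\<close> this has probability at most
  \<open>move_prob\<close>, which vanishes as \<open>i\<close> grows.\<close>

lemma quasi_left_continuity:
  assumes D: "open D"
  shows "AE \<omega> in M. \<forall>s>0. (\<forall>r. 0 \<le> r \<longrightarrow> r < s \<longrightarrow> alive D (walk x \<omega>) r) \<longrightarrow> x + Y s \<omega> \<in> D \<longrightarrow> alive D (walk x \<omega>) s"
proof -
  define C where "C j i n m = {\<omega>\<in>space M. \<exists>k. entry_at D n m k (walk x \<omega>) \<and>
     big_move (1 / Suc j) (1 / Suc i) (walk x \<omega>) ((real k + 1) / 2 ^ m)}" for j i n m :: nat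
  define C1 where "C1 j i n = {\<omega>\<in>space M. \<exists>m0. \<forall>m\<ge>m0. \<omega> \<in> C j i n m}" for j i n
  define C2 where "C2 j i = {\<omega>\<in>space M. \<exists>n0. \<forall>n\<ge>n0. \<omega> \<in> C1 j i n}" for j i
  have C[measurable]: "C j i n m \<in> sets M" for j i n m unfolding C_def by (rule entry_some_prob_le(2))
  have C1[measurable]: "C1 j i n \<in> sets M" for j i n unfolding C1_def by measurable
  have C2[measurable]: "C2 j i \<in> sets M" for j i unfolding C2_def by measurable
  have "emeasure M (C j i n m) \<le> move_prob (1 / Suc j) (1 / Suc i)" for j i n m
    unfolding C_def by (rule entry_some_prob_le(1))
  then have "emeasure M (C1 j i n) \<le> move_prob (1 / Suc j) (1 / Suc i)" for j i n
    unfolding C1_def by (intro emeasure_eventually_le) auto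
  then have c2: "emeasure M (C2 j i) \<le> move_prob (1 / Suc j) (1 / Suc i)" for j i
    unfolding C2_def by (intro emeasure_eventually_le) auto
  have "(\<Inter>i. C2 j i) \<in> null_sets M" for j
  proof -
    have "emeasure M (\<Inter>i. C2 j i) \<le> move_prob (1 / Suc j) (1 / Suc i)" for i
      by (rule order_trans[OF emeasure_mono[of _ "C2 j i"] c2]) auto
    then have "emeasure M (\<Inter>i. C2 j i) \<le> 0"
      using move_prob_tendsto[of "1 / Suc j"] by (intro LIMSEQ_le_const) auto
    then show ?thesis by (intro null_setsI) auto
  qed
  then have "(\<Union>j. \<Inter>i. C2 j i) \<in> null_sets M" by auto
  then show ?thesis
  proof (rule AE_I')
    show "{\<omega>\<in>space M. \<not> (\<forall>s>0. (\<forall>r. 0 \<le> r \<longrightarrow> r < s \<longrightarrow> alive D (walk x \<omega>) r) \<longrightarrow> x + Y s \<omega> \<in> D \<longrightarrow> alive D (walk x \<omega>) s)} \<subseteq> (\<Union>j. \<Inter>i. C2 j i)"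
    proof
      fix \<omega> assume "\<omega> \<in> {\<omega>\<in>space M. \<not> (\<forall>s>0. (\<forall>r. 0 \<le> r \<longrightarrow> r < s \<longrightarrow> alive D (walk x \<omega>) r) \<longrightarrow> x + Y s \<omega> \<in> D \<longrightarrow> alive D (walk x \<omega>) s)}"
      then obtain s where s: "\<omega> \<in> space M" "0 < s" "\<And>r. 0 \<le> r \<Longrightarrow> r < s \<Longrightarrow> alive D (walk x \<omega>) r" "x + Y s \<omega> \<in> D" "\<not> alive D (walk x \<omega>) s" by auto
      from jump_at_exit_detected[OF cadlag_translate[OF Y_cadlag] D s(2-)]
      show "\<omega> \<in> (\<Union>j. \<Inter>i. C2 j i)" using s(1) unfolding C2_def C1_def C_def by simp
    qed
  qed
qed

text \<open>One null set serves all times \<open>t\<close>, as the pathwise comparison of the killed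
  and the stopped process requires.\<close>

lemma AE_alive_iff_inside:
  assumes D: "open D" "- D \<noteq> {}"
  shows "AE \<omega> in M. \<forall>t\<ge>0. alive D (walk x \<omega>) t \<longleftrightarrow> (\<forall>r\<in>{0..t}. x + Y r \<omega> \<in> D)"
  using quasi_left_continuity[OF D(1), of x]
proof eventually_elim
  fix \<omega>
  assume q: "\<forall>s>0. (\<forall>r. 0 \<le> r \<longrightarrow> r < s \<longrightarrow> alive D (walk x \<omega>) r) \<longrightarrow> x + Y s \<omega> \<in> D \<longrightarrow> alive D (walk x \<omega>) s"
  show "\<forall>t\<ge>0. alive D (walk x \<omega>) t \<longleftrightarrow> (\<forall>r\<in>{0..t}. x + Y r \<omega> \<in> D)"
  proof (intro allI impI iffI ballI)
    fix t r assume "alive D (walk x \<omega>) t" "r \<in> {0..t}"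
    then show "x + Y r \<omega> \<in> D" using alive_in[of D "walk x \<omega>" t r] by simp
  next
    fix t :: real assume "0 \<le> t" "\<forall>r\<in>{0..t}. x + Y r \<omega> \<in> D"
    then show "alive D (walk x \<omega>) t"
      using alive_if_inside[OF cadlag_translate[OF Y_cadlag] D, of t x \<omega>] q by simp
  qed
qed

end

lemma alive_rat_restrict [simp]: "alive_rat D (restrict p {0..}) t = alive_rat D p t"
  by (simp add: alive_rat_def)

section \<open>The killed Feynman-Kac semigroup\<close>

text \<open>The last three assumptions record what is used of the subordinate structure and of the
  domain: smoothing by the heat kernel, a positive chance to leave \<open>D\<close> within unit
  time, and immediate exit from boundary points. The bounds on \<open>V\<close> are global because
  the potential will be one that is cut off outside \<open>D\<close>.\<close>

locale feynman_kac = cadlag_levy M Y for M :: "'w measure" and Y :: "real \<Rightarrow> 'w \<Rightarrow> 'a::euclidean_space" +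
  fixes D :: "'a set" and V :: "'a \<Rightarrow> real" and C :: real
  assumes D_open: "open D" and D_bounded: "bounded D"
    and V_measurable [measurable]: "V \<in> borel_measurable borel"
    and V_nonneg: "\<And>x. 0 \<le> V x" and V_le: "\<And>x. V x \<le> C"
    and feller: "\<And>t h c z x. 0 < t \<Longrightarrow> h \<in> borel_measurable borel \<Longrightarrow> (\<And>y. 0 \<le> h y) \<Longrightarrow> (\<And>y. h y \<le> (c::real)) \<Longrightarrow>
      (\<And>y. y \<notin> D \<Longrightarrow> h y = 0) \<Longrightarrow> z \<longlonglongrightarrow> x \<Longrightarrow>
      (\<lambda>n::nat. \<integral>\<^sup>+\<omega>. ennreal (h (z n + Y t \<omega>)) \<partial>M) \<longlonglongrightarrow> (\<integral>\<^sup>+\<omega>. ennreal (h (x + Y t \<omega>)) \<partial>M)"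
    and ball: "prob {\<omega>\<in>space M. norm (Y 1 \<omega>) \<le> diameter D} < 1"
    and regular: "\<And>z. z \<in> frontier D \<Longrightarrow> AE \<omega> in M. \<forall>t>0. \<exists>r. 0 < r \<and> r \<le> t \<and> z + Y r \<omega> \<notin> D"
begin

lemma C_nonneg: "0 \<le> C" using V_nonneg[of 0] V_le[of 0] by linarith

definition J :: "(real \<Rightarrow> 'a) \<Rightarrow> real \<Rightarrow> real" where
  "J p t = (LINT r|lborel. indicator {0..t} r * V (right_eval p r))"

text \<open>The multiplicative functional of killing and discounting. Through
  \<open>alive_rat\<close> and \<open>right_eval\<close> it is jointly measurable in path and
  time.\<close>

definition W :: "(real \<Rightarrow> 'a) \<Rightarrow> real \<Rightarrow> real" where
  "W p t = (if alive_rat D p t then exp (- J p t) else 0)"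

lemma J_restrict [simp]: "J (restrict p {0..}) t = J p t" by (simp add: J_def)

lemma W_restrict [simp]: "W (restrict p {0..}) t = W p t" by (simp add: W_def)

lemma J_nonneg: "0 \<le> J p t"
  unfolding J_def by (intro Bochner_Integration.integral_nonneg) (simp add: V_nonneg)

lemma W_nonneg [simp]: "0 \<le> W p t" by (simp add: W_def)

lemma W_le_1: "W p t \<le> 1" using J_nonneg by (simp add: W_def)

lemma measurable_right_eval_fixed:
  assumes "p \<in> space path_space" shows "(\<lambda>r. right_eval p r) \<in> borel_measurable borel"
  using assms by (intro measurable_right_eval[where P="\<lambda>_. p"]) auto

lemma integrable_indicator_Icc_scaleR: "integrable lborel (\<lambda>r. indicator {0..t} r *\<^sub>R (c::real))" for t :: real
proof -
  have "integrable lborel (indicator {0..t} :: real \<Rightarrow> real)"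
    by (rule integrable_real_indicator) (auto simp: emeasure_lborel_Icc_eq)
  then show ?thesis by (rule integrable_scaleR_left)
qed

lemma J_integrable: "integrable lborel (\<lambda>r. indicator {0..t} r * V (right_eval p r))"
proof -
  have [measurable]: "(\<lambda>r. right_eval p r) \<in> borel_measurable borel"
    using measurable_right_eval_fixed[of "restrict p {0..}"] by (simp add: space_PiM)
  show ?thesis
    by (rule Bochner_Integration.integrable_bound[OF integrable_indicator_Icc_scaleR[of t C]])
      (auto simp: V_nonneg V_le C_nonneg indicator_def)
qed

lemma J_le: "0 \<le> t \<Longrightarrow> J p t \<le> C * t"
proof -
  assume t: "0 \<le> t"
  have "J p t \<le> (LINT r|lborel. indicator {0..t} r *\<^sub>R C)"
    unfolding J_def by (intro integral_mono J_integrable integrable_indicator_Icc_scaleR) (auto simp: V_le C_nonneg indicator_def)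
  also have "\<dots> = C * t" using t by simp
  finally show ?thesis .
qed

lemma measurable_J [measurable (raw)]:
  assumes [measurable]: "P \<in> measurable N path_space" "R \<in> borel_measurable N"
  shows "(\<lambda>z. J (P z) (R z)) \<in> borel_measurable N"
  unfolding J_def indicator_def atLeastAtMost_iff by measurable

lemma measurable_W [measurable (raw)]:
  assumes [measurable]: "P \<in> measurable N path_space" "R \<in> borel_measurable N"
  shows "(\<lambda>z. W (P z) (R z)) \<in> borel_measurable N"
  unfolding W_def by measurable

lemma measurable_W_X [measurable (raw)]:
  assumes [measurable]: "x \<in> borel_measurable N" "\<omega> \<in> measurable N M" "R \<in> borel_measurable N"
  shows "(\<lambda>z. W (\<lambda>r. x z + Y r (\<omega> z)) (R z)) \<in> borel_measurable N"
  using measurable_W[OF measurable_X[OF assms(1,2)] assms(3)] by simp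

lemma measurable_right_eval_X [measurable (raw)]:
  assumes [measurable]: "x \<in> borel_measurable N" "\<omega> \<in> measurable N M" "R \<in> borel_measurable N"
  shows "(\<lambda>z. right_eval (\<lambda>r. x z + Y r (\<omega> z)) (R z)) \<in> borel_measurable N"
  using measurable_right_eval[OF measurable_X[OF assms(1,2)] assms(3)] by simp

lemma measurable_alive_rat_X [measurable (raw)]:
  assumes [measurable]: "x \<in> borel_measurable N" "\<omega> \<in> measurable N M" "R \<in> borel_measurable N"
  shows "Measurable.pred N (\<lambda>z. alive_rat D (\<lambda>r. x z + Y r (\<omega> z)) (R z))"
  using measurable_alive_rat[OF measurable_X[OF assms(1,2)] assms(3), of D] by simp

lemma X_cadlag: "cadlag (walk x \<omega>)"
  by (rule cadlag_translate[OF Y_cadlag])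

lemma J_glue:
  assumes p: "cadlag p" and q: "cadlag q" "q 0 = 0" and t: "0 \<le> t" and s: "0 \<le> s"
  shows "J (glue t p q) (t + s) = J p t + J (\<lambda>r. p t + q r) s"
proof -
  have c: "cadlag (glue t p q)" by (rule cadlag_glue) fact+
  have "J (\<lambda>r. p t + q r) s = \<bar>1\<bar> *\<^sub>R (LINT r|lborel. indicator {0..s} (- t + 1 * r) * V (right_eval (\<lambda>r. p t + q r) (- t + 1 * r)))"
    unfolding J_def by (rule lborel_integral_real_affine) simp
  then have 2: "J (\<lambda>r. p t + q r) s = (LINT r|lborel. indicator {0..s} (r - t) * V (right_eval (\<lambda>r. p t + q r) (r - t)))"
    by simp
  have 3: "integrable lborel (\<lambda>r. indicator {0..s} (r - t) * V (right_eval (\<lambda>r. p t + q r) (r - t)))"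
    using lborel_integrable_real_affine[OF J_integrable[of s "\<lambda>r. p t + q r"], of 1 "- t"] by simp
  have "J p t + J (\<lambda>r. p t + q r) s = (LINT r|lborel. indicator {0..t} r * V (right_eval p r) + indicator {0..s} (r - t) * V (right_eval (\<lambda>r. p t + q r) (r - t)))"
    unfolding 2 unfolding J_def using J_integrable 3 by (intro Bochner_Integration.integral_add[symmetric])
  also have "\<dots> = J (glue t p q) (t + s)"
    unfolding J_def
  proof (rule integral_cong_AE)
    show "AE r in lborel. indicator {0..t} r * V (right_eval p r) + indicator {0..s} (r - t) * V (right_eval (\<lambda>r. p t + q r) (r - t)) =
      indicator {0..t + s} r * V (right_eval (glue t p q) r)"
      \<comment> \<open>Both time intervals contain \<open>t\<close>; this single point is discarded
        as a null set.\<close>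
      using AE_lborel_singleton[of t]
    proof eventually_elim
      fix r assume r: "r \<noteq> t"
      show "indicator {0..t} r * V (right_eval p r) + indicator {0..s} (r - t) * V (right_eval (\<lambda>r. p t + q r) (r - t)) =
        indicator {0..t + s} r * V (right_eval (glue t p q) r)"
      proof (cases "r < t")
        case True
        have "right_eval (glue t p q) r = right_eval p r" if "0 \<le> r"
          unfolding right_eval_eq[OF p that] right_eval_eq[OF c that] using True by (simp add: glue_def)
        then show ?thesis using True s t by (cases "0 \<le> r") auto
      next
        case False
        then have rt: "t < r" using r by simp
        then have "right_eval (\<lambda>r. p t + q r) (r - t) = glue t p q r" "right_eval (glue t p q) r = glue t p q r"
          using t by (simp_all only: right_eval_eq[OF c] right_eval_eq[OF cadlag_translate[OF q(1)]] diff_ge_0_iff_ge less_imp_le order_trans[OF t])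
            (simp_all add: glue_def)
        then show ?thesis using rt s t by (auto simp: indicator_def)
      qed
    qed
  qed (use J_integrable 3 in \<open>auto intro!: borel_measurable_integrable\<close>)
  finally show ?thesis by simp
qed

lemma W_glue:
  assumes p: "cadlag p" and q: "cadlag q" "q 0 = 0" and t: "0 \<le> t" and s: "0 \<le> s"
  shows "W (glue t p q) (t + s) = W p t * W (\<lambda>r. p t + q r) s"
  unfolding W_def J_glue[OF assms] using assms
  by (simp add: alive_rat_eq cadlag_glue cadlag_translate alive_glue exp_add[symmetric])

text \<open>Values in \<open>ennreal\<close> admit sources and potentials before their finiteness is
  known.\<close>

definition Q :: "real \<Rightarrow> ('a \<Rightarrow> ennreal) \<Rightarrow> 'a \<Rightarrow> ennreal" where
  "Q t g x = (\<integral>\<^sup>+\<omega>. ennreal (W (walk x \<omega>) t) * g (right_eval (walk x \<omega>) t) \<partial>M)"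

lemma measurable_Q [measurable (raw)]:
  assumes [measurable]: "g \<in> borel_measurable borel" "R \<in> borel_measurable N" "x \<in> borel_measurable N"
  shows "(\<lambda>z. Q (R z) g (x z)) \<in> borel_measurable N"
  unfolding Q_def by measurable

lemma translate_glue: "(\<lambda>r. x + glue t p q r) = glue t (\<lambda>r. x + p r) q"
  by (auto simp: glue_def)

lemma restrict_translate_restrict: "restrict (\<lambda>r. x + restrict p {0..} r) {0..} = restrict (\<lambda>r. x + p r) {0..}"
  for x :: 'a and p :: "real \<Rightarrow> 'a"
  by (rule restrict_ext) simp

text \<open>Concatenation at time \<open>t\<close> splits the weight by \<open>W_glue\<close>, and
  the inner integral over the second copy is \<open>Q s g\<close> at the position reached.\<close>

lemma Q_semigroup:
  assumes [measurable]: "g \<in> borel_measurable borel" and t: "0 \<le> t" and s: "0 \<le> s"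
  shows "Q (t + s) g x = Q t (Q s g) x"
proof -
  define F where "F p = ennreal (W (restrict (\<lambda>r. x + p r) {0..}) (t + s)) * g (right_eval (restrict (\<lambda>r. x + p r) {0..}) (t + s))" for p
  have F[measurable]: "F \<in> borel_measurable path_space" unfolding F_def by measurable
  have Fr: "F (restrict p {0..}) = ennreal (W (\<lambda>r. x + p r) (t + s)) * g (right_eval (\<lambda>r. x + p r) (t + s))" for p
    unfolding F_def restrict_translate_restrict by simp
  have "Q (t + s) g x = (\<integral>\<^sup>+\<omega>. F (path_of Y \<omega>) \<partial>M)"
    unfolding Q_def path_of_def Fr ..
  also have "\<dots> = (\<integral>\<^sup>+\<omega>. \<integral>\<^sup>+\<omega>'. F (restrict (glue t (\<lambda>r. Y r \<omega>) (\<lambda>r. Y r \<omega>')) {0..}) \<partial>M \<partial>M)"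
    by (rule markov[OF F t])
  also have "\<dots> = (\<integral>\<^sup>+\<omega>. \<integral>\<^sup>+\<omega>'. ennreal (W (walk x \<omega>) t) *
       (ennreal (W (\<lambda>r. right_eval (walk x \<omega>) t + Y r \<omega>') s) * g (right_eval (\<lambda>r. right_eval (walk x \<omega>) t + Y r \<omega>') s)) \<partial>M \<partial>M)"
  proof (intro nn_integral_cong)
    fix \<omega> \<omega>'
    have "W (\<lambda>r. x + glue t (\<lambda>r. Y r \<omega>) (\<lambda>r. Y r \<omega>') r) (t + s) = W (walk x \<omega>) t * W (\<lambda>r. (x + Y t \<omega>) + Y r \<omega>') s"
      unfolding translate_glue by (rule W_glue[OF X_cadlag Y_cadlag Y_0 t s])
    moreover have "right_eval (\<lambda>r. x + glue t (\<lambda>r. Y r \<omega>) (\<lambda>r. Y r \<omega>') r) (t + s) = (x + Y t \<omega>) + Y s \<omega>'"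
      using t s by (subst right_eval_glue) (auto simp: glue_def)
    ultimately show "F (restrict (glue t (\<lambda>r. Y r \<omega>) (\<lambda>r. Y r \<omega>')) {0..}) = ennreal (W (walk x \<omega>) t) *
       (ennreal (W (\<lambda>r. right_eval (walk x \<omega>) t + Y r \<omega>') s) * g (right_eval (\<lambda>r. right_eval (walk x \<omega>) t + Y r \<omega>') s))"
      by (simp only: Fr right_eval_X[OF t] right_eval_X[OF s] ennreal_mult[OF W_nonneg W_nonneg] mult.assoc)
  qed
  also have "\<dots> = Q t (Q s g) x"
    unfolding Q_def by (intro nn_integral_cong nn_integral_cmult) measurable
  finally show ?thesis .
qed

lemma compl_D: "- D \<noteq> {}"
proof
  assume "- D = {}"
  then have "D = UNIV" by auto
  then show False using D_bounded not_bounded_UNIV by simp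
qed

lemma W_outside: "x \<notin> D \<Longrightarrow> 0 \<le> t \<Longrightarrow> W (walk x \<omega>) t = 0"
  using alive_in[of D "walk x \<omega>" t 0] by (auto simp: W_def alive_rat_eq[OF X_cadlag])

lemma W_not_alive: "0 \<le> t \<Longrightarrow> \<not> alive D (walk x \<omega>) t \<Longrightarrow> W (walk x \<omega>) t = 0"
  by (auto simp: W_def alive_rat_eq[OF X_cadlag])

lemma W_leaves: "x + Y t \<omega> \<notin> D \<Longrightarrow> 0 \<le> t \<Longrightarrow> W (walk x \<omega>) t = 0"
  using alive_in[of D "walk x \<omega>" t t] by (auto simp: W_def alive_rat_eq[OF X_cadlag])

lemma Q_outside: "x \<notin> D \<Longrightarrow> 0 \<le> t \<Longrightarrow> Q t g x = 0"
  by (simp add: Q_def W_outside)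

definition \<rho> :: real where "\<rho> = prob {\<omega>\<in>space M. norm (Y 1 \<omega>) \<le> diameter D}"

lemma \<rho>: "0 \<le> \<rho>" "\<rho> < 1" using ball by (auto simp: \<rho>_def)

text \<open>Two points of \<open>D\<close> are at most \<open>diameter D\<close> apart, so a path
  that starts in \<open>D\<close> and survives until time 1 has a displacement of at most that
  length. This contraction makes the potential finite.\<close>

lemma Q_1_le:
  assumes g: "\<And>y. g y \<le> c" shows "Q 1 g x \<le> c * ennreal \<rho>"
proof (cases "x \<in> D")
  case True
  have "Q 1 g x \<le> (\<integral>\<^sup>+\<omega>. c * indicator {\<omega>\<in>space M. norm (Y 1 \<omega>) \<le> diameter D} \<omega> \<partial>M)"
    unfolding Q_def
  proof (intro nn_integral_mono)
    fix \<omega> assume \<omega>: "\<omega> \<in> space M"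
    show "ennreal (W (walk x \<omega>) 1) * g (right_eval (walk x \<omega>) 1) \<le> c * indicator {\<omega>\<in>space M. norm (Y 1 \<omega>) \<le> diameter D} \<omega>"
    proof (cases "x + Y 1 \<omega> \<in> D")
      case in_D: True
      then have "norm (Y 1 \<omega>) \<le> diameter D"
        using diameter_bounded_bound[OF D_bounded True in_D] by (simp add: dist_norm)
      moreover have "ennreal (W (walk x \<omega>) 1) * g (right_eval (walk x \<omega>) 1) \<le> 1 * c"
        by (intro mult_mono g) (auto simp: W_le_1)
      ultimately show ?thesis using \<omega> by simp
    next
      case False
      then have "W (walk x \<omega>) 1 = 0" by (intro W_leaves) auto
      then show ?thesis by simp
    qed
  qed
  also have "\<dots> = c * ennreal \<rho>"
    unfolding \<rho>_def by (subst nn_integral_cmult_indicator) (auto simp: emeasure_eq_measure)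
  finally show ?thesis .
next
  case False
  then show ?thesis by (simp add: Q_outside)
qed

lemma Q_le: "Q t g x \<le> (\<integral>\<^sup>+\<omega>. g (right_eval (walk x \<omega>) t) \<partial>M)"
  unfolding Q_def
proof (intro nn_integral_mono)
  fix \<omega>
  have "ennreal (W (walk x \<omega>) t) * g (right_eval (walk x \<omega>) t) \<le> 1 * g (right_eval (walk x \<omega>) t)"
    by (intro mult_right_mono) (auto simp: W_le_1)
  then show "ennreal (W (walk x \<omega>) t) * g (right_eval (walk x \<omega>) t) \<le> g (right_eval (walk x \<omega>) t)" by simp
qed

end

text \<open>\<open>\<kappa>\<close> is a Kato-class condition: the expected integral of the source
  over a short time is small uniformly in the starting point. It is imposed on the free process,
  which dominates the killed one.\<close>

locale feynman_kac_source = feynman_kac +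
  fixes f :: "'b \<Rightarrow> ennreal" and \<kappa> :: "real \<Rightarrow> real"
  assumes f_measurable [measurable]: "f \<in> borel_measurable borel"
    and \<kappa>_nonneg: "\<And>e. 0 < e \<Longrightarrow> 0 \<le> \<kappa> e"
    and \<kappa>: "\<And>e x. 0 < e \<Longrightarrow> (\<integral>\<^sup>+s. (\<integral>\<^sup>+\<omega>. f (right_eval (walk x \<omega>) s) \<partial>M) * indicator {0..<e} s \<partial>lborel) \<le> ennreal (\<kappa> e)"
    and \<kappa>_tendsto: "(\<kappa> \<longlongrightarrow> 0) (at_right 0)"
begin

text \<open>It is applied to half-open time sets: \<open>{0..<t + u}\<close> is then the disjoint
  union of \<open>{0..<t}\<close> and the shift of \<open>{0..<u}\<close> by
  \<open>t\<close>.\<close>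

definition potential_on :: "real set \<Rightarrow> 'b \<Rightarrow> ennreal" where
  "potential_on A x = (\<integral>\<^sup>+s. Q s f x * indicator A s \<partial>lborel)"

lemma measurable_potential_on [measurable]:
  assumes [measurable]: "A \<in> sets borel"
  shows "potential_on A \<in> borel_measurable borel"
  unfolding potential_on_def[abs_def] by measurable

text \<open>Tonelli moves \<open>Q t\<close> inside the time integral, the semigroup property adds
  \<open>t\<close> to the time, and translation invariance of Lebesgue measure moves the shift to
  the indicator.\<close>

lemma Q_potential_on:
  assumes A[measurable]: "A \<in> sets borel" and A': "A \<subseteq> {0..}" and t: "0 \<le> t"
  shows "Q t (potential_on A) x = (\<integral>\<^sup>+s. Q s f x * indicator A (s - t) \<partial>lborel)"
proof -
  interpret MS: pair_sigma_finite M "lborel :: real measure" ..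
  have "Q t (potential_on A) x = (\<integral>\<^sup>+\<omega>. \<integral>\<^sup>+s. ennreal (W (walk x \<omega>) t) * (Q s f (right_eval (walk x \<omega>) t) * indicator A s) \<partial>lborel \<partial>M)"
    unfolding Q_def[of t] potential_on_def by (intro nn_integral_cong nn_integral_cmult[symmetric]) measurable
  also have "\<dots> = (\<integral>\<^sup>+s. \<integral>\<^sup>+\<omega>. ennreal (W (walk x \<omega>) t) * (Q s f (right_eval (walk x \<omega>) t) * indicator A s) \<partial>M \<partial>lborel)"
    by (rule MS.Fubini'[symmetric]) measurable
  also have "\<dots> = (\<integral>\<^sup>+s. Q (t + s) f x * indicator A s \<partial>lborel)"
  proof (intro nn_integral_cong)
    fix s :: real
    have "(\<integral>\<^sup>+\<omega>. ennreal (W (walk x \<omega>) t) * (Q s f (right_eval (walk x \<omega>) t) * indicator A s) \<partial>M) = Q t (Q s f) x * indicator A s"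
      unfolding Q_def[of t] by (subst nn_integral_multc[symmetric]) (auto simp: mult.assoc)
    also have "\<dots> = Q (t + s) f x * indicator A s"
      using A' t by (cases "s \<in> A") (auto simp: Q_semigroup)
    finally show "(\<integral>\<^sup>+\<omega>. ennreal (W (walk x \<omega>) t) * (Q s f (right_eval (walk x \<omega>) t) * indicator A s) \<partial>M) = Q (t + s) f x * indicator A s" .
  qed
  also have "\<dots> = (\<integral>\<^sup>+s. Q s f x * indicator A (s - t) \<partial>distr lborel borel ((+) t))"
    by (subst nn_integral_distr) auto
  finally show ?thesis by (simp add: lborel_distr_plus)
qed

lemma potential_on_split:
  assumes t: "0 \<le> t" and u: "0 \<le> u"
  shows "potential_on {0..<t + u} x = potential_on {0..<t} x + Q t (potential_on {0..<u}) x"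
proof -
  have sub: "{0..<u} \<subseteq> {0..}" by auto
  have "potential_on {0..<t + u} x = (\<integral>\<^sup>+s. Q s f x * indicator {0..<t} s + Q s f x * indicator {0..<u} (s - t) \<partial>lborel)"
    unfolding potential_on_def using t u by (intro nn_integral_cong) (auto simp: indicator_def)
  also have "\<dots> = potential_on {0..<t} x + Q t (potential_on {0..<u}) x"
    by (subst nn_integral_add) (auto simp: potential_on_def[of "{0..<t}"] Q_potential_on[OF _ sub t])
  finally show ?thesis .
qed

definition \<phi> :: "'b \<Rightarrow> ennreal" where "\<phi> = potential_on {0..}"

lemma \<phi>_measurable [measurable]: "\<phi> \<in> borel_measurable borel"
  unfolding \<phi>_def by measurable

lemma \<phi>_split:
  assumes t: "0 \<le> t"
  shows "\<phi> x = potential_on {0..<t} x + Q t \<phi> x"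
proof -
  have "\<phi> x = (\<integral>\<^sup>+s. Q s f x * indicator {0..<t} s + Q s f x * indicator {0..} (s - t) \<partial>lborel)"
    unfolding potential_on_def \<phi>_def using t by (intro nn_integral_cong) (auto simp: indicator_def)
  also have "\<dots> = potential_on {0..<t} x + Q t \<phi> x"
    unfolding \<phi>_def by (subst nn_integral_add) (auto simp: potential_on_def[of "{0..<t}"] Q_potential_on[of "{0..}"] t)
  finally show ?thesis .
qed

lemma potential_on_le: "0 < e \<Longrightarrow> potential_on {0..<e} x \<le> ennreal (\<kappa> e)"
  unfolding potential_on_def by (rule order_trans[OF nn_integral_mono \<kappa>]) (auto intro!: mult_right_mono Q_le)

text \<open>The fixed point of \<open>c = \<kappa> 1 + c * \<rho>\<close>, the recursion obtained by
  splitting off the first unit of time.\<close>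

definition potential_bound :: real where "potential_bound = \<kappa> 1 / (1 - \<rho>)"

lemma potential_bound_nonneg: "0 \<le> potential_bound" using \<rho> \<kappa>_nonneg[of 1] by (simp add: potential_bound_def)

lemma potential_on_le_bound: "potential_on {0..<real n} x \<le> ennreal potential_bound"
proof (induction n arbitrary: x)
  case 0
  then show ?case by (simp add: potential_on_def)
next
  case (Suc n)
  have "potential_on {0..<real (Suc n)} x = potential_on {0..<1} x + Q 1 (potential_on {0..<real n}) x"
    using potential_on_split[of 1 "real n" x] by (simp add: add.commute)
  also have "\<dots> \<le> ennreal (\<kappa> 1) + ennreal potential_bound * ennreal \<rho>"
    by (intro add_mono potential_on_le Q_1_le Suc.IH) auto
  also have "\<dots> = ennreal (\<kappa> 1 + potential_bound * \<rho>)"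
    using potential_bound_nonneg \<rho> \<kappa>_nonneg[of 1] by (simp add: ennreal_mult)
  also have "\<kappa> 1 + potential_bound * \<rho> = potential_bound"
    using \<rho> by (simp add: potential_bound_def field_simps)
  finally show ?case .
qed

lemma \<phi>_le_bnd: "\<phi> x \<le> ennreal potential_bound"
proof -
  have "\<phi> x = (\<integral>\<^sup>+s. (SUP n. Q s f x * indicator {0..<real n} s) \<partial>lborel)"
    unfolding \<phi>_def potential_on_def
  proof (intro nn_integral_cong)
    fix s :: real
    show "Q s f x * indicator {0..} s = (SUP n. Q s f x * indicator {0..<real n} s)"
    proof (cases "0 \<le> s")
      case True
      obtain N :: nat where N: "s < real N" using reals_Archimedean2 by blast
      show ?thesis
      proof (rule antisym)
        show "Q s f x * indicator {0..} s \<le> (SUP n. Q s f x * indicator {0..<real n} s)"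
          using N True by (intro SUP_upper2[of N]) auto
        show "(SUP n. Q s f x * indicator {0..<real n} s) \<le> Q s f x * indicator {0..} s"
          by (intro SUP_least) (auto simp: indicator_def)
      qed
    qed simp
  qed
  also have "\<dots> = (SUP n. potential_on {0..<real n} x)"
    unfolding potential_on_def
    by (intro nn_integral_monotone_convergence_SUP) (auto simp: incseq_def le_fun_def indicator_def)
  also have "\<dots> \<le> ennreal potential_bound" by (intro SUP_least potential_on_le_bound)
  finally show ?thesis .
qed

lemma \<phi>_outside: "x \<notin> D \<Longrightarrow> \<phi> x = 0"
proof -
  assume "x \<notin> D"
  then have 0: "Q s f x * indicator {0..} s = 0" for s by (cases "0 \<le> s") (auto simp: Q_outside)
  show ?thesis unfolding \<phi>_def potential_on_def 0 by simp
qed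

end

section \<open>Continuity of the potential, inside the domain and at its boundary\<close>

context cadlag_levy
begin

lemma small_if_not_big_move:
  assumes "\<not> big_move \<delta> h (path_of Y \<omega>) 0" "0 \<le> r" "r < h" shows "norm (Y r \<omega>) \<le> \<delta>"
proof (rule ccontr)
  assume "\<not> norm (Y r \<omega>) \<le> \<delta>"
  then have *: "\<delta> < norm (Y r \<omega>)" by simp
  have "((\<lambda>r. norm (Y r \<omega>)) \<longlongrightarrow> norm (Y r \<omega>)) (at_right r)"
    using Y_cadlag[of \<omega>] assms(2) by (intro tendsto_norm) (simp add: cadlag_def)
  from order_tendstoD(1)[OF this *] have "\<forall>\<^sub>F u in at_right r. \<delta> < norm (Y u \<omega>)" .
  then obtain a :: rat where a: "r < 0 + of_rat a" "0 + of_rat a < h" "\<delta> < norm (Y (0 + of_rat a) \<omega>)"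
    using assms(3) by (rule eventually_at_right_rat)
  moreover have "0 < (of_rat a :: real)" using a assms(2) by linarith
  ultimately have "big_move \<delta> h (path_of Y \<omega>) 0"
    unfolding big_move_def by (intro exI[of _ a]) (auto simp: right_eval_path_of)
  then show False using assms by simp
qed

end

context feynman_kac
begin

lemma alive_if_small:
  assumes "\<not> big_move \<delta> h (path_of Y \<omega>) 0" and "0 < \<delta>" "2 * \<delta> \<le> infdist x (- D)" "\<epsilon> < h"
  shows "alive D (walk x \<omega>) \<epsilon>"
proof -
  have "\<delta> \<le> infdist (x + Y r \<omega>) (- D)" if "r \<in> {0..\<epsilon>}" for r
  proof -
    have "norm (Y r \<omega>) \<le> \<delta>" using that assms by (intro small_if_not_big_move[OF assms(1)]) auto
    moreover have "infdist x (- D) \<le> infdist (x + Y r \<omega>) (- D) + dist x (x + Y r \<omega>)"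
      by (rule infdist_triangle)
    ultimately show ?thesis using assms by (simp add: dist_norm)
  qed
  then show ?thesis unfolding alive_iff_pos using assms by blast
qed

text \<open>Mass is lost only if the path moves by more than \<open>\<delta>\<close> before time
  \<open>h\<close>, or through the discount, which is at least
  \<open>exp (- (C * \<epsilon>))\<close>. The bound is the same for all points at distance at least
  \<open>2 * \<delta>\<close> from the complement.\<close>

lemma loss_le:
  assumes \<delta>: "0 < \<delta>" "2 * \<delta> \<le> infdist x (- D)" and \<epsilon>: "0 \<le> \<epsilon>" "\<epsilon> < h"
  shows "(\<integral>\<^sup>+\<omega>. ennreal (1 - W (walk x \<omega>) \<epsilon>) \<partial>M) \<le> move_prob \<delta> h + ennreal (1 - exp (- (C * \<epsilon>)))"
proof -
  have e1: "0 \<le> 1 - exp (- (C * \<epsilon>))" using C_nonneg \<epsilon> by simp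
  have "(\<integral>\<^sup>+\<omega>. ennreal (1 - W (walk x \<omega>) \<epsilon>) \<partial>M) \<le>
    (\<integral>\<^sup>+\<omega>. indicator {\<omega>\<in>space M. big_move \<delta> h (path_of Y \<omega>) 0} \<omega> + ennreal (1 - exp (- (C * \<epsilon>))) \<partial>M)"
  proof (intro nn_integral_mono)
    fix \<omega> assume \<omega>: "\<omega> \<in> space M"
    show "ennreal (1 - W (walk x \<omega>) \<epsilon>) \<le> indicator {\<omega>\<in>space M. big_move \<delta> h (path_of Y \<omega>) 0} \<omega> + ennreal (1 - exp (- (C * \<epsilon>)))"
    proof (cases "big_move \<delta> h (path_of Y \<omega>) 0")
      case True
      have "ennreal (1 - W (walk x \<omega>) \<epsilon>) \<le> 1 + 0" using W_nonneg by (simp add: ennreal_le_1)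
      also have "\<dots> \<le> 1 + ennreal (1 - exp (- (C * \<epsilon>)))" by (intro add_left_mono) simp
      finally show ?thesis using True \<omega> by simp
    next
      case False
      then have "alive_rat D (walk x \<omega>) \<epsilon>" using alive_if_small[OF False \<delta> \<epsilon>(2)] \<epsilon> by (simp add: alive_rat_eq[OF X_cadlag])
      then have "exp (- (C * \<epsilon>)) \<le> W (walk x \<omega>) \<epsilon>" using J_le[OF \<epsilon>(1)] by (simp add: W_def)
      then show ?thesis using False by (simp add: ennreal_leI)
    qed
  qed
  also have "\<dots> = move_prob \<delta> h + ennreal (1 - exp (- (C * \<epsilon>)))"
    unfolding move_prob_def by (subst nn_integral_add) (auto simp: emeasure_space_1)
  finally show ?thesis .
qed

definition survival :: "real \<Rightarrow> 'a \<Rightarrow> ennreal" where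
  "survival s y = (\<integral>\<^sup>+\<omega>. indicator {\<omega>. alive_rat D (walk y \<omega>) s} \<omega> \<partial>M)"

lemma survival_measurable [measurable]: "survival s \<in> borel_measurable borel"
  unfolding survival_def indicator_def mem_Collect_eq by measurable

lemma survival_le_1: "survival s y \<le> 1"
proof -
  have "survival s y \<le> (\<integral>\<^sup>+\<omega>. 1 \<partial>M)"
    unfolding survival_def by (intro nn_integral_mono) (auto simp: indicator_def)
  then show ?thesis by (simp add: emeasure_space_1)
qed

lemma survival_outside: "y \<notin> D \<Longrightarrow> 0 \<le> s \<Longrightarrow> survival s y = 0"
proof -
  assume "y \<notin> D" "0 \<le> s"
  then have "\<not> alive_rat D (walk y \<omega>) s" for \<omega>
    using alive_in[of D "walk y \<omega>" s 0] by (auto simp: alive_rat_eq[OF X_cadlag])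
  then show ?thesis unfolding survival_def by simp
qed

lemma Q_le_survival:
  assumes "\<And>y. g y \<le> c" shows "Q t g x \<le> c * survival t x"
proof -
  have "Q t g x \<le> (\<integral>\<^sup>+\<omega>. c * indicator {\<omega>. alive_rat D (walk x \<omega>) t} \<omega> \<partial>M)"
    unfolding Q_def
  proof (intro nn_integral_mono)
    fix \<omega>
    have "ennreal (W (walk x \<omega>) t) * g (right_eval (walk x \<omega>) t) \<le> 1 * c"
      by (intro mult_mono assms) (auto simp: W_le_1)
    then show "ennreal (W (walk x \<omega>) t) * g (right_eval (walk x \<omega>) t) \<le> c * indicator {\<omega>. alive_rat D (walk x \<omega>) t} \<omega>"
      by (auto simp: W_def indicator_def)
  qed
  also have "\<dots> = c * survival t x"
    unfolding survival_def indicator_def mem_Collect_eq by (rule nn_integral_cmult) measurable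
  finally show ?thesis .
qed

text \<open>If survival is observed only from time \<open>\<delta>\<close> on, its probability is an
  average of \<open>survival s\<close> over the position at time \<open>\<delta>\<close>. For
  \<open>\<delta> > 0\<close> such an average is continuous in the starting point by
  \<open>feller\<close>, although \<open>survival s\<close> itself is only known to be
  measurable.\<close>

lemma shifted_survival:
  assumes \<delta>: "0 \<le> \<delta>" and s: "0 \<le> s"
  shows "(\<integral>\<^sup>+\<omega>. indicator {\<omega>. alive D (\<lambda>r. x + Y (\<delta> + r) \<omega>) s} \<omega> \<partial>M) = (\<integral>\<^sup>+\<omega>. survival s (x + Y \<delta> \<omega>) \<partial>M)"
    "{\<omega>\<in>space M. alive D (\<lambda>r. x + Y (\<delta> + r) \<omega>) s} \<in> sets M"
proof -
  define T where "T p = restrict (\<lambda>r. x + p (\<delta> + r)) {0..}" for p :: "real \<Rightarrow> 'a"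
  define F where "F p = (indicator {p. alive_rat D (T p) s} p :: ennreal)" for p
  have [measurable]: "T \<in> measurable path_space path_space"
    unfolding T_def[abs_def] using \<delta> by (intro measurable_restrict) auto
  have F[measurable]: "F \<in> borel_measurable path_space"
    unfolding F_def indicator_def mem_Collect_eq by measurable
  have T: "T (restrict p {0..}) = restrict (\<lambda>r. x + p (\<delta> + r)) {0..}" for p
    unfolding T_def using \<delta> by (intro restrict_ext) simp
  have c: "cadlag (\<lambda>r. x + Y (\<delta> + r) \<omega>)" for \<omega>
    by (rule cadlag_translate[OF cadlag_shift[OF Y_cadlag \<delta>]])
  have e: "alive D (\<lambda>r. x + Y (\<delta> + r) \<omega>) s \<longleftrightarrow> alive_rat D (T (path_of Y \<omega>)) s" for \<omega>
    unfolding path_of_def T by (simp add: alive_rat_eq[OF c s])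
  show "{\<omega>\<in>space M. alive D (\<lambda>r. x + Y (\<delta> + r) \<omega>) s} \<in> sets M" unfolding e by measurable
  have "(\<integral>\<^sup>+\<omega>. indicator {\<omega>. alive D (\<lambda>r. x + Y (\<delta> + r) \<omega>) s} \<omega> \<partial>M) = (\<integral>\<^sup>+\<omega>. F (path_of Y \<omega>) \<partial>M)"
    by (simp add: F_def e indicator_def)
  also have "\<dots> = (\<integral>\<^sup>+\<omega>. \<integral>\<^sup>+\<omega>'. F (restrict (glue \<delta> (\<lambda>r. Y r \<omega>) (\<lambda>r. Y r \<omega>')) {0..}) \<partial>M \<partial>M)"
    by (rule markov[OF F \<delta>])
  also have "\<dots> = (\<integral>\<^sup>+\<omega>. survival s (x + Y \<delta> \<omega>) \<partial>M)"
    unfolding survival_def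
  proof (intro nn_integral_cong)
    fix \<omega> \<omega>'
    have "T (restrict (glue \<delta> (\<lambda>r. Y r \<omega>) (\<lambda>r. Y r \<omega>')) {0..}) = restrict (\<lambda>r. x + Y \<delta> \<omega> + Y r \<omega>') {0..}"
      unfolding T by (intro restrict_ext) (auto simp: glue_def)
    then show "F (restrict (glue \<delta> (\<lambda>r. Y r \<omega>) (\<lambda>r. Y r \<omega>')) {0..}) = indicator {\<omega>'. alive_rat D (\<lambda>r. x + Y \<delta> \<omega> + Y r \<omega>') s} \<omega>'"
      unfolding F_def indicator_def by simp
  qed
  finally show "(\<integral>\<^sup>+\<omega>. indicator {\<omega>. alive D (\<lambda>r. x + Y (\<delta> + r) \<omega>) s} \<omega> \<partial>M) = (\<integral>\<^sup>+\<omega>. survival s (x + Y \<delta> \<omega>) \<partial>M)" .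
qed

lemma survival_le_shifted:
  assumes "0 \<le> \<delta>" "\<delta> \<le> \<epsilon>"
  shows "survival \<epsilon> x \<le> (\<integral>\<^sup>+\<omega>. survival (\<epsilon> - \<delta>) (x + Y \<delta> \<omega>) \<partial>M)"
proof -
  have "survival \<epsilon> x \<le> (\<integral>\<^sup>+\<omega>. indicator {\<omega>. alive D (\<lambda>r. x + Y (\<delta> + r) \<omega>) (\<epsilon> - \<delta>)} \<omega> \<partial>M)"
    unfolding survival_def
  proof (intro nn_integral_mono)
    fix \<omega>
    have "alive D (\<lambda>r. x + Y (\<delta> + r) \<omega>) (\<epsilon> - \<delta>)" if "alive D (walk x \<omega>) \<epsilon>"
    proof -
      have "\<exists>e>0. \<forall>r\<in>{0..\<epsilon>}. e \<le> infdist (x + Y r \<omega>) (- D)" using that unfolding alive_iff_pos .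
      then obtain e where "e > 0" "\<forall>r\<in>{0..\<epsilon>}. e \<le> infdist (x + Y r \<omega>) (- D)" by (elim exE conjE)
      then show ?thesis unfolding alive_iff_pos using assms by (intro exI[of _ e]) auto
    qed
    then show "(indicator {\<omega>. alive_rat D (walk x \<omega>) \<epsilon>} \<omega> :: ennreal) \<le> indicator {\<omega>. alive D (\<lambda>r. x + Y (\<delta> + r) \<omega>) (\<epsilon> - \<delta>)} \<omega>"
      using assms by (auto simp: indicator_def alive_rat_eq[OF X_cadlag])
  qed
  then show ?thesis using assms by (simp add: shifted_survival)
qed

text \<open>As the unobserved initial period shrinks, the events decrease, and
  \<open>regular\<close> gives an exit at some positive time up to \<open>\<epsilon>\<close>, which
  is eventually observed. Survival from time 0 on is trivially impossible at \<open>z\<close> and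
  would say nothing about neighbouring points.\<close>

lemma shifted_survival_tendsto:
  assumes z: "z \<in> frontier D" and \<epsilon>: "0 < \<epsilon>"
  shows "(\<lambda>n. \<integral>\<^sup>+\<omega>. survival (\<epsilon> - \<epsilon> / Suc n) (z + Y (\<epsilon> / Suc n) \<omega>) \<partial>M) \<longlonglongrightarrow> 0"
proof -
  define \<delta> where "\<delta> n = \<epsilon> / Suc n" for n :: nat
  have \<delta>: "0 < \<delta> n" "\<delta> n \<le> \<epsilon>" for n using \<epsilon> by (auto simp: \<delta>_def field_simps)
  have \<delta>_mono: "\<delta> n \<le> \<delta> m" if "m \<le> n" for m n using \<epsilon> that unfolding \<delta>_def by (intro divide_left_mono) auto
  have \<delta>_0: "\<delta> \<longlonglongrightarrow> 0"
    using tendsto_mult[OF tendsto_const[of \<epsilon>] LIMSEQ_inverse_real_of_nat] by (simp add: \<delta>_def[abs_def] divide_inverse)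
  define A where "A n = {\<omega>\<in>space M. alive D (\<lambda>r. z + Y (\<delta> n + r) \<omega>) (\<epsilon> - \<delta> n)}" for n
  have [measurable]: "A n \<in> sets M" for n unfolding A_def using \<delta>[of n] by (intro shifted_survival) auto
  have eA: "emeasure M (A n) = (\<integral>\<^sup>+\<omega>. survival (\<epsilon> - \<delta> n) (z + Y (\<delta> n) \<omega>) \<partial>M)" for n
  proof -
    have "emeasure M (A n) = (\<integral>\<^sup>+\<omega>. indicator (A n) \<omega> \<partial>M)" by simp
    also have "\<dots> = (\<integral>\<^sup>+\<omega>. indicator {\<omega>. alive D (\<lambda>r. z + Y (\<delta> n + r) \<omega>) (\<epsilon> - \<delta> n)} \<omega> \<partial>M)"
      by (intro nn_integral_cong) (auto simp: A_def indicator_def)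
    finally show ?thesis using \<delta>[of n] by (simp add: shifted_survival)
  qed
  have inA: "\<omega> \<in> A n \<longleftrightarrow> \<omega> \<in> space M \<and> (\<exists>e>0. \<forall>r\<in>{\<delta> n..\<epsilon>}. e \<le> infdist (z + Y r \<omega>) (- D))" for n \<omega>
  proof -
    have "(\<forall>r\<in>{0..\<epsilon> - \<delta> n}. e \<le> infdist (z + Y (\<delta> n + r) \<omega>) (- D)) \<longleftrightarrow> (\<forall>r\<in>{\<delta> n..\<epsilon>}. e \<le> infdist (z + Y r \<omega>) (- D))" (is "?L \<longleftrightarrow> ?R") for e
    proof
      assume ?L
      show ?R
      proof
        fix r assume "r \<in> {\<delta> n..\<epsilon>}"
        then show "e \<le> infdist (z + Y r \<omega>) (- D)" using \<open>?L\<close>[rule_format, of "r - \<delta> n"] by simp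
      qed
    next
      assume ?R
      then show ?L using \<delta>[of n] by auto
    qed
    then show ?thesis unfolding A_def alive_iff_pos by simp
  qed
  have "(\<lambda>n. emeasure M (A n)) \<longlonglongrightarrow> emeasure M (\<Inter>n. A n)"
  proof (rule Lim_emeasure_decseq)
    have "A n \<subseteq> A m" if "m \<le> n" for m n
    proof
      fix \<omega> assume "\<omega> \<in> A n"
      then obtain e where "\<omega> \<in> space M" "e>0" "\<forall>r\<in>{\<delta> n..\<epsilon>}. e \<le> infdist (z + Y r \<omega>) (- D)" unfolding inA by blast
      then show "\<omega> \<in> A m" unfolding inA using \<delta>_mono[OF that] by (intro conjI exI[of _ e]) auto
    qed
    then show "decseq A" by (auto simp: decseq_def)
  qed auto
  moreover have "emeasure M (\<Inter>n. A n) = 0"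
  proof -
    have "AE \<omega> in M. \<omega> \<notin> (\<Inter>n. A n)"
      using regular[OF z]
    proof eventually_elim
      fix \<omega> assume "\<forall>t>0. \<exists>r. 0 < r \<and> r \<le> t \<and> z + Y r \<omega> \<notin> D"
      then obtain r where r: "0 < r" "r \<le> \<epsilon>" "z + Y r \<omega> \<notin> D" using \<epsilon> by blast
      have "\<forall>\<^sub>F n in sequentially. \<delta> n < r" using order_tendstoD(2)[OF \<delta>_0 r(1)] .
      then obtain n where n: "\<delta> n < r" by (auto simp: eventually_sequentially)
      have 0: "infdist (z + Y r \<omega>) (- D) = 0" using r(3) by (intro infdist_zero) simp
      have "\<omega> \<notin> A n"
      proof
        assume "\<omega> \<in> A n"
        then have "\<exists>e>0. \<forall>r\<in>{\<delta> n..\<epsilon>}. e \<le> infdist (z + Y r \<omega>) (- D)" unfolding inA by simp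
        then obtain e where e: "0 < e" "\<forall>r\<in>{\<delta> n..\<epsilon>}. e \<le> infdist (z + Y r \<omega>) (- D)" by (elim exE conjE)
        have "e \<le> infdist (z + Y r \<omega>) (- D)" by (rule bspec[OF e(2)]) (use n r in simp)
        then show False using e 0 by simp
      qed
      then show "\<omega> \<notin> (\<Inter>n. A n)" by blast
    qed
    moreover have "(\<Inter>n. A n) \<in> sets M" by auto
    ultimately have "(\<Inter>n. A n) \<in> null_sets M" by (simp only: AE_iff_null_sets)
    then show ?thesis by (rule null_setsD1)
  qed
  ultimately show ?thesis unfolding eA \<delta>_def by simp
qed

lemma survival_tendsto_boundary:
  assumes z: "z \<in> frontier D" and \<epsilon>: "0 < \<epsilon>" and y: "y \<longlonglongrightarrow> z"
  shows "(\<lambda>k::nat. survival \<epsilon> (y k)) \<longlonglongrightarrow> 0"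
proof (rule order_tendstoI)
  fix a :: ennreal assume a: "0 < a"
  obtain n where n: "(\<integral>\<^sup>+\<omega>. survival (\<epsilon> - \<epsilon> / Suc n) (z + Y (\<epsilon> / Suc n) \<omega>) \<partial>M) < a"
    using order_tendstoD(2)[OF shifted_survival_tendsto[OF z \<epsilon>] a] by (auto simp: eventually_sequentially)
  define \<delta> where "\<delta> = \<epsilon> / Suc n"
  have \<delta>: "0 < \<delta>" "\<delta> \<le> \<epsilon>" using \<epsilon> by (auto simp: \<delta>_def field_simps)
  have r: "survival (\<epsilon> - \<delta>) x = ennreal (enn2real (survival (\<epsilon> - \<delta>) x))" for x
    using survival_le_1[of "\<epsilon> - \<delta>" x] by (intro ennreal_enn2real[symmetric]) (auto intro: le_less_trans)
  have "(\<lambda>k. \<integral>\<^sup>+\<omega>. ennreal (enn2real (survival (\<epsilon> - \<delta>) (y k + Y \<delta> \<omega>))) \<partial>M) \<longlonglongrightarrow>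
    (\<integral>\<^sup>+\<omega>. ennreal (enn2real (survival (\<epsilon> - \<delta>) (z + Y \<delta> \<omega>))) \<partial>M)"
    by (rule feller[OF \<delta>(1), where c=1])
      (use \<delta> y survival_le_1 in \<open>auto simp: survival_outside intro!: enn2real_leI\<close>)
  then have "(\<lambda>k. \<integral>\<^sup>+\<omega>. survival (\<epsilon> - \<delta>) (y k + Y \<delta> \<omega>) \<partial>M) \<longlonglongrightarrow> (\<integral>\<^sup>+\<omega>. survival (\<epsilon> - \<delta>) (z + Y \<delta> \<omega>) \<partial>M)"
    by (simp only: r[symmetric])
  from order_tendstoD(2)[OF this n[folded \<delta>_def]]
  show "\<forall>\<^sub>F k in sequentially. survival \<epsilon> (y k) < a"
  proof eventually_elim
    case (elim k)
    with survival_le_shifted[of \<delta> \<epsilon> "y k"] \<delta> show ?case by (simp add: le_less_trans)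
  qed
qed simp

end

context feynman_kac_source
begin

definition \<psi> :: "'b \<Rightarrow> real" where "\<psi> x = enn2real (\<phi> x)"

lemma \<phi>_eq_\<psi>: "\<phi> x = ennreal (\<psi> x)"
  unfolding \<psi>_def using \<phi>_le_bnd[of x] by (intro ennreal_enn2real[symmetric]) (auto intro: le_less_trans)

lemma \<psi>_nonneg: "0 \<le> \<psi> x" by (simp add: \<psi>_def)

lemma \<psi>_le_bnd: "\<psi> x \<le> potential_bound"
  using \<phi>_le_bnd[of x] potential_bound_nonneg by (simp add: \<phi>_eq_\<psi>)

lemma \<psi>_outside: "x \<notin> D \<Longrightarrow> \<psi> x = 0"
  by (simp add: \<psi>_def \<phi>_outside)

lemma \<psi>_measurable [measurable]: "\<psi> \<in> borel_measurable borel"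
  unfolding \<psi>_def[abs_def] by measurable

text \<open>Expectation of \<open>\<psi>\<close> under the free process, without killing or
  discount, so that \<open>feller\<close> applies to it.\<close>

definition G :: "real \<Rightarrow> 'b \<Rightarrow> real" where "G \<epsilon> x = enn2real (\<integral>\<^sup>+\<omega>. ennreal (\<psi> (x + Y \<epsilon> \<omega>)) \<partial>M)"

lemma G_eq: "ennreal (G \<epsilon> x) = (\<integral>\<^sup>+\<omega>. ennreal (\<psi> (x + Y \<epsilon> \<omega>)) \<partial>M)"
proof -
  have "(\<integral>\<^sup>+\<omega>. ennreal (\<psi> (x + Y \<epsilon> \<omega>)) \<partial>M) \<le> (\<integral>\<^sup>+\<omega>. ennreal potential_bound \<partial>M)"
    by (intro nn_integral_mono ennreal_leI \<psi>_le_bnd)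
  then have "(\<integral>\<^sup>+\<omega>. ennreal (\<psi> (x + Y \<epsilon> \<omega>)) \<partial>M) \<le> ennreal potential_bound" by (simp add: emeasure_space_1)
  then show ?thesis unfolding G_def by (intro ennreal_enn2real) (auto intro: le_less_trans)
qed

lemma G_nonneg: "0 \<le> G \<epsilon> x" by (simp add: G_def)

lemma G_continuous: "0 < \<epsilon> \<Longrightarrow> continuous_on A (G \<epsilon>)"
proof (rule continuous_on_sequentiallyI)
  fix u :: "nat \<Rightarrow> 'b" and a assume \<epsilon>: "0 < \<epsilon>" and u: "u \<longlonglongrightarrow> a"
  have "(\<lambda>n. \<integral>\<^sup>+\<omega>. ennreal (\<psi> (u n + Y \<epsilon> \<omega>)) \<partial>M) \<longlonglongrightarrow> (\<integral>\<^sup>+\<omega>. ennreal (\<psi> (a + Y \<epsilon> \<omega>)) \<partial>M)"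
    by (rule feller[OF \<epsilon>, where c=potential_bound]) (auto simp: \<psi>_nonneg \<psi>_le_bnd \<psi>_outside u)
  then have "(\<lambda>n. ennreal (G \<epsilon> (u n))) \<longlonglongrightarrow> ennreal (G \<epsilon> a)" by (simp only: G_eq)
  then show "(\<lambda>n. G \<epsilon> (u n)) \<longlonglongrightarrow> G \<epsilon> a" by (simp add: tendsto_ennreal_iff G_nonneg)
qed

lemma move_prob_real: "move_prob \<delta> h = ennreal (enn2real (move_prob \<delta> h))"
  unfolding move_prob_def by (simp add: emeasure_eq_measure)

text \<open>\<open>\<psi>\<close> is a short-time potential plus the killed expectation of
  \<open>\<psi>\<close>. The first is at most \<open>\<kappa> \<epsilon>\<close>; replacing the
  killed expectation by the free one adds at most \<open>potential_bound\<close> times the lost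
  mass.\<close>

lemma \<psi>_approx:
  assumes \<delta>: "0 < \<delta>" "2 * \<delta> \<le> infdist x (- D)" and \<epsilon>: "0 < \<epsilon>" "\<epsilon> < h"
  shows "\<bar>G \<epsilon> x - \<psi> x\<bar> \<le> \<kappa> \<epsilon> + potential_bound * (enn2real (move_prob \<delta> h) + (1 - exp (- (C * \<epsilon>))))"
proof -
  let ?L = "enn2real (move_prob \<delta> h) + (1 - exp (- (C * \<epsilon>)))"
  have L: "0 \<le> ?L" using C_nonneg \<epsilon> by simp
  have [measurable]: "Y \<epsilon> \<in> borel_measurable M" using \<epsilon> by simp
  have "ennreal (\<psi> x) \<le> ennreal (\<kappa> \<epsilon>) + ennreal (G \<epsilon> x)"
    unfolding \<phi>_eq_\<psi>[symmetric] \<phi>_split[OF less_imp_le[OF \<epsilon>(1)], of x] G_eq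
    using Q_le[of \<epsilon> \<phi> x] \<epsilon> by (intro add_mono potential_on_le) (simp_all add: \<phi>_eq_\<psi>)
  also have "\<dots> = ennreal (\<kappa> \<epsilon> + G \<epsilon> x)" using \<kappa>_nonneg[OF \<epsilon>(1)] G_nonneg by (simp add: ennreal_plus)
  finally have 1: "\<psi> x \<le> \<kappa> \<epsilon> + G \<epsilon> x" using \<kappa>_nonneg[OF \<epsilon>(1)] G_nonneg[of \<epsilon> x] by (subst (asm) ennreal_le_iff) auto
  have "ennreal (G \<epsilon> x) \<le> (\<integral>\<^sup>+\<omega>. ennreal (W (walk x \<omega>) \<epsilon>) * ennreal (\<psi> (x + Y \<epsilon> \<omega>)) + ennreal potential_bound * ennreal (1 - W (walk x \<omega>) \<epsilon>) \<partial>M)"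
    unfolding G_eq
  proof (intro nn_integral_mono)
    fix \<omega>
    let ?w = "W (walk x \<omega>) \<epsilon>"
    have "\<psi> (x + Y \<epsilon> \<omega>) = ?w * \<psi> (x + Y \<epsilon> \<omega>) + \<psi> (x + Y \<epsilon> \<omega>) * (1 - ?w)" by (simp add: algebra_simps)
    also have "\<dots> \<le> ?w * \<psi> (x + Y \<epsilon> \<omega>) + potential_bound * (1 - ?w)"
      using W_le_1[of "walk x \<omega>" \<epsilon>] by (intro add_left_mono mult_right_mono \<psi>_le_bnd) auto
    finally show "ennreal (\<psi> (x + Y \<epsilon> \<omega>)) \<le> ennreal ?w * ennreal (\<psi> (x + Y \<epsilon> \<omega>)) + ennreal potential_bound * ennreal (1 - ?w)"
      using W_le_1[of "walk x \<omega>" \<epsilon>] potential_bound_nonneg \<psi>_nonneg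
      by (simp add: ennreal_mult[symmetric] ennreal_plus[symmetric] ennreal_leI del: ennreal_plus)
  qed
  also have "\<dots> = Q \<epsilon> \<phi> x + ennreal potential_bound * (\<integral>\<^sup>+\<omega>. ennreal (1 - W (walk x \<omega>) \<epsilon>) \<partial>M)"
    unfolding Q_def using \<epsilon> by (simp add: nn_integral_add nn_integral_cmult \<phi>_eq_\<psi>)
  also have "\<dots> \<le> \<phi> x + ennreal potential_bound * (move_prob \<delta> h + ennreal (1 - exp (- (C * \<epsilon>))))"
    using \<phi>_split[OF less_imp_le[OF \<epsilon>(1)], of x] \<epsilon>
    by (intro add_mono mult_left_mono loss_le[OF \<delta>]) auto
  also have "\<dots> = ennreal (\<psi> x + potential_bound * ?L)"
    using \<psi>_nonneg potential_bound_nonneg L C_nonneg \<epsilon> by (subst move_prob_real) (simp add: \<phi>_eq_\<psi> ennreal_mult ennreal_plus)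
  finally have 2: "G \<epsilon> x \<le> \<psi> x + potential_bound * ?L"
    using \<psi>_nonneg[of x] potential_bound_nonneg L by (subst (asm) ennreal_le_iff) auto
  show ?thesis using 1 2 \<kappa>_nonneg[OF \<epsilon>(1)] potential_bound_nonneg L by (simp add: abs_le_iff) (smt (verit) mult_nonneg_nonneg)
qed

lemma \<psi>_continuous_inside:
  assumes x: "x \<in> D" shows "isCont \<psi> x"
proof -
  define \<delta> where "\<delta> = infdist x (- D) / 4"
  have "closed (- D)" by (rule closed_Compl[OF D_open])
  then have "infdist x (- D) \<noteq> 0" using x in_closed_iff_infdist_zero[OF _ compl_D] by blast
  then have \<delta>: "0 < \<delta>" using infdist_nonneg[of x "- D"] by (simp add: \<delta>_def)
  \<comment> \<open>\<open>infdist x (- D)\<close> equals \<open>4 * \<delta>\<close>, so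
    \<open>U\<close> is a neighbourhood of \<open>x\<close>, and the approximation error is uniform
    on it.\<close>
  define U where "U = {y. 2 * \<delta> < infdist y (- D)}"
  have U: "open U" unfolding U_def by (intro open_Collect_less continuous_intros)
  have xU: "x \<in> U" using \<delta> by (simp add: U_def \<delta>_def)
  define \<epsilon> where "\<epsilon> n = 1 / (2 * real (Suc n))" for n
  have \<epsilon>: "0 < \<epsilon> n" "\<epsilon> n < 1 / real (Suc n)" for n by (auto simp: \<epsilon>_def field_simps)
  have \<epsilon>_0: "\<epsilon> \<longlonglongrightarrow> 0"
  proof -
    have "\<epsilon> = (\<lambda>n. 1 / 2 * inverse (real (Suc n)))" unfolding \<epsilon>_def by (rule ext) (simp add: field_simps)
    then show ?thesis using tendsto_mult[OF tendsto_const[of "1/2"] LIMSEQ_inverse_real_of_nat] by simp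
  qed
  define E where "E n = \<kappa> (\<epsilon> n) + potential_bound * (enn2real (move_prob \<delta> (1 / Suc n)) + (1 - exp (- (C * \<epsilon> n))))" for n
  have \<kappa>_0: "(\<lambda>n. \<kappa> (\<epsilon> n)) \<longlonglongrightarrow> 0"
    by (rule filterlim_compose[OF \<kappa>_tendsto]) (use \<epsilon>_0 \<epsilon> in \<open>auto simp: filterlim_at less_imp_neq[symmetric]\<close>)
  have m_0: "(\<lambda>n. enn2real (move_prob \<delta> (1 / real (Suc n)))) \<longlonglongrightarrow> 0"
    using tendsto_enn2real[OF move_prob_tendsto[OF \<delta>, unfolded ennreal_0[symmetric]]] by simp
  have "E \<longlonglongrightarrow> 0 + potential_bound * (0 + (1 - exp (- (C * 0))))"
    unfolding E_def
    by (rule tendsto_add[OF \<kappa>_0 tendsto_mult[OF tendsto_const tendsto_add[OF m_0 tendsto_diff[OF tendsto_const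
      tendsto_exp[OF tendsto_minus[OF tendsto_mult[OF tendsto_const \<epsilon>_0]]]]]]])
  then have E0: "E \<longlonglongrightarrow> 0" by simp
  have "uniform_limit U (\<lambda>n. G (\<epsilon> n)) \<psi> sequentially"
  proof (rule uniform_limitI)
    fix e :: real assume "0 < e"
    from order_tendstoD(2)[OF E0 this] show "\<forall>\<^sub>F n in sequentially. \<forall>y\<in>U. dist (G (\<epsilon> n) y) (\<psi> y) < e"
    proof eventually_elim
      case (elim n)
      show ?case
      proof
        fix y assume "y \<in> U"
        then have "\<bar>G (\<epsilon> n) y - \<psi> y\<bar> \<le> E n" unfolding E_def U_def using \<epsilon>[of n] \<delta> by (intro \<psi>_approx) auto
        then show "dist (G (\<epsilon> n) y) (\<psi> y) < e" using elim by (simp add: dist_real_def)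
      qed
    qed
  qed
  then have "continuous_on U \<psi>"
    by (rule uniform_limit_theorem[rotated]) (auto intro!: always_eventually G_continuous \<epsilon>)
  then show ?thesis using U xU by (simp add: continuous_on_eq_continuous_at)
qed

text \<open>The contribution of the times before \<open>\<epsilon>\<close> is below
  \<open>a / 2\<close> uniformly in the point, by the choice of \<open>\<epsilon>\<close>. The rest
  is at most \<open>potential_bound\<close> times the probability to survive until
  \<open>\<epsilon>\<close>, which tends to 0 at \<open>z\<close>.\<close>

lemma \<psi>_continuous_boundary:
  assumes z: "z \<in> frontier D" shows "isCont \<psi> z"
  unfolding continuous_at_sequentially
proof (intro allI impI)
  fix y :: "nat \<Rightarrow> 'b" assume y: "y \<longlonglongrightarrow> z"
  have "z \<notin> D" using z D_open by (simp add: frontier_def interior_open)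
  then have \<psi>z: "\<psi> z = 0" by (rule \<psi>_outside)
  show "(\<psi> \<circ> y) \<longlonglongrightarrow> \<psi> z"
    unfolding \<psi>z comp_def
  proof (rule order_tendstoI)
    fix a :: real assume "a < 0" then show "\<forall>\<^sub>F k in sequentially. a < \<psi> (y k)"
      using \<psi>_nonneg by (intro always_eventually) (auto intro: less_le_trans)
  next
    fix a :: real assume a: "0 < a"
    have "\<forall>\<^sub>F e in at_right 0. \<kappa> e < a / 2" using order_tendstoD(2)[OF \<kappa>_tendsto, of "a / 2"] a by simp
    then obtain \<epsilon> where \<epsilon>: "0 < \<epsilon>" "\<kappa> \<epsilon> < a / 2"
      unfolding eventually_at_right_field by (meson dense)
    have "(\<lambda>k. ennreal potential_bound * survival \<epsilon> (y k)) \<longlonglongrightarrow> ennreal potential_bound * 0"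
      by (rule ennreal_tendsto_cmult[OF _ survival_tendsto_boundary[OF z \<epsilon>(1) y]]) simp
    then have "\<forall>\<^sub>F k in sequentially. ennreal potential_bound * survival \<epsilon> (y k) < ennreal (a / 2)"
      using a by (intro order_tendstoD(2)) auto
    then show "\<forall>\<^sub>F k in sequentially. \<psi> (y k) < a"
    proof eventually_elim
      case (elim k)
      have "ennreal (\<psi> (y k)) \<le> ennreal (\<kappa> \<epsilon>) + ennreal potential_bound * survival \<epsilon> (y k)"
        unfolding \<phi>_eq_\<psi>[symmetric] \<phi>_split[OF less_imp_le[OF \<epsilon>(1)], of "y k"]
        by (intro add_mono potential_on_le[OF \<epsilon>(1)] Q_le_survival \<phi>_le_bnd)
      also have "\<dots> \<le> ennreal (\<kappa> \<epsilon>) + ennreal (a / 2)" using elim by (intro add_left_mono) simp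
      also have "\<dots> = ennreal (\<kappa> \<epsilon> + a / 2)" using \<kappa>_nonneg[OF \<epsilon>(1)] a by (simp add: ennreal_plus)
      finally have "\<psi> (y k) \<le> \<kappa> \<epsilon> + a / 2" using \<kappa>_nonneg[OF \<epsilon>(1)] a by (subst (asm) ennreal_le_iff) auto
      then show ?case using \<epsilon> by simp
    qed
  qed
qed

lemma \<psi>_continuous: "continuous_on UNIV \<psi>"
proof (rule continuous_at_imp_continuous_on, rule ballI)
  fix x
  consider "x \<in> D" | "x \<in> frontier D" | "x \<notin> closure D"
    using D_open by (auto simp: frontier_def interior_open)
  then show "isCont \<psi> x"
  proof cases
    case 3
    have "continuous_on (- closure D) \<psi>"
      by (rule continuous_on_cong[THEN iffD2, OF refl _ continuous_on_const[of _ 0]])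
         (use closure_subset in \<open>auto intro!: \<psi>_outside\<close>)
    then show ?thesis using 3 by (auto simp: continuous_on_eq_continuous_at open_Compl)
  qed (auto intro: \<psi>_continuous_inside \<psi>_continuous_boundary)
qed

end

section \<open>Weak solutions\<close>

text \<open>Stopped quantities need not be measurable for \<open>M\<close>, but they agree almost
  surely with measurable functionals of the killed path. The same transfer serves the time integrals
  over completed Lebesgue measure.\<close>

lemma integrable_completion_AE:
  fixes F F' :: "'w \<Rightarrow> real"
  assumes F': "integrable M F'" and eq: "AE x in M. F x = F' x"
  shows "integrable (completion M) F" "integral\<^sup>L (completion M) F = integral\<^sup>L M F'"
proof -
  have m: "F' \<in> borel_measurable M" using F' by auto
  have eq': "AE x in completion M. F x = F' x" using eq by (rule AE_completion)
  have mF: "F \<in> borel_measurable (completion M)"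
  proof (rule measurableI)
    fix A :: "real set" assume A: "A \<in> sets borel"
    show "F -` A \<inter> space (completion M) \<in> sets (completion M)"
    proof (rule completion.in_sets_AE)
      show "AE x in completion M. (x \<in> F' -` A \<inter> space M) \<longleftrightarrow> (x \<in> F -` A \<inter> space (completion M))"
        using eq' by eventually_elim auto
      show "F' -` A \<inter> space M \<in> sets (completion M)"
        using measurable_sets[OF m A] by (rule sets_completionI_sets)
    qed auto
  qed simp
  have mF': "F' \<in> borel_measurable (completion M)" using m by (rule measurable_completion)
  have i: "integrable (completion M) F'" using F' m by (simp add: integrable_completion)
  show "integrable (completion M) F" using integrable_cong_AE[OF mF mF' eq'] i by simp
  have "integral\<^sup>L (completion M) F = integral\<^sup>L (completion M) F'" by (rule integral_cong_AE[OF mF mF' eq'])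
  then show "integral\<^sup>L (completion M) F = integral\<^sup>L M F'" using m by (simp add: integral_completion)
qed

text \<open>The infimum of the exit times is attained: were the path in \<open>D\<close> at that
  time, right-continuity and openness would keep it there for a while. It is positive because
  \<open>p 0 \<in> D\<close>.\<close>

lemma stopped_time_cases:
  fixes p :: "real \<Rightarrow> 'a::euclidean_space"
  assumes p: "cadlag p" and D: "open D" and p0: "p 0 \<in> D" and t: "0 \<le> t"
  obtains (stays) "stopped_time D t p = t" "\<And>r. 0 \<le> r \<Longrightarrow> r \<le> t \<Longrightarrow> p r \<in> D"
    | (exits) "0 < stopped_time D t p" "stopped_time D t p \<le> t" "p (stopped_time D t p) \<notin> D"
        "\<And>r. 0 \<le> r \<Longrightarrow> r < stopped_time D t p \<Longrightarrow> p r \<in> D"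
proof (cases "\<forall>r. 0 \<le> r \<longrightarrow> r \<le> t \<longrightarrow> p r \<in> D")
  case True
  have "ereal t \<le> exit_time D p"
    unfolding exit_time_def
  proof (rule Inf_greatest)
    fix x assume "x \<in> ereal ` {r. r > 0 \<and> p r \<notin> D}"
    then obtain r where r: "x = ereal r" "r > 0" "p r \<notin> D" by auto
    then have "\<not> r \<le> t" using True by auto
    then show "ereal t \<le> x" using r by simp
  qed
  then have "stopped_time D t p = t" by (simp add: stopped_time_def min_absorb1)
  then show thesis using stays True by blast
next
  case False
  then obtain r0 where r0: "0 \<le> r0" "r0 \<le> t" "p r0 \<notin> D" by blast
  define A where "A = {r. r > 0 \<and> p r \<notin> D}"
  define \<tau> where "\<tau> = Inf A"
  have r0A: "r0 \<in> A" using r0 p0 by (cases "r0 = 0") (auto simp: A_def)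
  have bdd: "bdd_below A" by (auto simp: A_def intro!: bdd_belowI[of _ 0])
  have \<tau>: "0 \<le> \<tau>" "\<tau> \<le> r0" unfolding \<tau>_def using r0A bdd
    by (auto intro!: cInf_greatest cInf_lower) (auto simp: A_def)
  have before: "p r \<in> D" if "0 \<le> r" "r < \<tau>" for r
  proof (rule ccontr)
    assume "p r \<notin> D"
    then have "r \<in> A" using that p0 by (cases "r = 0") (auto simp: A_def)
    then have "\<tau> \<le> r" unfolding \<tau>_def using bdd by (intro cInf_lower)
    then show False using that by simp
  qed
  have p\<tau>: "p \<tau> \<notin> D"
  proof
    assume "p \<tau> \<in> D"
    have "(p \<longlongrightarrow> p \<tau>) (at_right \<tau>)" using p \<tau> by (simp add: cadlag_def)
    then have "\<forall>\<^sub>F r in at_right \<tau>. p r \<in> D" using D \<open>p \<tau> \<in> D\<close> by (rule topological_tendstoD)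
    then obtain b where b: "b > \<tau>" "\<And>y. \<tau> < y \<Longrightarrow> y < b \<Longrightarrow> p y \<in> D"
      unfolding eventually_at_right_field by blast
    obtain r where r: "r \<in> A" "r < b" using cInf_lessD[of A b] r0A b(1) unfolding \<tau>_def by blast
    have "\<tau> \<le> r" unfolding \<tau>_def using bdd r by (intro cInf_lower)
    then show False using r b(2)[of r] \<open>p \<tau> \<in> D\<close> by (cases "r = \<tau>") (auto simp: A_def)
  qed
  have "\<tau> \<noteq> 0" using p\<tau> p0 by auto
  then have \<tau>pos: "0 < \<tau>" using \<tau> by simp
  have "exit_time D p = ereal \<tau>"
    unfolding exit_time_def
  proof (rule antisym)
    show "Inf (ereal ` {t. 0 < t \<and> p t \<notin> D}) \<le> ereal \<tau>" using \<tau>pos p\<tau> by (intro Inf_lower) auto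
    show "ereal \<tau> \<le> Inf (ereal ` {t. 0 < t \<and> p t \<notin> D})"
      unfolding \<tau>_def using bdd by (intro Inf_greatest) (auto simp: A_def intro!: cInf_lower)
  qed
  then have T: "stopped_time D t p = \<tau>" using \<tau> r0 by (simp add: stopped_time_def min_absorb2)
  show thesis by (rule exits) (use T \<tau> \<tau>pos r0 p\<tau> before in auto)
qed

lemma (in feynman_kac_source) running_nn:
  "potential_on {0..<t} x = (\<integral>\<^sup>+\<omega>. \<integral>\<^sup>+s. ennreal (W (walk x \<omega>) s) * f (right_eval (walk x \<omega>) s) * indicator {0..<t} s \<partial>lborel \<partial>M)"
proof -
  interpret MS: pair_sigma_finite M "lborel :: real measure" ..
  have "potential_on {0..<t} x = (\<integral>\<^sup>+s. \<integral>\<^sup>+\<omega>. ennreal (W (walk x \<omega>) s) * f (right_eval (walk x \<omega>) s) * indicator {0..<t} s \<partial>M \<partial>lborel)"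
    unfolding potential_on_def Q_def by (intro nn_integral_cong nn_integral_multc[symmetric]) measurable
  also have "\<dots> = (\<integral>\<^sup>+\<omega>. \<integral>\<^sup>+s. ennreal (W (walk x \<omega>) s) * f (right_eval (walk x \<omega>) s) * indicator {0..<t} s \<partial>lborel \<partial>M)"
    by (rule MS.Fubini') measurable
  finally show ?thesis .
qed

section \<open>The equation in terms of the killed process\<close>

context feynman_kac
begin

definition killed_density :: "('a \<Rightarrow> real) \<Rightarrow> real \<Rightarrow> 'a \<Rightarrow> 'w \<Rightarrow> real \<Rightarrow> real" where
  "killed_density g t x \<omega> s = indicator {0..<t} s * (W (walk x \<omega>) s * g (right_eval (walk x \<omega>) s))"

lemma measurable_killed_density [measurable (raw)]:
  assumes [measurable]: "g \<in> borel_measurable borel" "\<omega> \<in> measurable N M" "s \<in> borel_measurable N"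
  shows "(\<lambda>z. killed_density g t x (\<omega> z) (s z)) \<in> borel_measurable N"
  unfolding killed_density_def indicator_def atLeastLessThan_iff by measurable

text \<open>The weak formulation with killing in place of stopping, measurable on \<open>M\<close>
  itself. The terminal value is read at the fixed time \<open>t\<close>: after an exit the weight
  \<open>W\<close> is 0, just as \<open>\<phi>\<close> is 0 where the stopped path sits.\<close>

definition solves :: "('a \<Rightarrow> real) \<Rightarrow> ('a \<Rightarrow> real) \<Rightarrow> bool" where
  "solves g \<phi> \<longleftrightarrow> g \<in> borel_measurable borel \<and> continuous_on UNIV \<phi> \<and> (\<forall>x. x \<notin> D \<longrightarrow> \<phi> x = 0) \<and>
    (\<forall>t\<ge>0. \<forall>x. (AE \<omega> in M. integrable lborel (killed_density g t x \<omega>)) \<and>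
      integrable M (\<lambda>\<omega>. LINT s|lborel. killed_density g t x \<omega> s) \<and>
      integrable M (\<lambda>\<omega>. W (walk x \<omega>) t * \<phi> (x + Y t \<omega>)) \<and>
      \<phi> x = (LINT \<omega>|M. W (walk x \<omega>) t * \<phi> (x + Y t \<omega>)) + (LINT \<omega>|M. LINT s|lborel. killed_density g t x \<omega> s))"

text \<open>The potential lives in \<open>ennreal\<close>, which confines the construction to
  nonnegative sources. Finiteness by \<open>potential_bound\<close> carries its identities over to
  Bochner integrals.\<close>

lemma solves_nonneg:
  fixes g :: "'a \<Rightarrow> real"
  assumes g[measurable]: "g \<in> borel_measurable borel" and g0: "\<And>x. 0 \<le> g x"
    and \<kappa>0: "\<And>e. 0 < e \<Longrightarrow> 0 \<le> \<kappa> e"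
    and \<kappa>: "\<And>e x. 0 < e \<Longrightarrow> (\<integral>\<^sup>+s. (\<integral>\<^sup>+\<omega>. ennreal (g (right_eval (walk x \<omega>) s)) \<partial>M) * indicator {0..<e} s \<partial>lborel) \<le> ennreal (\<kappa> e)"
    and \<kappa>_lim: "(\<kappa> \<longlongrightarrow> 0) (at_right 0)"
  shows "\<exists>\<phi>. solves g \<phi>"
proof -
  interpret F: feynman_kac_source M Y D V C "\<lambda>x. ennreal (g x)" \<kappa>
    by unfold_locales (use \<kappa>0 \<kappa> \<kappa>_lim in auto)
  have "solves g F.\<psi>"
    unfolding solves_def
  proof (intro conjI allI impI)
    fix t :: real and x assume t: "0 \<le> t"
    have [measurable]: "Y t \<in> borel_measurable M" using t by simp
    have mrun: "killed_density g t x \<omega> \<in> borel_measurable borel" if "\<omega> \<in> space M" for \<omega>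
      using that measurable_killed_density[OF g measurable_const[of \<omega> M borel] measurable_ident] by simp
    have nn: "(\<integral>\<^sup>+s. ennreal (W (walk x \<omega>) s) * ennreal (g (right_eval (walk x \<omega>) s)) * indicator {0..<t} s \<partial>lborel) = (\<integral>\<^sup>+s. ennreal (killed_density g t x \<omega> s) \<partial>lborel)" for \<omega>
      by (intro nn_integral_cong) (auto simp: killed_density_def indicator_def ennreal_mult g0)
    have run0: "0 \<le> killed_density g t x \<omega> s" for \<omega> s by (simp add: killed_density_def g0)
    have potential_on: "F.potential_on {0..<t} x = (\<integral>\<^sup>+\<omega>. \<integral>\<^sup>+s. ennreal (killed_density g t x \<omega> s) \<partial>lborel \<partial>M)"
      unfolding F.running_nn nn ..
    have "F.potential_on {0..<t} x \<le> F.\<phi> x" unfolding F.\<phi>_split[OF t, of x] by simp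
    then have fin: "F.potential_on {0..<t} x < \<infinity>" by (rule le_less_trans[OF order_trans[OF _ F.\<phi>_le_bnd]]) simp
    have mnn[measurable]: "(\<lambda>\<omega>. \<integral>\<^sup>+s. ennreal (killed_density g t x \<omega> s) \<partial>lborel) \<in> borel_measurable M" by measurable
    have ae: "AE \<omega> in M. (\<integral>\<^sup>+s. ennreal (killed_density g t x \<omega> s) \<partial>lborel) \<noteq> \<infinity>"
      using fin unfolding potential_on by (intro nn_integral_PInf_AE) auto
    show "AE \<omega> in M. integrable lborel (killed_density g t x \<omega>)"
    proof (rule AE_mp[OF ae], rule AE_I2, rule impI)
      fix \<omega> assume "\<omega> \<in> space M" "(\<integral>\<^sup>+s. ennreal (killed_density g t x \<omega> s) \<partial>lborel) \<noteq> \<infinity>"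
      then show "integrable lborel (killed_density g t x \<omega>)"
        using mrun run0 by (intro integrableI_nonneg) (auto simp: top.not_eq_extremum)
    qed
    have L: "AE \<omega> in M. ennreal (LINT s|lborel. killed_density g t x \<omega> s) = (\<integral>\<^sup>+s. ennreal (killed_density g t x \<omega> s) \<partial>lborel)"
    proof (rule AE_mp[OF ae], rule AE_I2, rule impI)
      fix \<omega> assume \<omega>: "\<omega> \<in> space M" "(\<integral>\<^sup>+s. ennreal (killed_density g t x \<omega> s) \<partial>lborel) \<noteq> \<infinity>"
      then have "integrable lborel (killed_density g t x \<omega>)"
        using mrun run0 by (intro integrableI_nonneg) (auto simp: top.not_eq_extremum)
      then show "ennreal (LINT s|lborel. killed_density g t x \<omega> s) = (\<integral>\<^sup>+s. ennreal (killed_density g t x \<omega> s) \<partial>lborel)"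
        using run0 by (intro nn_integral_eq_integral[symmetric]) auto
    qed
    have nnL: "(\<integral>\<^sup>+\<omega>. ennreal (LINT s|lborel. killed_density g t x \<omega> s) \<partial>M) = F.potential_on {0..<t} x"
      unfolding potential_on by (intro nn_integral_cong_AE L)
    have L0: "0 \<le> (LINT s|lborel. killed_density g t x \<omega> s)" for \<omega> using run0 by (intro Bochner_Integration.integral_nonneg)
    have mL[measurable]: "(\<lambda>\<omega>. LINT s|lborel. killed_density g t x \<omega> s) \<in> borel_measurable M" by measurable
    show iL: "integrable M (\<lambda>\<omega>. LINT s|lborel. killed_density g t x \<omega> s)"
      using L0 fin nnL by (intro integrableI_nonneg) auto
    have mW[measurable]: "(\<lambda>\<omega>. W (walk x \<omega>) t * F.\<psi> (x + Y t \<omega>)) \<in> borel_measurable M" by measurable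
    show iW: "integrable M (\<lambda>\<omega>. W (walk x \<omega>) t * F.\<psi> (x + Y t \<omega>))"
    proof (rule integrable_const_bound[of _ F.potential_bound])
      show "AE \<omega> in M. norm (W (walk x \<omega>) t * F.\<psi> (x + Y t \<omega>)) \<le> F.potential_bound"
      proof (rule AE_I2)
        fix \<omega>
        have "W (walk x \<omega>) t * F.\<psi> (x + Y t \<omega>) \<le> 1 * F.potential_bound"
          using W_le_1 F.\<psi>_le_bnd F.\<psi>_nonneg by (intro mult_mono) auto
        then show "norm (W (walk x \<omega>) t * F.\<psi> (x + Y t \<omega>)) \<le> F.potential_bound"
          using F.\<psi>_nonneg by (simp add: abs_mult)
      qed
    qed measurable
    have "ennreal (F.\<psi> x) = F.potential_on {0..<t} x + Q t F.\<phi> x"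
      using F.\<phi>_split[OF t, of x] by (simp add: F.\<phi>_eq_\<psi>)
    also have "Q t F.\<phi> x = (\<integral>\<^sup>+\<omega>. ennreal (W (walk x \<omega>) t * F.\<psi> (x + Y t \<omega>)) \<partial>M)"
      unfolding Q_def using t by (simp add: F.\<phi>_eq_\<psi> ennreal_mult F.\<psi>_nonneg)
    also have "\<dots> = ennreal (LINT \<omega>|M. W (walk x \<omega>) t * F.\<psi> (x + Y t \<omega>))"
      using iW F.\<psi>_nonneg by (intro nn_integral_eq_integral) auto
    also have "F.potential_on {0..<t} x = ennreal (LINT \<omega>|M. LINT s|lborel. killed_density g t x \<omega> s)"
      unfolding nnL[symmetric] using iL L0 by (intro nn_integral_eq_integral) auto
    finally have "ennreal (F.\<psi> x) = ennreal ((LINT \<omega>|M. W (walk x \<omega>) t * F.\<psi> (x + Y t \<omega>)) + (LINT \<omega>|M. LINT s|lborel. killed_density g t x \<omega> s))"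
      using L0 F.\<psi>_nonneg by (subst ennreal_plus) (auto simp: add.commute intro!: Bochner_Integration.integral_nonneg)
    then show "F.\<psi> x = (LINT \<omega>|M. W (walk x \<omega>) t * F.\<psi> (x + Y t \<omega>)) + (LINT \<omega>|M. LINT s|lborel. killed_density g t x \<omega> s)"
      using L0 F.\<psi>_nonneg by (subst (asm) ennreal_inj) (auto intro!: Bochner_Integration.integral_nonneg add_nonneg_nonneg)
  qed (auto simp: F.\<psi>_continuous F.\<psi>_outside g)
  then show ?thesis by blast
qed

text \<open>Sources of both signs are reached by linearity; the integrability clauses of
  \<open>solves\<close> let the integrals be subtracted.\<close>

lemma solves_diff:
  assumes g: "solves g \<phi>" and h: "solves h \<eta>"
  shows "solves (\<lambda>x. g x - h x) (\<lambda>x. \<phi> x - \<eta> x)"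
  unfolding solves_def
proof (intro conjI allI impI)
  have [measurable]: "g \<in> borel_measurable borel" "h \<in> borel_measurable borel" using g h by (auto simp: solves_def)
  show "(\<lambda>x. g x - h x) \<in> borel_measurable borel" by measurable
  show "continuous_on UNIV (\<lambda>x. \<phi> x - \<eta> x)" using g h by (auto simp: solves_def intro!: continuous_intros)
  show "\<phi> x - \<eta> x = 0" if "x \<notin> D" for x using g h that by (auto simp: solves_def)
  fix t :: real and x assume t: "0 \<le> t"
  have killed_density: "killed_density (\<lambda>x. g x - h x) t x \<omega> = (\<lambda>s. killed_density g t x \<omega> s - killed_density h t x \<omega> s)" for \<omega>
    by (auto simp: killed_density_def algebra_simps)
  have ig: "AE \<omega> in M. integrable lborel (killed_density g t x \<omega>)" "integrable M (\<lambda>\<omega>. LINT s|lborel. killed_density g t x \<omega> s)"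
      "integrable M (\<lambda>\<omega>. W (walk x \<omega>) t * \<phi> (x + Y t \<omega>))"
      "\<phi> x = (LINT \<omega>|M. W (walk x \<omega>) t * \<phi> (x + Y t \<omega>)) + (LINT \<omega>|M. LINT s|lborel. killed_density g t x \<omega> s)"
    using g t unfolding solves_def by blast+
  have ih: "AE \<omega> in M. integrable lborel (killed_density h t x \<omega>)" "integrable M (\<lambda>\<omega>. LINT s|lborel. killed_density h t x \<omega> s)"
      "integrable M (\<lambda>\<omega>. W (walk x \<omega>) t * \<eta> (x + Y t \<omega>))"
      "\<eta> x = (LINT \<omega>|M. W (walk x \<omega>) t * \<eta> (x + Y t \<omega>)) + (LINT \<omega>|M. LINT s|lborel. killed_density h t x \<omega> s)"
    using h t unfolding solves_def by blast+
  show "AE \<omega> in M. integrable lborel (killed_density (\<lambda>x. g x - h x) t x \<omega>)"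
    using ig(1) ih(1) by eventually_elim (simp add: killed_density)
  have eq: "AE \<omega> in M. (LINT s|lborel. killed_density g t x \<omega> s) - (LINT s|lborel. killed_density h t x \<omega> s) = (LINT s|lborel. killed_density (\<lambda>x. g x - h x) t x \<omega> s)"
    using ig(1) ih(1) by eventually_elim (simp add: killed_density)
  have i: "integrable M (\<lambda>\<omega>. (LINT s|lborel. killed_density g t x \<omega> s) - (LINT s|lborel. killed_density h t x \<omega> s))"
    using ig(2) ih(2) by simp
  have m: "(\<lambda>\<omega>. LINT s|lborel. killed_density (\<lambda>x. g x - h x) t x \<omega> s) \<in> borel_measurable M" by measurable
  show "integrable M (\<lambda>\<omega>. LINT s|lborel. killed_density (\<lambda>x. g x - h x) t x \<omega> s)"
    using integrable_cong_AE[OF borel_measurable_integrable[OF i] m eq] i by simp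
  show iW: "integrable M (\<lambda>\<omega>. W (walk x \<omega>) t * (\<phi> (x + Y t \<omega>) - \<eta> (x + Y t \<omega>)))"
    using ig(3) ih(3) by (simp add: right_diff_distrib)
  have "(LINT \<omega>|M. LINT s|lborel. killed_density (\<lambda>x. g x - h x) t x \<omega> s) =
      (LINT \<omega>|M. LINT s|lborel. killed_density g t x \<omega> s) - (LINT \<omega>|M. LINT s|lborel. killed_density h t x \<omega> s)"
    using integral_cong_AE[OF borel_measurable_integrable[OF i] m eq] ig(2) ih(2) by simp
  moreover have "(LINT \<omega>|M. W (walk x \<omega>) t * (\<phi> (x + Y t \<omega>) - \<eta> (x + Y t \<omega>))) =
      (LINT \<omega>|M. W (walk x \<omega>) t * \<phi> (x + Y t \<omega>)) - (LINT \<omega>|M. W (walk x \<omega>) t * \<eta> (x + Y t \<omega>))"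
    unfolding right_diff_distrib using ig(3) ih(3) by (rule Bochner_Integration.integral_diff)
  ultimately show "\<phi> x - \<eta> x = (LINT \<omega>|M. W (walk x \<omega>) t * (\<phi> (x + Y t \<omega>) - \<eta> (x + Y t \<omega>))) + (LINT \<omega>|M. LINT s|lborel. killed_density (\<lambda>x. g x - h x) t x \<omega> s)"
    using ig(4) ih(4) by linarith
qed

end

section \<open>From killing to stopping, and uniqueness\<close>

context feynman_kac
begin

text \<open>The path stays in \<open>D\<close> up to time \<open>s\<close>, where both potentials
  agree, so the bounded Borel function \<open>V\<close> can stand for the given
  \<open>U\<close>.\<close>

lemma fk_weight_eq:
  assumes U: "\<And>y. y \<in> D \<Longrightarrow> U y = V y" and inside: "\<And>r. 0 \<le> r \<Longrightarrow> r \<le> s \<Longrightarrow> x + Y r \<omega> \<in> D"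
  shows "fk_weight U (walk x \<omega>) s = exp (- J (walk x \<omega>) s)"
proof -
  have "(LINT r:{0..s}|lebesgue. U (x + Y r \<omega>)) = (LINT r|lebesgue. indicator {0..s} r * V (right_eval (walk x \<omega>) r))"
    unfolding set_lebesgue_integral_def using U inside
    by (intro Bochner_Integration.integral_cong refl) (auto simp: indicator_def)
  also have "\<dots> = J (walk x \<omega>) s"
    unfolding J_def using borel_measurable_integrable[OF J_integrable] by (intro integral_completion) simp
  finally show ?thesis by (simp add: fk_weight_def)
qed

text \<open>On a path that stays in \<open>D\<close> up to \<open>t\<close> survival holds and the
  weights agree. On a path that exits, the stopped position lies outside \<open>D\<close>, where
  \<open>\<phi>\<close> is 0, and \<open>W\<close> is 0 from the exit on, so both terminal values
  vanish. In the running term the integrands agree before the exit for almost every time, and both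
  are 0 after it.\<close>

lemma weak_solutionI:
  assumes XY: "AE \<omega> in M. \<forall>t. X t \<omega> = Y t \<omega>" and U: "\<And>y. y \<in> D \<Longrightarrow> U y = V y"
    and sol: "solves g \<phi>"
    and fg: "\<And>x. AE \<omega> in M. AE s in lborel. 0 \<le> s \<longrightarrow> x + Y s \<omega> \<in> D \<longrightarrow> f (x + Y s \<omega>) = g (x + Y s \<omega>)"
  shows "weak_solution M X D U f \<phi>"
  unfolding weak_solution_def
proof (intro conjI allI impI ballI)
  show "continuous_on UNIV \<phi>" "\<And>x. x \<notin> D \<Longrightarrow> \<phi> x = 0" using sol unfolding solves_def by blast+
  fix t :: real and x assume t: "0 \<le> t" and x: "x \<in> D"
  have s: "AE \<omega> in M. integrable lborel (killed_density g t x \<omega>)" "integrable M (\<lambda>\<omega>. LINT s|lborel. killed_density g t x \<omega> s)"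
      "integrable M (\<lambda>\<omega>. W (walk x \<omega>) t * \<phi> (x + Y t \<omega>))"
      "\<phi> x = (LINT \<omega>|M. W (walk x \<omega>) t * \<phi> (x + Y t \<omega>)) + (LINT \<omega>|M. LINT s|lborel. killed_density g t x \<omega> s)"
      "\<And>y. y \<notin> D \<Longrightarrow> \<phi> y = 0"
    using sol t unfolding solves_def by blast+
  define P where "P \<omega> = path_from X x \<omega>" for \<omega>
  define T where "T \<omega> = stopped_time D t (P \<omega>)" for \<omega>
  have P: "AE \<omega> in M. P \<omega> = (walk x \<omega>)"
    using XY by eventually_elim (simp add: P_def path_from_def)
  have terminal: "AE \<omega> in M. fk_weight U (P \<omega>) (T \<omega>) * \<phi> (P \<omega> (T \<omega>)) = W (walk x \<omega>) t * \<phi> (x + Y t \<omega>)"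
    using P AE_alive_iff_inside[OF D_open compl_D, of x]
  proof eventually_elim
    case (elim \<omega>)
    from X_cadlag D_open _ t have ?case if "(walk x \<omega>) 0 \<in> D"
    proof (rule stopped_time_cases[of "walk x \<omega>" D t])
      show "x + Y 0 \<omega> \<in> D" using that by simp
    next
      assume T: "stopped_time D t (walk x \<omega>) = t" and ins: "\<And>r. 0 \<le> r \<Longrightarrow> r \<le> t \<Longrightarrow> x + Y r \<omega> \<in> D"
      have "alive_rat D (walk x \<omega>) t" using elim(2) t ins by (simp add: alive_rat_eq[OF X_cadlag])
      then show ?thesis using T by (simp add: T_def elim(1) W_def fk_weight_eq[OF U ins])
    next
      let ?T = "stopped_time D t (walk x \<omega>)"
      assume T: "0 < ?T" "?T \<le> t" "x + Y ?T \<omega> \<notin> D"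
      have "\<not> alive D (walk x \<omega>) t" using alive_in[of D "walk x \<omega>" t ?T] T by auto
      then have "W (walk x \<omega>) t = 0" using t by (rule W_not_alive[rotated])
      then show ?thesis using s(5)[OF T(3)] by (simp add: T_def elim(1))
    qed
    then show ?case using x by simp
  qed
  have density: "AE \<omega> in M. AE s in lborel. indicator {0..T \<omega>} s *\<^sub>R (fk_weight U (P \<omega>) s * f (P \<omega> s)) = killed_density g t x \<omega> s"
    using P AE_alive_iff_inside[OF D_open compl_D, of x] fg[of x]
  proof eventually_elim
    case (elim \<omega>)
    let ?T = "stopped_time D t (walk x \<omega>)"
    have "0 \<le> ?T \<and> ?T \<le> t \<and> (\<forall>r. 0 \<le> r \<longrightarrow> r < ?T \<longrightarrow> x + Y r \<omega> \<in> D) \<and> (?T = t \<or> x + Y ?T \<omega> \<notin> D)"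
      by (rule stopped_time_cases[OF X_cadlag[of x \<omega>] D_open _ t]) (use t x in auto)
    then have T: "0 \<le> ?T" "?T \<le> t" "\<And>r. 0 \<le> r \<Longrightarrow> r < ?T \<Longrightarrow> x + Y r \<omega> \<in> D" "?T = t \<or> x + Y ?T \<omega> \<notin> D"
      by blast+
    \<comment> \<open>The time \<open>?T\<close> itself, which the closed interval of the stopped
      integral includes, is discarded as a null set.\<close>
    show ?case using elim(3) AE_lborel_singleton[of ?T]
    proof eventually_elim
      case e: (elim r)
      consider "r < 0" | "0 \<le> r" "r < ?T" | "?T < r" using e(2) by fastforce
      then show ?case
      proof cases
        case 1
        then show ?thesis by (simp add: killed_density_def)
      next
        case 2
        then have ins: "\<And>u. 0 \<le> u \<Longrightarrow> u \<le> r \<Longrightarrow> x + Y u \<omega> \<in> D" using T(3) by simp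
        then have "alive_rat D (walk x \<omega>) r" using elim(2) 2 by (simp add: alive_rat_eq[OF X_cadlag])
        then show ?thesis using 2 T(2) e(1) ins[of r]
          by (simp add: killed_density_def T_def elim(1) W_def fk_weight_eq[OF U ins])
      next
        case 3
        have "killed_density g t x \<omega> r = 0"
        proof (cases "?T = t")
          case True then show ?thesis using 3 by (simp add: killed_density_def)
        next
          case False
          then have "x + Y ?T \<omega> \<notin> D" using T(4) by simp
          then have "\<not> alive D (walk x \<omega>) r" using alive_in[of D "walk x \<omega>" r ?T] T(1) 3 by auto
          then have "W (walk x \<omega>) r = 0" using 3 T(1) by (intro W_not_alive) auto
          then show ?thesis by (simp add: killed_density_def)
        qed
        then show ?thesis using 3 by (simp add: T_def elim(1))
      qed
    qed
  qed
  have dens: "AE \<omega> in M. set_integrable lebesgue {0..T \<omega>} (\<lambda>s. fk_weight U (P \<omega>) s * f (P \<omega> s)) \<and>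
     (LINT s:{0..T \<omega>}|lebesgue. fk_weight U (P \<omega>) s * f (P \<omega> s)) = (LINT s|lborel. killed_density g t x \<omega> s)"
    using density s(1)
  proof eventually_elim
    case (elim \<omega>)
    from integrable_completion_AE[OF elim(2) elim(1)]
    show ?case unfolding set_integrable_def set_lebesgue_integral_def by simp
  qed
  have dens1: "AE \<omega> in M. set_integrable lebesgue {0..T \<omega>} (\<lambda>s. fk_weight U (P \<omega>) s * f (P \<omega> s))"
    using dens by eventually_elim simp
  have dens2: "AE \<omega> in M. (LINT s:{0..T \<omega>}|lebesgue. fk_weight U (P \<omega>) s * f (P \<omega> s)) = (LINT s|lborel. killed_density g t x \<omega> s)"
    using dens by eventually_elim simp
  show "let T = \<lambda>\<omega>. stopped_time D t (path_from X x \<omega>);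
            terminal = \<lambda>\<omega>. fk_weight U (path_from X x \<omega>) (T \<omega>) * \<phi> (path_from X x \<omega> (T \<omega>));
            density = \<lambda>\<omega> s. fk_weight U (path_from X x \<omega>) s * f (path_from X x \<omega> s);
            running = \<lambda>\<omega>. LINT s:{0..T \<omega>}|lebesgue. density \<omega> s
        in integrable (completion M) terminal \<and>
           (AE \<omega> in M. set_integrable lebesgue {0..T \<omega>} (density \<omega>)) \<and>
           integrable (completion M) running \<and>
           \<phi> x = (LINT \<omega>|completion M. terminal \<omega>) + (LINT \<omega>|completion M. running \<omega>)"
    unfolding Let_def P_def[symmetric] T_def[symmetric]
    using integrable_completion_AE[OF s(3) terminal] integrable_completion_AE[OF s(2) dens2] dens1 s(4) by simp
qed

lemma weak_solution_unique:
  assumes XY: "AE \<omega> in M. \<forall>t. X t \<omega> = Y t \<omega>" and U: "\<And>y. y \<in> D \<Longrightarrow> U y = V y"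
    and sol: "weak_solution M X D U f \<phi>1" "weak_solution M X D U f \<phi>2"
  shows "\<phi>1 = \<phi>2"
proof -
  define d where "d x = \<bar>\<phi>1 x - \<phi>2 x\<bar>" for x
  have d0: "d x = 0" if "x \<notin> D" for x using sol that by (simp add: d_def weak_solution_def)
  have dc: "continuous_on (closure D) d"
    using sol unfolding d_def weak_solution_def by (auto intro!: continuous_intros elim!: continuous_on_subset)
  show ?thesis
  proof (cases "D = {}")
    case True
    then have "d x = 0" for x using d0 by simp
    then show ?thesis by (auto simp: d_def)
  next
    case False
    have "compact (closure D)" using D_bounded by (simp add: compact_closure)
    then obtain x0 where x0: "x0 \<in> closure D" "\<And>y. y \<in> closure D \<Longrightarrow> d y \<le> d x0"
      using continuous_attains_sup[OF _ _ dc] False by (metis closure_eq_empty)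
    define m where "m = d x0"
    have m: "d y \<le> m" for y
      using x0(2)[of y] d0[of y] closure_subset[of D] by (cases "y \<in> D") (auto simp: m_def d_def)
    have m0: "0 \<le> m" by (simp add: m_def d_def)
    have le: "d x \<le> m * \<rho>" if x: "x \<in> D" for x
    proof -
      define P where "P \<omega> = path_from X x \<omega>" for \<omega>
      define T where "T \<omega> = stopped_time D 1 (P \<omega>)" for \<omega>
      define tm where "tm \<phi> \<omega> = fk_weight U (P \<omega>) (T \<omega>) * \<phi> (P \<omega> (T \<omega>))" for \<phi> \<omega>
      \<comment> \<open>The running term does not involve the solution, so it cancels in the
        difference of the two equations, which are both taken at time 1.\<close>
      define rn where "rn \<omega> = (LINT s:{0..T \<omega>}|lebesgue. fk_weight U (P \<omega>) s * f (P \<omega> s))" for \<omega>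
      have i1: "integrable (completion M) (tm \<phi>1)" "\<phi>1 x = (LINT \<omega>|completion M. tm \<phi>1 \<omega>) + (LINT \<omega>|completion M. rn \<omega>)"
        using sol(1) x unfolding weak_solution_def Let_def tm_def rn_def T_def P_def by (auto dest!: spec[of _ "1::real"])
      have i2: "integrable (completion M) (tm \<phi>2)" "\<phi>2 x = (LINT \<omega>|completion M. tm \<phi>2 \<omega>) + (LINT \<omega>|completion M. rn \<omega>)"
        using sol(2) x unfolding weak_solution_def Let_def tm_def rn_def T_def P_def by (auto dest!: spec[of _ "1::real"])
      define E where "E \<omega> = m * indicator {\<omega>\<in>space M. norm (Y 1 \<omega>) \<le> diameter D} \<omega>" for \<omega>
      have E: "integrable M E" "integral\<^sup>L M E = m * \<rho>"
        unfolding E_def \<rho>_def by (auto simp: less_top[symmetric] intro!: integrable_mult_right)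
      have mE: "E \<in> borel_measurable M" using E(1) by auto
      have "AE \<omega> in M. \<bar>tm \<phi>1 \<omega> - tm \<phi>2 \<omega>\<bar> \<le> E \<omega>"
      proof (rule AE_mp[OF XY], rule AE_I2, rule impI)
        fix \<omega> assume \<omega>: "\<omega> \<in> space M" and "\<forall>t. X t \<omega> = Y t \<omega>"
        then have P: "P \<omega> = (walk x \<omega>)" by (simp add: P_def path_from_def)
        show "\<bar>tm \<phi>1 \<omega> - tm \<phi>2 \<omega>\<bar> \<le> E \<omega>"
        proof (rule stopped_time_cases[of "walk x \<omega>" D 1])
          assume T: "stopped_time D 1 (walk x \<omega>) = 1" and ins: "\<And>r. 0 \<le> r \<Longrightarrow> r \<le> 1 \<Longrightarrow> x + Y r \<omega> \<in> D"
          have w: "fk_weight U (P \<omega>) (T \<omega>) = exp (- J (walk x \<omega>) 1)"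
            unfolding T_def P T by (rule fk_weight_eq[OF U ins])
          have "norm (Y 1 \<omega>) \<le> diameter D"
            using diameter_bounded_bound[OF D_bounded x ins[of 1]] by (simp add: dist_norm)
          then have "E \<omega> = m" using \<omega> by (simp add: E_def)
          moreover have "\<bar>tm \<phi>1 \<omega> - tm \<phi>2 \<omega>\<bar> = exp (- J (walk x \<omega>) 1) * d (x + Y 1 \<omega>)"
            unfolding tm_def w d_def by (simp add: T_def P T abs_mult flip: right_diff_distrib)
          moreover have "\<dots> \<le> 1 * m"
            using m J_nonneg by (intro mult_mono) (auto simp: d_def)
          ultimately show ?thesis by simp
        next
          assume "x + Y (stopped_time D 1 (walk x \<omega>)) \<omega> \<notin> D"
          then have "\<phi>1 (P \<omega> (T \<omega>)) = 0" "\<phi>2 (P \<omega> (T \<omega>)) = 0"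
            using sol unfolding weak_solution_def T_def P by auto
          then show ?thesis using m0 by (simp add: tm_def E_def)
        qed (use x X_cadlag D_open in auto)
      qed
      then have "AE \<omega> in completion M. \<bar>tm \<phi>1 \<omega> - tm \<phi>2 \<omega>\<bar> \<le> E \<omega>" by (rule AE_completion)
      moreover have "integrable (completion M) E" using E(1) mE by (simp add: integrable_completion)
      moreover have "integrable (completion M) (\<lambda>\<omega>. \<bar>tm \<phi>1 \<omega> - tm \<phi>2 \<omega>\<bar>)" using i1(1) i2(1) by simp
      ultimately have "(LINT \<omega>|completion M. \<bar>tm \<phi>1 \<omega> - tm \<phi>2 \<omega>\<bar>) \<le> (LINT \<omega>|completion M. E \<omega>)"
        by (intro integral_mono_AE) auto
      then have "(LINT \<omega>|completion M. \<bar>tm \<phi>1 \<omega> - tm \<phi>2 \<omega>\<bar>) \<le> m * \<rho>" using E(2) mE by (simp add: integral_completion)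
      then have "\<bar>LINT \<omega>|completion M. tm \<phi>1 \<omega> - tm \<phi>2 \<omega>\<bar> \<le> m * \<rho>"
        by (rule order_trans[OF integral_abs_bound])
      moreover have "\<phi>1 x - \<phi>2 x = (LINT \<omega>|completion M. tm \<phi>1 \<omega> - tm \<phi>2 \<omega>)"
        using i1 i2 by simp
      ultimately show ?thesis by (simp add: d_def)
    qed
    have "m = 0"
    proof (rule ccontr)
      assume "m \<noteq> 0"
      \<comment> \<open>\<open>d\<close> vanishes off \<open>D\<close>, so a nonzero maximum is
        attained inside, where the contraction \<open>le\<close> applies.\<close>
      then have "x0 \<in> D" using d0[of x0] by (auto simp: m_def)
      then have "m \<le> m * \<rho>" using le[of x0] by (simp add: m_def)
      then show False using \<open>m \<noteq> 0\<close> m0 \<rho> by (simp add: mult_le_cancel_left1)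
    qed
    then have "d x = 0" for x using m[of x] by (simp add: d_def)
    then show ?thesis by (auto simp: d_def)
  qed
qed

end

text \<open>
  The inequality \<open>g \<le> l + l\<^bsup>1-p\<^esup> g\<^sup>p\<close> for \<open>l > 0\<close> replaces Hoelder's inequality; the choice
  \<open>l = 1 + s\<^bsup>-b/p\<^esup>\<close> balances both terms.
\<close>

lemma (in cadlag_levy) kato_bound:
  fixes g :: "'a \<Rightarrow> real"
  assumes K: "0 \<le> K" and heat: "\<And>t h x. 0 < t \<Longrightarrow> h \<in> borel_measurable borel \<Longrightarrow>
      (\<integral>\<^sup>+\<omega>. h (x + Y t \<omega>) \<partial>M) \<le> ennreal (1 + K * t powr (- b)) * (\<integral>\<^sup>+y. h y \<partial>lborel)"
    and [measurable]: "g \<in> borel_measurable borel" and g0: "\<And>y. 0 \<le> g y"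
    and A: "(\<integral>\<^sup>+y. ennreal (g y powr p) \<partial>lborel) \<le> ennreal A" "0 \<le> A"
    and p: "1 \<le> p" "0 < b" "b < p"
  shows "\<exists>\<kappa>. (\<forall>e>0. 0 \<le> \<kappa> e) \<and> (\<forall>e>0. \<forall>x. (\<integral>\<^sup>+s. (\<integral>\<^sup>+\<omega>. ennreal (g (right_eval (walk x \<omega>) s)) \<partial>M) * indicator {0..<e} s \<partial>lborel) \<le> ennreal (\<kappa> e)) \<and>
    (\<kappa> \<longlongrightarrow> 0) (at_right 0)"
proof -
  \<comment> \<open>\<open>b < p\<close> gives \<open>q < 1\<close>, so \<open>s powr (- q)\<close>
    is integrable at 0; \<open>\<kappa> e\<close> is \<open>c\<close> times the integral of
    \<open>1 + s powr (- q)\<close> over \<open>{0..e}\<close>.\<close>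
  define q where "q = b / p"
  have q: "0 < q" "q < 1" using p by (auto simp: q_def)
  define c where "c = 1 + (1 + K) * A"
  have c: "0 \<le> c" using K A by (simp add: c_def)
  define \<kappa> where "\<kappa> e = c * (e + e powr (1 - q) / (1 - q))" for e
  have split: "g y \<le> l + l powr (1 - p) * g y powr p" if l: "0 < l" for l y
  proof (cases "g y \<le> l")
    case True
    then show ?thesis by (simp add: add_increasing2)
  next
    case False
    then have "g y = g y powr (1 - p) * g y powr p" using l by (simp flip: powr_add)
    also have "\<dots> \<le> l powr (1 - p) * g y powr p"
      using False l p by (intro mult_right_mono powr_mono2') auto
    finally show ?thesis using l by simp
  qed
  have est: "(\<integral>\<^sup>+\<omega>. ennreal (g (x + Y s \<omega>)) \<partial>M) \<le> ennreal (c * (1 + s powr (- q)))" if s: "0 < s" for s x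
  proof -
    define l where "l = 1 + s powr (- q)"
    have l: "1 \<le> l" by (simp add: l_def)
    have [measurable]: "Y s \<in> borel_measurable M" using s by simp
    have "(\<integral>\<^sup>+\<omega>. ennreal (g (x + Y s \<omega>)) \<partial>M) \<le> (\<integral>\<^sup>+\<omega>. ennreal l + ennreal (l powr (1 - p)) * ennreal (g (x + Y s \<omega>) powr p) \<partial>M)"
      using split[of l] l by (intro nn_integral_mono) (auto simp: ennreal_mult[symmetric] ennreal_plus[symmetric] simp del: ennreal_plus intro!: ennreal_leI)
    also have "\<dots> = ennreal l + ennreal (l powr (1 - p)) * (\<integral>\<^sup>+\<omega>. ennreal (g (x + Y s \<omega>) powr p) \<partial>M)"
      by (simp add: nn_integral_add nn_integral_cmult emeasure_space_1)
    also have "\<dots> \<le> ennreal l + ennreal (l powr (1 - p)) * (ennreal (1 + K * s powr (- b)) * ennreal A)"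
      by (intro add_left_mono mult_left_mono order_trans[OF heat[OF s, of "\<lambda>y. ennreal (g y powr p)"]] A(1)) auto
    also have "\<dots> = ennreal (l + l powr (1 - p) * ((1 + K * s powr (- b)) * A))"
      using l K A by (simp add: ennreal_mult[symmetric] ennreal_plus[symmetric] del: ennreal_plus)
    also have "\<dots> \<le> ennreal (c * (1 + s powr (- q)))"
    proof (rule ennreal_leI)
      \<comment> \<open>Both 1 and \<open>s powr (- b)\<close> are at most \<open>l powr p\<close>,
        so the second term of the splitting is at most \<open>(1 + K) * A * l\<close>.\<close>
      have "s powr (- b) = (s powr (- q)) powr p" using p by (simp add: powr_powr q_def)
      also have "\<dots> \<le> l powr p" using p by (intro powr_mono2) (auto simp: l_def)
      finally have 1: "s powr (- b) \<le> l powr p" .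
      have 2: "1 \<le> l powr p" using l p by (simp add: ge_one_powr_ge_zero)
      have "1 + K * s powr (- b) \<le> l powr p + K * l powr p"
        using 1 2 K by (intro add_mono mult_left_mono) auto
      then have "l powr (1 - p) * ((1 + K * s powr (- b)) * A) \<le> l powr (1 - p) * ((l powr p + K * l powr p) * A)"
        using A by (intro mult_left_mono mult_right_mono) auto
      also have "\<dots> = (l powr (1 - p) * l powr p) * ((1 + K) * A)" by (simp add: algebra_simps)
      also have "l powr (1 - p) * l powr p = l" using l by (simp flip: powr_add)
      finally show "l + l powr (1 - p) * ((1 + K * s powr (- b)) * A) \<le> c * (1 + s powr (- q))"
        by (simp add: c_def l_def algebra_simps)
    qed
    finally show ?thesis .
  qed
  have "(\<integral>\<^sup>+s. (\<integral>\<^sup>+\<omega>. ennreal (g (right_eval (walk x \<omega>) s)) \<partial>M) * indicator {0..<e} s \<partial>lborel) \<le> ennreal (\<kappa> e)" if e: "0 < e" for e x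
  proof -
    have "(\<integral>\<^sup>+s. (\<integral>\<^sup>+\<omega>. ennreal (g (right_eval (walk x \<omega>) s)) \<partial>M) * indicator {0..<e} s \<partial>lborel) \<le>
      (\<integral>\<^sup>+s. ennreal (c * (1 + s powr (- q))) * indicator {0..e} s \<partial>lborel)"
    proof (rule nn_integral_mono_AE)
      show "AE s in lborel. (\<integral>\<^sup>+\<omega>. ennreal (g (right_eval (walk x \<omega>) s)) \<partial>M) * indicator {0..<e} s \<le> ennreal (c * (1 + s powr (- q))) * indicator {0..e} s"
        using AE_lborel_singleton[of 0]
      proof eventually_elim
        case (elim s)
        then show ?case using est[of s x] by (cases "0 < s") (auto simp: indicator_def)
      qed
    qed
    also have "\<dots> = ennreal (\<kappa> e)"
    proof (rule nn_integral_has_integral_lebesgue')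
      have "((\<lambda>s. s powr (- q)) has_integral (e powr (- q + 1) / (- q + 1))) {0..e}"
        using q e by (intro has_integral_powr_from_0) auto
      moreover have "((\<lambda>s. 1::real) has_integral e) {0..e}" using has_integral_const_real[of "1::real" 0 e] e by simp
      ultimately have "((\<lambda>s. c * (1 + s powr (- q))) has_integral c * (e + e powr (- q + 1) / (- q + 1))) {0..e}"
        by (intro has_integral_mult_right has_integral_add)
      then show "((\<lambda>s. c * (1 + s powr (- q))) has_integral \<kappa> e) {0..e}" by (simp add: \<kappa>_def)
    qed (use c in auto)
    finally show ?thesis .
  qed
  moreover have "0 \<le> \<kappa> e" if "0 < e" for e using that c q by (simp add: \<kappa>_def)
  moreover have "(\<kappa> \<longlongrightarrow> 0) (at_right 0)"
  proof -
    have "((\<lambda>e. e powr (1 - q)) \<longlongrightarrow> 0 powr (1 - q)) (at_right 0)"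
      using q by (intro tendsto_powr2 tendsto_ident_at tendsto_const) (auto simp: eventually_at_right_field intro!: exI[of _ 1])
    then have "(\<kappa> \<longlongrightarrow> c * (0 + 0 powr (1 - q) / (1 - q))) (at_right 0)"
      unfolding \<kappa>_def by (intro tendsto_mult tendsto_add tendsto_divide tendsto_const tendsto_ident_at) (use q in auto)
    then show ?thesis by simp
  qed
  ultimately show ?thesis by blast
qed

section \<open>Verification of the assumptions for the subordinate process, and assembly\<close>

context subordinated_bm
begin

text \<open>The transition density is an average of Gaussian densities, each bounded by
  \<open>small_moment\<close> of the clock. Since this moment is infinite at nonpositive clock
  values, its finite expectation also yields positivity.\<close>

lemma heat_bound:
  assumes "0 \<le> K" and K: "\<And>t. 0 < t \<Longrightarrow> (\<integral>\<^sup>+\<omega>. small_moment (DIM('a) / 2) (S t \<omega>) \<partial>M) \<le> ennreal (1 + K * t powr (- b))"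
    and t: "0 < t"
  shows "AE \<omega> in M. 0 < S t \<omega>"
    and "h \<in> borel_measurable borel \<Longrightarrow> (\<integral>\<^sup>+\<omega>. h (x + Y t \<omega>) \<partial>M) \<le> ennreal (1 + K * t powr (- b)) * (\<integral>\<^sup>+y. h (y::'a) \<partial>lborel)"
proof -
  have [measurable]: "S t \<in> borel_measurable M" using t by (intro levy_process_measurable[OF levy_S]) simp
  have "(\<integral>\<^sup>+\<omega>. small_moment (DIM('a) / 2) (S t \<omega>) \<partial>M) \<noteq> \<infinity>" using K[OF t] by (auto simp: top_unique)
  then have "AE \<omega> in M. small_moment (DIM('a) / 2) (S t \<omega>) \<noteq> \<infinity>" by (intro nn_integral_PInf_AE) auto
  then show pos: "AE \<omega> in M. 0 < S t \<omega>"
    by eventually_elim (use small_moment_nonpos[of "DIM('a) / 2"] in \<open>auto simp: not_less[symmetric]\<close>)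
  assume [measurable]: "h \<in> borel_measurable borel"
  have "(\<integral>\<^sup>+\<omega>. h (x + Y t \<omega>) \<partial>M) = (\<integral>\<^sup>+\<omega>. (\<integral>\<^sup>+y. h y * gauss (S t \<omega>) (y - x) \<partial>lborel) \<partial>M)"
    using t pos by (intro nn_integral_Y_gauss) auto
  also have "\<dots> \<le> (\<integral>\<^sup>+\<omega>. small_moment (DIM('a) / 2) (S t \<omega>) * (\<integral>\<^sup>+y. h y \<partial>lborel) \<partial>M)"
  proof (rule nn_integral_mono_AE)
    show "AE \<omega> in M. (\<integral>\<^sup>+y. h y * gauss (S t \<omega>) (y - x) \<partial>lborel) \<le> small_moment (DIM('a) / 2) (S t \<omega>) * (\<integral>\<^sup>+y. h y \<partial>lborel)"
      using pos
    proof eventually_elim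
      case (elim \<omega>)
      have "(\<integral>\<^sup>+y. h y * gauss (S t \<omega>) (y - x) \<partial>lborel) \<le> (\<integral>\<^sup>+y. small_moment (DIM('a) / 2) (S t \<omega>) * h y \<partial>lborel)"
        by (subst mult.commute) (intro nn_integral_mono mult_right_mono gauss_le_small_moment[OF elim] zero_le)
      then show ?case by (simp add: nn_integral_cmult)
    qed
  qed
  also have "\<dots> = (\<integral>\<^sup>+\<omega>. small_moment (DIM('a) / 2) (S t \<omega>) \<partial>M) * (\<integral>\<^sup>+y. h y \<partial>lborel)"
    by (rule nn_integral_multc) measurable
  also have "\<dots> \<le> ennreal (1 + K * t powr (- b)) * (\<integral>\<^sup>+y. h y \<partial>lborel)"
    by (intro mult_right_mono K t) simp
  finally show "(\<integral>\<^sup>+\<omega>. h (x + Y t \<omega>) \<partial>M) \<le> ennreal (1 + K * t powr (- b)) * (\<integral>\<^sup>+y. h y \<partial>lborel)" .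
qed

end

text \<open>If \<open>g\<close> were negative at \<open>z\<close>, it would be negative on a ball,
  which has positive Lebesgue measure. This turns the almost everywhere bounds on the potential into
  pointwise bounds in \<open>D\<close>.\<close>

lemma continuous_AE_nonneg:
  fixes g :: "'a::euclidean_space \<Rightarrow> real"
  assumes D: "open D" and g: "continuous_on D g" and ae: "AE x in lebesgue. 0 \<le> g x" and z: "z \<in> D"
  shows "0 \<le> g z"
proof (rule ccontr)
  assume "\<not> 0 \<le> g z"
  have "open (D \<inter> g -` {..<0})" using continuous_open_preimage[OF g D] by simp
  moreover have "z \<in> D \<inter> g -` {..<0}" using \<open>\<not> 0 \<le> g z\<close> z by simp
  ultimately obtain e where e: "e > 0" "ball z e \<subseteq> D \<inter> g -` {..<0}" by (meson openE)
  have "AE x in lborel. 0 \<le> g x" using ae by (simp only: AE_completion_iff)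
  then obtain N where N: "N \<in> null_sets lborel" "{x. \<not> 0 \<le> g x} \<subseteq> N"
    unfolding eventually_ae_filter by auto
  have "ball z e \<subseteq> N"
  proof
    fix x assume "x \<in> ball z e"
    then have "g x < 0" using e(2) by blast
    then show "x \<in> N" using N(2) by auto
  qed
  then have "emeasure lborel (ball z e) \<le> emeasure lborel N" using N by (intro emeasure_mono) auto
  then have "emeasure lborel (ball z e) = 0" using N by (auto simp: null_sets_def)
  then have "measure lborel (ball z e) = 0" by (simp add: measure_def)
  then show False using content_ball_pos[OF e(1), of z] by simp
qed

text \<open>For \<open>s > 0\<close> the heat bound gives \<open>N\<close> probability 0, so by
  Tonelli almost every path avoids \<open>N\<close> at almost every time. The running integral
  therefore does not depend on the representative of the source.\<close>

lemma (in feynman_kac) AE_off_null_set: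
  assumes N: "N \<in> null_sets lborel"
    and heat: "\<And>t h. 0 < t \<Longrightarrow> h \<in> borel_measurable borel \<Longrightarrow>
      (\<integral>\<^sup>+\<omega>. h (x + Y t \<omega>) \<partial>M) \<le> ennreal (k t) * (\<integral>\<^sup>+y. h y \<partial>lborel)"
  shows "AE \<omega> in M. AE s in lborel. 0 \<le> s \<longrightarrow> x + Y s \<omega> \<notin> N"
proof -
  interpret MS: pair_sigma_finite M "lborel :: real measure" ..
  have [measurable]: "N \<in> sets borel" using N by auto
  have z: "(\<integral>\<^sup>+\<omega>. indicator N (right_eval (walk x \<omega>) s) * indicator {0<..} s \<partial>M) = (0::ennreal)" for s :: real
  proof (cases "0 < s")
    case True
    have "(\<integral>\<^sup>+\<omega>. indicator N (x + Y s \<omega>) \<partial>M) \<le> ennreal (k s) * (\<integral>\<^sup>+y. indicator N y \<partial>lborel)"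
      using True by (intro heat) auto
    then show ?thesis using True N by (simp add: null_sets_def)
  qed simp
  have "(\<integral>\<^sup>+\<omega>. \<integral>\<^sup>+s. indicator N (right_eval (walk x \<omega>) s) * indicator {0<..} s \<partial>lborel \<partial>M) =
    (\<integral>\<^sup>+s. \<integral>\<^sup>+\<omega>. indicator N (right_eval (walk x \<omega>) s) * indicator {0<..} s \<partial>M \<partial>lborel)"
    by (rule MS.Fubini'[symmetric]) measurable
  also have "\<dots> = (0::ennreal)" unfolding z by simp
  finally have "(\<integral>\<^sup>+\<omega>. \<integral>\<^sup>+s. indicator N (right_eval (walk x \<omega>) s) * indicator {0<..} s \<partial>lborel \<partial>M) = (0::ennreal)" .
  moreover have "(\<lambda>\<omega>. \<integral>\<^sup>+s. indicator N (right_eval (walk x \<omega>) s) * indicator {0<..} s \<partial>lborel :: ennreal) \<in> borel_measurable M"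
    by measurable
  ultimately have ae: "AE \<omega> in M. (\<integral>\<^sup>+s. indicator N (right_eval (walk x \<omega>) s) * indicator {0<..} s \<partial>lborel) = (0::ennreal)"
    by (subst (asm) nn_integral_0_iff_AE) auto
  show ?thesis
  proof (rule AE_mp[OF ae], rule AE_I2, rule impI)
    fix \<omega> assume \<omega>: "\<omega> \<in> space M" and 0: "(\<integral>\<^sup>+s. indicator N (right_eval (walk x \<omega>) s) * indicator {0<..} s \<partial>lborel) = (0::ennreal)"
    have [measurable]: "(\<lambda>s. right_eval (walk x \<omega>) s) \<in> borel_measurable borel"
      using measurable_right_eval_X[of "\<lambda>_. x" borel "\<lambda>_. \<omega>" "\<lambda>s. s"] \<omega> by simp
    have "AE s in lborel. indicator N (right_eval (walk x \<omega>) s) * indicator {0<..} s = (0::ennreal)"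
      using 0 by (subst (asm) nn_integral_0_iff_AE) auto
    with AE_lborel_singleton[of 0] show "AE s in lborel. 0 \<le> s \<longrightarrow> x + Y s \<omega> \<notin> N"
      by eventually_elim (auto simp: indicator_def split: if_splits)
  qed
qed

lemma regular_boundary_exits:
  fixes X :: "real \<Rightarrow> 'w \<Rightarrow> 'a::euclidean_space"
  assumes "regular_boundary M X D" and XY: "AE \<omega> in M. \<forall>t. X t \<omega> = Y t \<omega>" and z: "z \<in> frontier D"
  shows "AE \<omega> in M. \<forall>t>0. \<exists>r. 0 < r \<and> r \<le> t \<and> z + Y r \<omega> \<notin> D"
proof -
  have "AE \<omega> in M. exit_time D (path_from X z \<omega>) = 0" using assms(1) z by (simp add: regular_boundary_def)
  with XY show ?thesis
  proof eventually_elim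
    case (elim \<omega>)
    show ?case
    proof (intro allI impI)
      fix t :: real assume "0 < t"
      then have "Inf (ereal ` {t. t > 0 \<and> path_from X z \<omega> t \<notin> D}) < ereal t"
        using elim(2) by (simp add: exit_time_def)
      then obtain r where "0 < r" "r < t" "path_from X z \<omega> r \<notin> D" unfolding Inf_less_iff by auto
      then show "\<exists>r. 0 < r \<and> r \<le> t \<and> z + Y r \<omega> \<notin> D"
        using elim(1) by (intro exI[of _ r]) (auto simp: path_from_def)
    qed
  qed
qed

theorem theorem3p3:
  fixes M :: "'w measure"
    and X :: "real \<Rightarrow> 'w \<Rightarrow> 'a::euclidean_space"
    and \<Psi> :: "real \<Rightarrow> real"
    and \<mu> c \<theta> p :: real
    and D :: "'a set"
    and V f :: "'a \<Rightarrow> real"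
  assumes "bernstein0 \<Psi>" and "strict_mono_on {0<..} \<Psi>"
    and "\<mu> > 0" and "0 < c" and "c \<le> 1" and "\<theta> \<ge> 0"
    and "weak_lower_scaling \<Psi> \<mu> c \<theta>"
    and "subordinate_brownian_motion M \<Psi> X"
    and "open D" and "connected D" and "bounded D"
    and "regular_boundary M X D"
    and "Linfty V" and "AE x in lebesgue. V x \<ge> 0"
    and "\<exists>U. open U \<and> D \<subseteq> U \<and> continuous_on U V"
    and "p \<ge> 1" and "p > real DIM('a) / (2 * \<mu>)"
    and "Lp_on p D f"
  shows "\<exists>!\<phi>. weak_solution M X D V f \<phi>"
proof -
  obtain B S where BS: "brownian_motion M B" "subordinator M \<Psi> S"
      "prob_space.indep_set M (process_events M B) (process_events M S)" and X: "X = (\<lambda>t \<omega>. B (S t \<omega>) \<omega>)"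
    using \<open>subordinate_brownian_motion M \<Psi> X\<close> unfolding subordinate_brownian_motion_def by blast
  interpret subordinated_bm M \<Psi> B S by unfold_locales fact+
  have XY: "AE \<omega> in M. \<forall>t. X t \<omega> = Y t \<omega>" using AE_Y by (simp add: X)
  have D[measurable]: "D \<in> sets borel" using \<open>open D\<close> by simp

  \<comment> \<open>Strictly between \<open>d / (2 * \<mu>)\<close> and \<open>p\<close>, with
    \<open>d = DIM('a)\<close>: the lower bound controls the negative moment of order
    \<open>d / 2\<close> of the clock, the upper one makes the Kato bound integrable in
    time.\<close>
  define b where "b = (real DIM('a) / (2 * \<mu>) + p) / 2"
  have b: "real DIM('a) / (2 * \<mu>) < b" "b < p" using \<open>p > real DIM('a) / (2 * \<mu>)\<close> by (auto simp: b_def)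
  have b0: "0 < b" using b(1) \<open>\<mu> > 0\<close> by (meson divide_nonneg_pos le_less_trans mult_pos_pos of_nat_0_le_iff zero_less_numeral)
  have ab: "real DIM('a) / 2 < \<mu> * b" using b(1) \<open>\<mu> > 0\<close> by (simp add: field_simps)
  have "\<And>u. 0 < u \<Longrightarrow> 0 \<le> \<Psi> u" using \<open>bernstein0 \<Psi>\<close> unfolding bernstein0_def by blast
  then obtain C0 where C0: "0 < C0" "\<And>n::nat. C0 * (2 powr \<mu>) ^ n \<le> \<Psi> (2 ^ n)"
    using weak_lower_scaling_dyadic[of \<Psi> \<mu> c \<theta>] assms(2-7) by blast
  obtain K where K: "0 \<le> K" "\<And>t. 0 < t \<Longrightarrow> (\<integral>\<^sup>+\<omega>. small_moment (DIM('a) / 2) (S t \<omega>) \<partial>M) \<le> ennreal (1 + K * t powr (- b))"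
    using small_moment_bound[OF C0 _ ab b0] by auto
  note pos = heat_bound(1)[OF K] and heat = heat_bound(2)[OF K]

  have VD: "continuous_on D V" using assms(15) continuous_on_subset by blast
  have V0: "0 \<le> V x" if "x \<in> D" for x
    using continuous_AE_nonneg[OF \<open>open D\<close> VD _ that] assms(14) by simp
  obtain C1 where "AE x in lebesgue. \<bar>V x\<bar> \<le> C1" using \<open>Linfty V\<close> unfolding Linfty_def by blast
  then have "AE x in lebesgue. 0 \<le> C1 - V x" by eventually_elim simp
  then have V1: "V x \<le> C1" if "x \<in> D" for x
    using continuous_AE_nonneg[OF \<open>open D\<close> _ _ that, of "\<lambda>x. C1 - V x"] VD by (simp add: continuous_intros)
  \<comment> \<open>Only values in \<open>D\<close> enter the equation; cut off outside, the
    potential is Borel, nonnegative and bounded everywhere.\<close>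
  define V' where "V' x = indicator D x *\<^sub>R V x" for x
  interpret F: feynman_kac M Y D V' "max 0 C1"
  proof
    show "V' \<in> borel_measurable borel"
      unfolding V'_def[abs_def] using VD by (intro borel_measurable_continuous_on_indicator) auto
    show "0 \<le> V' x" "V' x \<le> max 0 C1" for x using V0[of x] V1[of x] by (auto simp: V'_def indicator_def)
    show "(\<lambda>n. \<integral>\<^sup>+\<omega>. ennreal (h (z n + Y t \<omega>)) \<partial>M) \<longlonglongrightarrow> (\<integral>\<^sup>+\<omega>. ennreal (h (x + Y t \<omega>)) \<partial>M)"
      if "0 < t" "h \<in> borel_measurable borel" "\<And>y. 0 \<le> h y" "\<And>y. h y \<le> c" "\<And>y. y \<notin> D \<Longrightarrow> h y = 0" "z \<longlonglongrightarrow> x"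
      for t h c x and z :: "nat \<Rightarrow> 'a"
      by (rule strong_feller[where c=c and D=D]) (use that pos \<open>bounded D\<close> in auto)
    show "prob {\<omega>\<in>space M. norm (Y 1 \<omega>) \<le> diameter D} < 1"
      by (rule prob_ball_less_1) (use pos in auto)
    show "AE \<omega> in M. \<forall>t>0. \<exists>r. 0 < r \<and> r \<le> t \<and> z + Y r \<omega> \<notin> D" if "z \<in> frontier D" for z
      by (rule regular_boundary_exits) fact+
  qed fact+
  have V': "V x = V' x" if "x \<in> D" for x using that by (simp add: V'_def)

  have "(\<lambda>x. indicator D x *\<^sub>R f x) \<in> borel_measurable lebesgue"
    using \<open>Lp_on p D f\<close> by (simp add: Lp_on_def set_borel_measurable_def)
  \<comment> \<open>The source is only Lebesgue measurable, while composition with the process calls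
    for a Borel function. \<open>f1\<close> vanishes almost everywhere off \<open>D\<close>, so its
    p-th power integral over the whole space is that of \<open>f\<close> over
    \<open>D\<close>.\<close>
  then obtain f1 where [measurable]: "f1 \<in> borel_measurable lborel" and f1: "AE x in lborel. indicator D x *\<^sub>R f x = f1 x"
    using completion_ex_borel_measurable_real by blast
  define A where "A = (LINT x|lebesgue. indicator D x *\<^sub>R (\<bar>f x\<bar> powr p))"
  have A: "0 \<le> A" unfolding A_def by (intro Bochner_Integration.integral_nonneg) auto
  have "(\<integral>\<^sup>+y. ennreal (\<bar>f1 y\<bar> powr p) \<partial>lborel) = (\<integral>\<^sup>+y. ennreal (indicator D y *\<^sub>R (\<bar>f y\<bar> powr p)) \<partial>lborel)"
  proof (rule nn_integral_cong_AE)
    show "AE y in lborel. ennreal (\<bar>f1 y\<bar> powr p) = ennreal (indicator D y *\<^sub>R (\<bar>f y\<bar> powr p))"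
      using f1 by eventually_elim (auto simp: indicator_def split: if_splits)
  qed
  also have "\<dots> = (\<integral>\<^sup>+y. ennreal (indicator D y *\<^sub>R (\<bar>f y\<bar> powr p)) \<partial>lebesgue)"
    by (rule nn_integral_completion[symmetric])
  also have "\<dots> = ennreal A"
    unfolding A_def using \<open>Lp_on p D f\<close>
    by (intro nn_integral_eq_integral) (auto simp: Lp_on_def set_integrable_def)
  finally have fA: "(\<integral>\<^sup>+y. ennreal (\<bar>f1 y\<bar> powr p) \<partial>lborel) \<le> ennreal A" by simp
  have "\<exists>\<kappa>. (\<forall>e>0. 0 \<le> \<kappa> e) \<and> (\<forall>e>0. \<forall>x. (\<integral>\<^sup>+s. (\<integral>\<^sup>+\<omega>. ennreal \<bar>f1 (right_eval (\<lambda>r. x + Y r \<omega>) s)\<bar> \<partial>M) * indicator {0..<e} s \<partial>lborel) \<le> ennreal (\<kappa> e)) \<and>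
    (\<kappa> \<longlongrightarrow> 0) (at_right 0)"
    by (rule kato_bound[OF K(1) heat _ _ fA A \<open>p \<ge> 1\<close> b0 b(2)]) auto
  then obtain \<kappa> where \<kappa>: "\<And>e. 0 < e \<Longrightarrow> 0 \<le> \<kappa> e"
    "\<And>e x. 0 < e \<Longrightarrow> (\<integral>\<^sup>+s. (\<integral>\<^sup>+\<omega>. ennreal \<bar>f1 (right_eval (\<lambda>r. x + Y r \<omega>) s)\<bar> \<partial>M) * indicator {0..<e} s \<partial>lborel) \<le> ennreal (\<kappa> e)"
    "(\<kappa> \<longlongrightarrow> 0) (at_right 0)" by blast
  \<comment> \<open>The positive and the negative part of \<open>f1\<close> are both dominated by
    its absolute value, so one \<open>\<kappa>\<close> serves both.\<close>
  have part: "\<exists>\<phi>. F.solves g \<phi>" if [measurable]: "g \<in> borel_measurable borel" and g: "\<And>x. 0 \<le> g x" "\<And>x. g x \<le> \<bar>f1 x\<bar>" for g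
  proof (rule F.solves_nonneg[OF _ g(1) \<kappa>(1) _ \<kappa>(3)])
    fix e :: real and x assume "0 < e"
    then show "(\<integral>\<^sup>+s. (\<integral>\<^sup>+\<omega>. ennreal (g (right_eval (\<lambda>r. x + Y r \<omega>) s)) \<partial>M) * indicator {0..<e} s \<partial>lborel) \<le> ennreal (\<kappa> e)"
      by (intro order_trans[OF _ \<kappa>(2)[of e x]] nn_integral_mono mult_right_mono ennreal_leI g) auto
  qed auto
  have "\<exists>\<phi>. F.solves (\<lambda>x. max 0 (f1 x)) \<phi>" "\<exists>\<phi>. F.solves (\<lambda>x. max 0 (- f1 x)) \<phi>"
    by (rule part; simp add: abs_ge_self abs_ge_minus_self)+
  then obtain \<phi>1 \<phi>2 where \<phi>1: "F.solves (\<lambda>x. max 0 (f1 x)) \<phi>1" and \<phi>2: "F.solves (\<lambda>x. max 0 (- f1 x)) \<phi>2"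
    by blast
  have "(\<lambda>x. max 0 (f1 x) - max 0 (- f1 x)) = f1" by (rule ext) auto
  with F.solves_diff[OF \<phi>1 \<phi>2] have sol: "F.solves f1 (\<lambda>x. \<phi>1 x - \<phi>2 x)" by simp

  obtain N where N: "N \<in> null_sets lborel" "{x. indicator D x *\<^sub>R f x \<noteq> f1 x} \<subseteq> N"
    using f1 unfolding eventually_ae_filter by auto
  have off: "AE \<omega> in M. AE s in lborel. 0 \<le> s \<longrightarrow> x + Y s \<omega> \<notin> N" for x
    by (rule F.AE_off_null_set[OF N(1)]) (rule heat)
  have "AE \<omega> in M. AE s in lborel. 0 \<le> s \<longrightarrow> x + Y s \<omega> \<in> D \<longrightarrow> f (x + Y s \<omega>) = f1 (x + Y s \<omega>)" for x
    using off[of x]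
  proof eventually_elim
    case (elim \<omega>)
    then show ?case
    proof eventually_elim
      case (elim s)
      show ?case
      proof (intro impI)
        assume "0 \<le> s" "x + Y s \<omega> \<in> D"
        then have "indicator D (x + Y s \<omega>) *\<^sub>R f (x + Y s \<omega>) = f1 (x + Y s \<omega>)" using elim N(2) by blast
        then show "f (x + Y s \<omega>) = f1 (x + Y s \<omega>)" using \<open>x + Y s \<omega> \<in> D\<close> by simp
      qed
    qed
  qed
  from F.weak_solutionI[OF XY V' sol this]
  show ?thesis using F.weak_solution_unique[OF XY V'] by blast
qed

end
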